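(* Let $E$ be a real Hilbert space, let $1\le p\le\infty$, and let $E\otimes E$ be the completion of the algebraic tensor product $E\otimes_a E$ with respect to the Schatten $p$-norm. Let $T>0$ and $\alpha\in(1/3,1/2)$. Let $\mathscr{C}^\alpha_g([0,T],E)$ and $\mathscr{C}^\alpha_{wg}([0,T],E)$ denote respectively the set of geometric $\alpha$-rough paths and the set of weakly geometric $\alpha$-rough paths in $E$ on $[0,T]$, relative to this tensor norm. Then for any $\beta\in(1/3,\alpha)$ we have inclusions $$\mathscr{C}_g^{\alpha}([0,T],E)\subset\mathscr{C}^{\alpha}_{wg}([0,T],E)\subset\mathscr{C}_g^{\beta}([0,T],E).$$
   Context: Schatten norm: $E\otimes_a E$ is identified with the finite rank operators on $E$; the Schatten $p$-norm of an operator is the $\ell^p$-norm of its sequence of singular values (so $p=1$ is the trace norm, i.e. the projective tensor norm; $p=2$ the Hilbert–Schmidt norm; $p=\infty$ the operator norm, i.e. the injective tensor norm). It is denoted $\|\cdot\|_\otimes$. Rough paths: an $\alpha$-rough path is a pair $(x,x^{(2)})$ with $x:[0,T]\to E$ and $x^{(2)}:[0,T]^2\to E\otimes E$ such that, for some constant, $\|x_t-x_s\|\lesssim|t-s|^\alpha$, $\|x^{(2)}_{st}\|_\otimes\lesssim|t-s|^{2\alpha}$, and Chen's relation $x^{(2)}_{st}-x^{(2)}_{su}-x^{(2)}_{ut}=(x_u-x_s)\otimes(x_t-x_u)$ holds. It is identified with $\mathbf{x}_{st}=1+x_{st}+x^{(2)}_{st}$, $x_{st}=x_t-x_s$, with values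 in $1+E\oplus(E\otimes E)$, a group under the truncated tensor product $(1+x+x^{(2)})(1+y+y^{(2)})=1+(x+y)+(x^{(2)}+x\otimes y+y^{(2)})$. Chen's relation reads $\mathbf{x}_{st}=\mathbf{x}_{su}\mathbf{x}_{ut}$. Distance: for $\mathbf{x}=1+x+x^{(2)}$ put $|\mathbf{x}|=\max\{\|x\|,\|x^{(2)}\|_\otimes^{1/2}\}$, $d(\mathbf{x},\mathbf{y})=|\mathbf{x}^{-1}\mathbf{y}|$, and for $\alpha$-rough paths $$d_\alpha(\mathbf{x},\mathbf{y})=\sup_{0\le s<t\le T}\frac{d(\mathbf{x}_{st},\mathbf{y}_{st})}{|t-s|^\alpha}.$$ Weakly geometric: an $\alpha$-rough path is weakly geometric if the symmetric part of $x^{(2)}_{st}$ equals $\frac12x_{st}\otimes x_{st}$ for all $s,t$. Geometric: $\mathscr{C}^\alpha_g([0,T],E)$ is the closure with respect to $d_\alpha$, in the set of $\alpha$-rough paths, of the set of canonical lifts $1+x_t-x_s+\int_s^t(x_r-x_s)\otimes dx_r$ of smooth paths $x:[0,T]\to E$. The same definitions apply with $\beta$ in place of $\alpha$. *)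

theory Defs
  imports "HOL-Analysis.Analysis"
begin

definition finite_rank :: "('a::real_normed_vector \<Rightarrow>\<^sub>L 'a) set" where
  "finite_rank = {A. \<exists>B. finite B \<and> range (blinfun_apply A) \<subseteq> span B}"

text \<open>The elementary tensor of \<open>x\<close> and \<open>y\<close>, as the operator sending \<open>z\<close> to \<open>(z \<bullet> y) *\<^sub>R x\<close>.\<close>

definition rank_one :: "'a::real_inner \<Rightarrow> 'a \<Rightarrow> 'a \<Rightarrow>\<^sub>L 'a" where
  "rank_one x y = blinfun_scaleR_left x o\<^sub>L blinfun_inner_left y"

text \<open>The singular values of \<open>A\<close> are the square roots of the eigenvalues of \<open>A* A\<close>, repeated
  according to multiplicity, in decreasing order. For \<open>A\<close> of finite rank the sequence ends in
  zeros and the following condition determines it. Finiteness of the fibres is required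
  explicitly because \<open>card\<close> of an infinite set is \<open>0\<close>.\<close>

definition is_singular_values :: "('a::real_inner \<Rightarrow>\<^sub>L 'a) \<Rightarrow> (nat \<Rightarrow> real) \<Rightarrow> bool" where
  "is_singular_values A s \<longleftrightarrow> decseq s \<and> (\<forall>n. 0 \<le> s n) \<and>
     (\<forall>\<sigma>>0. finite {n. s n = \<sigma>} \<and>
        card {n. s n = \<sigma>} = dim {v. adjoint (blinfun_apply A) (blinfun_apply A v) = \<sigma>\<^sup>2 *\<^sub>R v})"

definition singular_values :: "('a::real_inner \<Rightarrow>\<^sub>L 'a) \<Rightarrow> nat \<Rightarrow> real" where
  "singular_values A = (THE s. is_singular_values A s)"

definition lp_norm :: "ennreal \<Rightarrow> (nat \<Rightarrow> real) \<Rightarrow> real" where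
  "lp_norm p s =
     (if p = \<infinity> then (SUP n. \<bar>s n\<bar>)
      else (\<Sum>n. \<bar>s n\<bar> powr enn2real p) powr (1 / enn2real p))"

definition schatten_norm :: "ennreal \<Rightarrow> ('a::real_inner \<Rightarrow>\<^sub>L 'a) \<Rightarrow> real" where
  "schatten_norm p A = lp_norm p (singular_values A)"

text \<open>The Banach space \<open>'b\<close>, together with the embedding \<open>J\<close>, is the completion of the space of
  finite rank operators (that is, of the algebraic tensor product) in the Schatten \<open>p\<close>-norm:
  \<open>J\<close> is linear and isometric on finite rank operators, with dense range. Its values at other
  operators are irrelevant.\<close>

definition schatten_completion ::
    "ennreal \<Rightarrow> (('a::{real_inner,complete_space} \<Rightarrow>\<^sub>L 'a) \<Rightarrow> 'b::banach) \<Rightarrow> bool" where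
  "schatten_completion p J \<longleftrightarrow>
     (\<forall>A\<in>finite_rank. \<forall>B\<in>finite_rank. J (A + B) = J A + J B) \<and>
     (\<forall>c. \<forall>A\<in>finite_rank. J (c *\<^sub>R A) = c *\<^sub>R J A) \<and>
     (\<forall>A\<in>finite_rank. norm (J A) = schatten_norm p A) \<and>
     closure (J ` finite_rank) = UNIV"

definition tensor :: "(('a::real_inner \<Rightarrow>\<^sub>L 'a) \<Rightarrow> 'b) \<Rightarrow> 'a \<Rightarrow> 'a \<Rightarrow> 'b" where
  "tensor J x y = J (rank_one x y)"

text \<open>Below, \<open>tens\<close> always stands for the map sending \<open>x\<close> and \<open>y\<close> to their tensor product. The
  swap is the continuous linear map exchanging the two factors.\<close>

definition tensor_swap :: "('a \<Rightarrow> 'a \<Rightarrow> 'b::real_normed_vector) \<Rightarrow> 'b \<Rightarrow> 'b" where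
  "tensor_swap tens = (THE f. bounded_linear f \<and> (\<forall>x y. f (tens x y) = tens y x))"

definition sym_part :: "('a \<Rightarrow> 'a \<Rightarrow> 'b::real_normed_vector) \<Rightarrow> 'b \<Rightarrow> 'b" where
  "sym_part tens A = (1/2) *\<^sub>R (A + tensor_swap tens A)"

text \<open>The pair \<open>(x, X)\<close> stands for the group element \<open>1 + x + X\<close>.\<close>

definition grp_mult ::
    "('a \<Rightarrow> 'a \<Rightarrow> 'b) \<Rightarrow> 'a::ab_group_add \<times> 'b::ab_group_add \<Rightarrow> 'a \<times> 'b \<Rightarrow> 'a \<times> 'b" where
  "grp_mult tens g h = (fst g + fst h, snd g + tens (fst g) (fst h) + snd h)"

definition grp_inv :: "('a \<Rightarrow> 'a \<Rightarrow> 'b) \<Rightarrow> 'a::ab_group_add \<times> 'b::ab_group_add \<Rightarrow> 'a \<times> 'b" where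
  "grp_inv tens g = (- fst g, tens (fst g) (fst g) - snd g)"

lemma grp_inv_inverse:
  assumes "\<And>x y. tens (- x) y = - tens x y" and "\<And>x y. tens x (- y) = - tens x y"
  shows "grp_mult tens g (grp_inv tens g) = (0, 0)"
    and "grp_mult tens (grp_inv tens g) g = (0, 0)"
  by (simp_all add: grp_mult_def grp_inv_def assms)

definition grp_norm :: "'a::real_normed_vector \<times> 'b::real_normed_vector \<Rightarrow> real" where
  "grp_norm g = max (norm (fst g)) (sqrt (norm (snd g)))"

definition grp_dist :: "('a \<Rightarrow> 'a \<Rightarrow> 'b) \<Rightarrow>
    'a::real_normed_vector \<times> 'b::real_normed_vector \<Rightarrow> 'a \<times> 'b \<Rightarrow> real" where
  "grp_dist tens g h = grp_norm (grp_mult tens (grp_inv tens g) h)"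

text \<open>A rough path is given by total functions; no definition below depends on their values
  at times outside \<open>{0..T}\<close>.\<close>

type_synonym ('a, 'b) path2 = "(real \<Rightarrow> 'a) \<times> (real \<Rightarrow> real \<Rightarrow> 'b)"

definition path2_incr :: "('a::ab_group_add, 'b) path2 \<Rightarrow> real \<Rightarrow> real \<Rightarrow> 'a \<times> 'b" where
  "path2_incr X s t = (fst X t - fst X s, snd X s t)"

definition rough_paths :: "('a \<Rightarrow> 'a \<Rightarrow> 'b) \<Rightarrow> real \<Rightarrow> real \<Rightarrow>
    ('a::real_normed_vector, 'b::real_normed_vector) path2 set" where
  "rough_paths tens T \<alpha> = {(x, X).
     (\<exists>C. \<forall>s\<in>{0..T}. \<forall>t\<in>{0..T}.
        norm (x t - x s) \<le> C * \<bar>t - s\<bar> powr \<alpha> \<and>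
        norm (X s t) \<le> C * \<bar>t - s\<bar> powr (2 * \<alpha>)) \<and>
     (\<forall>s\<in>{0..T}. \<forall>u\<in>{0..T}. \<forall>t\<in>{0..T}.
        X s t - X s u - X u t = tens (x u - x s) (x t - x u))}"

definition rough_dist :: "('a \<Rightarrow> 'a \<Rightarrow> 'b) \<Rightarrow> real \<Rightarrow> real \<Rightarrow>
    ('a::real_normed_vector, 'b::real_normed_vector) path2 \<Rightarrow> ('a, 'b) path2 \<Rightarrow> ennreal" where
  "rough_dist tens T \<alpha> X Y =
     (SUP (s, t) \<in> {(s, t). 0 \<le> s \<and> s < t \<and> t \<le> T}.
        ennreal (grp_dist tens (path2_incr X s t) (path2_incr Y s t) / \<bar>t - s\<bar> powr \<alpha>))"

definition weakly_geometric :: "('a \<Rightarrow> 'a \<Rightarrow> 'b) \<Rightarrow> real \<Rightarrow> real \<Rightarrow>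
    ('a::real_normed_vector, 'b::real_normed_vector) path2 set" where
  "weakly_geometric tens T \<alpha> = {(x, X). (x, X) \<in> rough_paths tens T \<alpha> \<and>
     (\<forall>s\<in>{0..T}. \<forall>t\<in>{0..T}.
        sym_part tens (X s t) = (1/2) *\<^sub>R tens (x t - x s) (x t - x s))}"

text \<open>Smoothness on the closed interval, with one-sided derivatives at the end points;
  \<open>D n\<close> is the \<open>n\<close>-th derivative.\<close>

definition smooth_path :: "real \<Rightarrow> (real \<Rightarrow> 'a::real_normed_vector) \<Rightarrow> bool" where
  "smooth_path T x \<longleftrightarrow> (\<exists>D :: nat \<Rightarrow> real \<Rightarrow> 'a. (\<forall>t\<in>{0..T}. D 0 t = x t) \<and>
     (\<forall>n. \<forall>t\<in>{0..T}. (D n has_vector_derivative D (Suc n) t) (at t within {0..T})))"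

definition oriented_integral :: "real \<Rightarrow> real \<Rightarrow> (real \<Rightarrow> 'b::real_normed_vector) \<Rightarrow> 'b" where
  "oriented_integral s t f =
     (if s \<le> t then integral {s..t} f else - integral {t..s} f)"

definition canonical_lift :: "('a \<Rightarrow> 'a \<Rightarrow> 'b) \<Rightarrow> real \<Rightarrow> (real \<Rightarrow> 'a) \<Rightarrow>
    ('a::real_normed_vector, 'b::real_normed_vector) path2" where
  "canonical_lift tens T x =
     (x, \<lambda>s t. oriented_integral s t
            (\<lambda>r. tens (x r - x s) (vector_derivative x (at r within {0..T}))))"

definition geometric :: "('a \<Rightarrow> 'a \<Rightarrow> 'b) \<Rightarrow> real \<Rightarrow> real \<Rightarrow>
    ('a::real_normed_vector, 'b::real_normed_vector) path2 set" where
  "geometric tens T \<alpha> = {X \<in> rough_paths tens T \<alpha>.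
     \<forall>\<epsilon>>0. \<exists>x. smooth_path T x \<and> rough_dist tens T \<alpha> (canonical_lift tens T x) X < ennreal \<epsilon>}"

end

theory Submission
  imports Defs
begin

text \<open>
  The first inclusion holds because weak geometricity is a closed algebraic condition. A canonical
  lift satisfies it by integration by parts. If a weakly geometric element \<open>1 + y + Y\<close> is
  multiplied by \<open>1 + d + R\<close> to give \<open>1 + x + X\<close>, then the defect of \<open>X\<close>, its symmetric part
  minus \<open>x \<otimes> x / 2\<close>, is the symmetric part of \<open>R\<close> minus \<open>d \<otimes> d / 2\<close>; up to a
  constant it is bounded by the square of the homogeneous norm of \<open>1 + d + R\<close>, so it vanishes in the limit
  (\<open>geometric_subset_weakly_geometric\<close>).

  For the second inclusion a weakly geometric path is approximated in two steps. The distances are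
  measured on each level separately, by \<open>|t - s| powr \<beta>\<close> and \<open>|t - s| powr (2 * \<beta>)\<close>, so that the
  triangle inequality can be used.

  Step one replaces \<open>x\<close> by \<open>P x\<close> and \<open>X\<close> by \<open>P X P\<close> for an orthogonal projection \<open>P\<close> of finite
  rank (\<open>projection_close\<close>). Such projections contract both norms and converge to the identity
  uniformly on compact sets, here on the images of \<open>x\<close> and of \<open>X 0\<close>. Thus the increments of the
  projected path are uniformly close to the old ones and satisfy the same \<open>\<alpha>\<close>-Hoelder bounds;
  interpolation between the two facts gives closeness with the smaller exponent \<open>\<beta>\<close>.

  Step two takes place in a space of finite dimension \<open>n\<close>, where constants may depend on \<open>n\<close>
  because \<open>P\<close> is already fixed. An increment of size \<open>r\<close> is a product of \<open>1 + 4 n\<^sup>2\<close>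
  exponentials \<open>1 + v + v \<otimes> v / 2\<close> with \<open>norm v \<le> r\<close>: one straight segment, and one commutator,
  that is, one rectangular loop, for each ordered pair of basis
  vectors (\<open>word_prod_exists\<close>). A polygon that runs
  through these vectors inside each cell of a grid of mesh \<open>h\<close> has a lift that agrees with the given
  path on all grid points. Run through with a smooth step function, it becomes a smooth path with
  the same signature over each segment. Inside a cell its speed is of order \<open>h powr (\<alpha> - 1)\<close>, so at
  scales below \<open>h\<close> both paths are small of order \<open>h powr (\<alpha> - \<beta>)\<close> relative to \<open>|t - s| powr \<beta>\<close>, and by
  Chen's relation this controls their difference at all scales (\<open>close_from_grid\<close>,
  \<open>polygon_close\<close>). In both steps the gap between \<open>\<alpha>\<close> and \<open>\<beta>\<close> pays for the approximation.

  What has to be known about Schatten norms is little. They do not change under the adjoint or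
  under composition with an isometry, because these operations respect the multiplicities of the
  singular values. A projection is the mean \<open>(1 + U) / 2\<close> of the identity and a reflection, so its
  contractivity follows from invariance and the triangle inequality, and the latter holds since
  the Schatten norm is the restriction of the norm of the completion.
\<close>

section \<open>Finite rank operators on a Hilbert space\<close>

text \<open>
  The representing vector is the maximiser of \<open>2 * f x - x \<bullet> x\<close>. This functional is strictly
  concave, with the parallelogram law giving its exact defect of concavity, so every maximising
  sequence is Cauchy.
\<close>
lemma riesz_representation:
  fixes f :: "'a::{real_inner,complete_space} \<Rightarrow> real"
  assumes f: "bounded_linear f"
  obtains z where "\<And>x. f x = x \<bullet> z"
proof -
  interpret f: bounded_linear f by (rule f)
  define G where "G x = 2 * f x - x \<bullet> x" for x
  define s where "s = (SUP x. G x)"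
  obtain K where K: "\<And>x. \<bar>f x\<bar> \<le> norm x * K"
    using f.bounded by auto
  have "G x \<le> K\<^sup>2" for x
  proof -
    have "G x \<le> 2 * (norm x * K) - (norm x)\<^sup>2"
      using K[of x] by (simp add: G_def dot_square_norm)
    also have "\<dots> \<le> K\<^sup>2"
      using zero_le_power2[of "norm x - K"] by (simp add: power2_diff)
    finally show ?thesis .
  qed
  then have bdd: "bdd_above (range G)" by (auto intro!: bdd_aboveI)
  then have le_s: "G x \<le> s" for x
    unfolding s_def by (rule cSUP_upper[OF UNIV_I])
  have mid: "(dist x y)\<^sup>2 \<le> 2 * (s - G x) + 2 * (s - G y)" for x y
  proof -
    \<comment> \<open>the parallelogram law\<close>
    have "G ((1/2) *\<^sub>R (x + y)) = (G x + G y) / 2 + (dist x y)\<^sup>2 / 4"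
      by (simp add: G_def f.scaleR f.add dist_norm power2_norm_eq_inner inner_simps inner_commute)
        (simp add: field_simps)
    then show ?thesis using le_s[of "(1/2) *\<^sub>R (x + y)"] by (simp add: field_simps)
  qed
  have "\<exists>x. s - inverse (real (Suc n)) < G x" for n
    using less_cSUP_iff[OF _ bdd, of "s - inverse (real (Suc n))"] by (auto simp flip: s_def)
  then obtain x where x: "\<And>n. s - inverse (real (Suc n)) < G (x n)"
    by metis
  have "Cauchy x"
  proof (rule metric_CauchyI)
    fix e :: real
    assume "0 < e"
    then obtain N where N: "inverse (real (Suc N)) < e\<^sup>2 / 4"
      using reals_Archimedean[of "e\<^sup>2 / 4"] by auto
    have "dist (x m) (x n) < e" if "m \<ge> N" "n \<ge> N" for m n
    proof -
      have "s - G (x k) < e\<^sup>2 / 4" if "k \<ge> N" for k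
      proof -
        have "inverse (real (Suc k)) \<le> inverse (real (Suc N))"
          using that by (intro le_imp_inverse_le) auto
        then show ?thesis using x[of k] N by linarith
      qed
      from this[OF that(1)] this[OF that(2)] have "(dist (x m) (x n))\<^sup>2 < e\<^sup>2"
        using mid[of "x m" "x n"] by (simp add: field_simps)
      then show ?thesis using \<open>0 < e\<close> by (simp add: power_less_imp_less_base)
    qed
    then show "\<exists>M. \<forall>m\<ge>M. \<forall>n\<ge>M. dist (x m) (x n) < e" by blast
  qed
  then obtain z where z: "x \<longlonglongrightarrow> z" using Cauchy_convergent convergent_def by blast
  have "(\<lambda>n. G (x n)) \<longlonglongrightarrow> G z"
    unfolding G_def by (intro tendsto_intros f.tendsto z)
  moreover have "(\<lambda>n. s - inverse (real (Suc n))) \<longlonglongrightarrow> s"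
    using tendsto_diff[OF tendsto_const LIMSEQ_inverse_real_of_nat, of s] by simp
  ultimately have "s \<le> G z"
    using x by (intro LIMSEQ_le[of "\<lambda>n. s - inverse (real (Suc n))" s "\<lambda>n. G (x n)" "G z"])
       (auto intro: less_imp_le)
  have "f k = k \<bullet> z" for k
  proof (rule ccontr)
    define c where "c = f k - k \<bullet> z"
    assume "f k \<noteq> k \<bullet> z"
    then have "c \<noteq> 0" by (simp add: c_def)
    \<comment> \<open>maximality of \<open>G\<close> at \<open>z\<close> along the line with direction \<open>k\<close>\<close>
    have ineq: "2 * t * c \<le> t\<^sup>2 * (k \<bullet> k)" for t
    proof -
      have "G (z + t *\<^sub>R k) \<le> G z" using le_s \<open>s \<le> G z\<close> order_trans by blast
      then show ?thesis
        by (simp add: G_def c_def f.add f.scaleR inner_simps inner_commute power2_eq_square algebra_simps)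
    qed
    show False
    proof (cases "k \<bullet> k = 0")
      case True
      then show ?thesis using ineq[of c] \<open>c \<noteq> 0\<close> zero_less_mult_iff[of c c] by (auto simp: not_le)
    next
      case False
      then have pos: "0 < k \<bullet> k" by simp
      have "2 * (c / (k \<bullet> k)) * c \<le> (c / (k \<bullet> k))\<^sup>2 * (k \<bullet> k)" by (rule ineq)
      then have "2 * c\<^sup>2 \<le> c\<^sup>2" using pos by (simp add: field_simps power2_eq_square)
      then show False using \<open>c \<noteq> 0\<close> by simp
    qed
  qed
  then show thesis by (rule that)
qed

lemma rank_one_apply [simp]: "blinfun_apply (rank_one x y) z = (z \<bullet> y) *\<^sub>R x"
  by (simp add: rank_one_def)

lemma subspace_finite_rank: "subspace (finite_rank :: ('a::real_normed_vector \<Rightarrow>\<^sub>L 'a) set)"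
proof (rule subspaceI)
  show "0 \<in> (finite_rank :: ('a \<Rightarrow>\<^sub>L 'a) set)"
    by (auto simp: finite_rank_def intro!: exI[of _ "{}"])
next
  fix A B :: "'a \<Rightarrow>\<^sub>L 'a"
  assume "A \<in> finite_rank" "B \<in> finite_rank"
  then obtain S1 S2 where S: "finite S1" "range (blinfun_apply A) \<subseteq> span S1"
      "finite S2" "range (blinfun_apply B) \<subseteq> span S2"
    by (auto simp: finite_rank_def)
  have "A x + B x \<in> span (S1 \<union> S2)" for x
    using S span_mono[of S1 "S1 \<union> S2"] span_mono[of S2 "S1 \<union> S2"]
    by (intro span_add) blast+
  then show "A + B \<in> finite_rank"
    unfolding finite_rank_def using S by (auto simp: blinfun.add_left intro!: exI[of _ "S1 \<union> S2"])
next
  fix c :: real and A :: "'a \<Rightarrow>\<^sub>L 'a"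
  assume "A \<in> finite_rank"
  then show "c *\<^sub>R A \<in> finite_rank"
    unfolding finite_rank_def by (fastforce simp: blinfun.scaleR_left intro: span_scale)
qed

lemma rank_one_in_finite_rank [simp]: "rank_one x y \<in> finite_rank"
  unfolding finite_rank_def by (auto intro!: exI[of _ "{x}"] intro: span_scale span_base)

definition orthonormal :: "'a::real_inner set \<Rightarrow> bool" where
  "orthonormal B \<longleftrightarrow> (\<forall>b\<in>B. \<forall>c\<in>B. b \<bullet> c = (if b = c then 1 else 0))"

definition proj :: "'a::real_inner set \<Rightarrow> 'a \<Rightarrow> 'a" where
  "proj B x = (\<Sum>b\<in>B. (x \<bullet> b) *\<^sub>R b)"

lemma orthonormal_norm: "orthonormal B \<Longrightarrow> b \<in> B \<Longrightarrow> norm b = 1"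
  by (simp add: orthonormal_def norm_eq_sqrt_inner)

text \<open>Gram--Schmidt orthogonalisation, followed by normalising the nonzero vectors.\<close>
lemma orthonormal_basis_of_finite:
  fixes S :: "'a::real_inner set"
  assumes "finite S"
  obtains B where "finite B" "orthonormal B" "span B = span S"
proof -
  obtain C where C: "finite C" "span C = span S" "pairwise orthogonal C"
    using basis_orthogonal[OF assms] by blast
  define C' where "C' = C - {0}"
  define B where "B = (\<lambda>c. (1 / norm c) *\<^sub>R c) ` C'"
  have "span C' = span S" using C(2) by (simp add: C'_def)
  have "finite C'" "\<And>c. c \<in> C' \<Longrightarrow> 1 / norm c \<noteq> 0" by (auto simp: C'_def C)
  then have "span B = span C'"
    unfolding B_def using span_image_scale[of C' "\<lambda>c. 1 / norm c"] by simp
  moreover have "orthonormal B"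
    unfolding orthonormal_def B_def
  proof (clarify)
    fix b c
    assume bc: "b \<in> C'" "c \<in> C'"
    then have "b \<noteq> 0" by (simp add: C'_def)
    then have "(1 / norm b) *\<^sub>R b \<bullet> (1 / norm b) *\<^sub>R b = 1"
      by (simp add: dot_square_norm power2_eq_square)
    moreover have "(1 / norm b) *\<^sub>R b \<bullet> (1 / norm c) *\<^sub>R c = 0" if "b \<noteq> c"
      using C(3) bc that by (auto simp: C'_def pairwise_def orthogonal_def)
    ultimately show "(1 / norm b) *\<^sub>R b \<bullet> (1 / norm c) *\<^sub>R c =
        (if (1 / norm b) *\<^sub>R b = (1 / norm c) *\<^sub>R c then 1 else 0)"
      by (metis (full_types) zero_neq_one)
  qed
  moreover have "finite B" using \<open>finite C'\<close> by (simp add: B_def)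
  ultimately show thesis using that \<open>span C' = span S\<close> by simp
qed

lemma proj_add: "proj B (x + y) = proj B x + proj B y"
  by (simp add: proj_def inner_simps scaleR_add_left sum.distrib)

lemma proj_scaleR: "proj B (c *\<^sub>R x) = c *\<^sub>R proj B x"
  by (simp add: proj_def scaleR_sum_right)

lemma linear_proj: "linear (proj B)"
  by (intro linearI proj_add proj_scaleR)

lemma proj_inner_basis:
  assumes "finite B" "orthonormal B" "b \<in> B"
  shows "proj B x \<bullet> b = x \<bullet> b"
proof -
  have "proj B x \<bullet> b = (\<Sum>c\<in>B. (x \<bullet> c) * (if c = b then 1 else 0))"
    using assms by (auto simp: proj_def inner_sum_left orthonormal_def intro!: sum.cong)
  also have "\<dots> = x \<bullet> b" using assms by (simp add: sum.delta' if_distrib cong: if_cong)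
  finally show ?thesis .
qed

lemma proj_span:
  assumes "finite B" "orthonormal B" "x \<in> span B"
  shows "proj B x = x"
  using assms(3)
proof (induction rule: span_induct_alt)
  case base
  then show ?case by (simp add: proj_def)
next
  case (step c b y)
  have "proj B b = (\<Sum>c\<in>B. if c = b then b else 0)"
    unfolding proj_def using assms step(1) by (intro sum.cong) (auto simp: orthonormal_def)
  then have "proj B b = b" using assms(1) step(1) by simp
  then show ?case by (simp add: proj_add proj_scaleR step)
qed

lemma proj_inner_proj: "proj B x \<bullet> y = x \<bullet> proj B y"
  by (simp add: proj_def inner_sum_left inner_sum_right inner_commute mult.commute)

lemma proj_in_span: "proj B x \<in> span B"
  unfolding proj_def by (intro span_sum span_scale span_base)

lemma norm_proj_le:
  assumes "finite B" "orthonormal B"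
  shows "norm (proj B x) \<le> norm x"
proof (rule power2_le_imp_le)
  have "proj B x \<bullet> proj B x = proj B x \<bullet> x"
    using proj_inner_proj proj_span[OF assms proj_in_span] by metis
  then have "(norm x)\<^sup>2 = (norm (proj B x))\<^sup>2 + (norm (x - proj B x))\<^sup>2"
    by (simp add: power2_norm_eq_inner inner_simps inner_commute)
  then show "(norm (proj B x))\<^sup>2 \<le> (norm x)\<^sup>2" by simp
qed auto

text \<open>
  Expanding \<open>A x\<close> in an orthonormal basis of a space that contains the range, each coordinate is a
  bounded functional of \<open>x\<close>, hence an inner product with a fixed vector. Thus the finite rank
  operators are exactly the algebraic tensor product.
\<close>
lemma finite_rank_eq_span:
  "(finite_rank :: ('a::{real_inner,complete_space} \<Rightarrow>\<^sub>L 'a) set) = span {rank_one x y | x y. True}"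
proof
  show "span {rank_one x y | x y. True} \<subseteq> (finite_rank :: ('a \<Rightarrow>\<^sub>L 'a) set)"
    by (intro span_minimal subspace_finite_rank) auto
  show "(finite_rank :: ('a \<Rightarrow>\<^sub>L 'a) set) \<subseteq> span {rank_one x y | x y. True}"
  proof
    fix A :: "'a \<Rightarrow>\<^sub>L 'a"
    assume "A \<in> finite_rank"
    then obtain S where S: "finite S" "range (blinfun_apply A) \<subseteq> span S"
      by (auto simp: finite_rank_def)
    from S(1) obtain B where B: "finite B" "orthonormal B" "span B = span S"
      by (rule orthonormal_basis_of_finite)
    have "\<exists>w. \<forall>x. A x \<bullet> b = x \<bullet> w" for b
    proof -
      have "bounded_linear (\<lambda>x. A x \<bullet> b)" by (intro bounded_linear_intros)
      then show ?thesis using riesz_representation by metis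
    qed
    then obtain w where w: "\<And>b x. A x \<bullet> b = x \<bullet> w b" by metis
    have "A = (\<Sum>b\<in>B. rank_one b (w b))"
    proof (rule blinfun_eqI)
      fix x
      have "A x = proj B (A x)" using S B by (auto intro!: proj_span[symmetric])
      then show "A x = (\<Sum>b\<in>B. rank_one b (w b)) x"
        by (simp add: blinfun.sum_left proj_def w)
    qed
    moreover have "\<dots> \<in> span {rank_one x y | x y. True}"
      by (intro span_sum span_base) auto
    ultimately show "A \<in> span {rank_one x y | x y. True}" by simp
  qed
qed

lemma finite_rank_induct [consumes 1, case_names rank_one add]:
  fixes A :: "'a::{real_inner,complete_space} \<Rightarrow>\<^sub>L 'a"
  assumes "A \<in> finite_rank" "\<And>x y. P (rank_one x y)" "\<And>A B. A \<in> finite_rank \<Longrightarrow> B \<in> finite_rank \<Longrightarrow> P A \<Longrightarrow> P B \<Longrightarrow> P (A + B)"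
  shows "P A"
proof -
  have "A \<in> finite_rank \<and> P A"
    using assms(1) unfolding finite_rank_eq_span
  proof (induction rule: span_induct_alt)
    case base
    have "rank_one 0 0 = (0 :: 'a \<Rightarrow>\<^sub>L 'a)" by (rule blinfun_eqI) simp
    then show ?case using assms(2)[of 0 0] by (simp add: span_zero)
  next
    case (step c A B)
    then obtain x y where "A = rank_one x y" by auto
    moreover have "c *\<^sub>R rank_one x y = rank_one (c *\<^sub>R x) y" by (rule blinfun_eqI) (simp add: blinfun.scaleR_left)
    ultimately have eq: "c *\<^sub>R A + B = rank_one (c *\<^sub>R x) y + B" by simp
    have "B \<in> finite_rank" "P B" using step by (auto simp: finite_rank_eq_span)
    then have "rank_one (c *\<^sub>R x) y + B \<in> finite_rank" "P (rank_one (c *\<^sub>R x) y + B)"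
      by (auto intro!: assms(2,3) subspace_add[OF subspace_finite_rank])
    then show ?case unfolding eq finite_rank_eq_span by blast
  qed
  then show ?thesis ..
qed

lemma finite_rank_add: "A \<in> finite_rank \<Longrightarrow> B \<in> finite_rank \<Longrightarrow> A + B \<in> finite_rank"
  by (rule subspace_add[OF subspace_finite_rank])

lemma finite_rank_compose_left:
  assumes "A \<in> finite_rank"
  shows "L o\<^sub>L A \<in> finite_rank"
proof -
  obtain S where "finite S" "range (blinfun_apply A) \<subseteq> span S"
    using assms by (auto simp: finite_rank_def)
  then have "L (A x) \<in> span (blinfun_apply L ` S)" for x
    using linear_span_image[OF bounded_linear.linear[OF blinfun.bounded_linear_right], of L S] by auto
  then show ?thesis using \<open>finite S\<close> by (auto simp: finite_rank_def intro!: exI[of _ "blinfun_apply L ` S"])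
qed

lemma finite_rank_compose_right:
  assumes "A \<in> finite_rank"
  shows "A o\<^sub>L L \<in> finite_rank"
  using assms by (fastforce simp: finite_rank_def)

lemma finite_rank_has_adjoint:
  fixes A :: "'a::{real_inner,complete_space} \<Rightarrow>\<^sub>L 'a"
  assumes "A \<in> finite_rank"
  shows "\<exists>B\<in>finite_rank. \<forall>x y. A x \<bullet> y = x \<bullet> blinfun_apply B y"
  using assms
proof (induction rule: finite_rank_induct)
  case (rank_one x y)
  show ?case by (rule bexI[of _ "rank_one y x"]) (auto simp: inner_commute)
next
  case (add A B)
  then obtain A' B' where "A'\<in>finite_rank" "B' \<in> finite_rank"
    "\<forall>x y. A x \<bullet> y = x \<bullet> A' y" "\<forall>x y. B x \<bullet> y = x \<bullet> B' y" by blast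
  then show ?case
    by (intro bexI[of _ "A' + B'"]) (auto simp: blinfun.add_left inner_simps finite_rank_add)
qed

text \<open>
  The Hilbert space adjoint of a finite rank operator, as a bounded operator. Its existence reduces to
  the case of rank one.
\<close>
definition adj :: "('a::real_inner \<Rightarrow>\<^sub>L 'a) \<Rightarrow> 'a \<Rightarrow>\<^sub>L 'a" where
  "adj A = (SOME B. B \<in> finite_rank \<and> (\<forall>x y. A x \<bullet> y = x \<bullet> B y))"

lemma
  fixes A :: "'a::{real_inner,complete_space} \<Rightarrow>\<^sub>L 'a"
  assumes "A \<in> finite_rank"
  shows adj_finite_rank: "adj A \<in> finite_rank"
    and adj_inner: "A x \<bullet> y = x \<bullet> adj A y"
proof -
  have "adj A \<in> finite_rank \<and> (\<forall>x y. A x \<bullet> y = x \<bullet> adj A y)"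
    using someI_ex[OF finite_rank_has_adjoint[OF assms, unfolded Bex_def]] unfolding adj_def .
  then show "adj A \<in> finite_rank" "A x \<bullet> y = x \<bullet> adj A y" by auto
qed

lemma adj_eqI:
  fixes A :: "'a::{real_inner,complete_space} \<Rightarrow>\<^sub>L 'a"
  assumes "A \<in> finite_rank" "\<And>x y. A x \<bullet> y = x \<bullet> blinfun_apply B y"
  shows "adj A = B"
proof (rule blinfun_eqI)
  fix y
  have "x \<bullet> adj A y = x \<bullet> B y" for x using adj_inner[OF assms(1)] assms(2) by metis
  then have "(adj A y - B y) \<bullet> (adj A y - B y) = 0" by (simp add: inner_diff_right)
  then show "adj A y = B y" by simp
qed

lemma adj_rank_one: "adj (rank_one x y) = rank_one y (x :: 'a::{real_inner,complete_space})"
  by (rule adj_eqI) (auto simp: inner_commute)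

lemma adj_add:
  fixes A B :: "'a::{real_inner,complete_space} \<Rightarrow>\<^sub>L 'a"
  assumes "A \<in> finite_rank" "B \<in> finite_rank"
  shows "adj (A + B) = adj A + adj B"
  using assms by (intro adj_eqI finite_rank_add) (auto simp: blinfun.add_left inner_simps adj_inner)

lemma adj_scaleR:
  fixes A :: "'a::{real_inner,complete_space} \<Rightarrow>\<^sub>L 'a"
  assumes "A \<in> finite_rank"
  shows "adj (c *\<^sub>R A) = c *\<^sub>R adj A"
  using assms by (intro adj_eqI subspace_scale[OF subspace_finite_rank])
    (auto simp: blinfun.scaleR_left adj_inner)

lemma adj_adj:
  fixes A :: "'a::{real_inner,complete_space} \<Rightarrow>\<^sub>L 'a"
  assumes "A \<in> finite_rank"
  shows "adj (adj A) = A"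
  using assms adj_inner[OF assms] by (intro adj_eqI adj_finite_rank) (auto simp: inner_commute)

lemma adjoint_eq_adj:
  fixes A :: "'a::{real_inner,complete_space} \<Rightarrow>\<^sub>L 'a"
  assumes "A \<in> finite_rank"
  shows "adjoint (blinfun_apply A) = blinfun_apply (adj A)"
  using adj_inner[OF assms] by (intro adjoint_unique) simp

section \<open>Invariance properties of the Schatten norm\<close>

lemma dim_image_eq_inj_on_subspace:
  fixes f :: "'a::real_vector \<Rightarrow> 'b::real_vector"
  assumes f: "linear f" and V: "subspace V" and inj: "inj_on f V"
  shows "dim (f ` V) = dim V"
proof -
  obtain B where B: "B \<subseteq> V" "independent B" "V \<subseteq> span B" "card B = dim V"
    using basis_exists by blast
  have spB: "span B = V" using B V by (simp add: span_minimal subset_antisym)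
  have inj': "inj_on f (span B)" using inj spB by simp
  have "independent (f ` B)"
    by (rule linear_independent_injective_image[OF f B(2) inj'])
  moreover have "span (f ` B) = f ` V" using linear_span_image[OF f, of B] spB by simp
  ultimately have "dim (f ` V) = card (f ` B)"
    by (metis dim_span_eq_card_independent)
  also have "\<dots> = card B" by (rule card_image[OF inj_on_subset[OF inj B(1)]])
  finally show ?thesis using B(4) by simp
qed

text \<open>
  The eigenspace dimensions determine the predicate that characterises the sequence of singular
  values, hence also the sequence chosen by it.
\<close>
lemma schatten_norm_cong:
  assumes "\<And>\<sigma>. 0 < \<sigma> \<Longrightarrow>
    dim {v. adjoint (blinfun_apply A) (blinfun_apply A v) = \<sigma>\<^sup>2 *\<^sub>R v} =
    dim {v. adjoint (blinfun_apply B) (blinfun_apply B v) = \<sigma>\<^sup>2 *\<^sub>R v}"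
  shows "schatten_norm p A = schatten_norm p B"
proof -
  have "is_singular_values A = is_singular_values B"
    using assms by (auto simp: is_singular_values_def fun_eq_iff)
  then show ?thesis by (simp add: schatten_norm_def singular_values_def)
qed

text \<open>
  \<open>A\<close> maps the eigenspace of \<open>A* A\<close> for a positive eigenvalue \<open>\<sigma>\<^sup>2\<close> bijectively onto that of
  \<open>A A*\<close>; the inverse is \<open>A* / \<sigma>\<^sup>2\<close>.
\<close>
lemma schatten_norm_adj:
  fixes A :: "'a::{real_inner,complete_space} \<Rightarrow>\<^sub>L 'a"
  assumes A: "A \<in> finite_rank"
  shows "schatten_norm p (adj A) = schatten_norm p A"
proof (rule schatten_norm_cong)
  fix \<sigma> :: real
  assume "0 < \<sigma>"
  define V where "V = {v. adj A (A v) = \<sigma>\<^sup>2 *\<^sub>R v}"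
  define W where "W = {v. A (adj A v) = \<sigma>\<^sup>2 *\<^sub>R v}"
  have VW: "A ` V = W"
  proof
    show "A ` V \<subseteq> W" by (auto simp: V_def W_def blinfun.scaleR_right)
    show "W \<subseteq> A ` V"
    proof
      fix w assume "w \<in> W"
      then have "w = A ((1 / \<sigma>\<^sup>2) *\<^sub>R adj A w)" "(1 / \<sigma>\<^sup>2) *\<^sub>R adj A w \<in> V"
        using \<open>0 < \<sigma>\<close> by (auto simp: W_def V_def blinfun.scaleR_right)
      then show "w \<in> A ` V" by blast
    qed
  qed
  have "inj_on A V"
  proof (rule inj_onI)
    fix x y assume "x \<in> V" "y \<in> V" "A x = A y"
    then have "\<sigma>\<^sup>2 *\<^sub>R x = \<sigma>\<^sup>2 *\<^sub>R y" by (simp add: V_def)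
    then show "x = y" using \<open>0 < \<sigma>\<close> by simp
  qed
  moreover have "subspace V"
    unfolding V_def by (auto simp: subspace_def blinfun.zero_right blinfun.add_right blinfun.scaleR_right scaleR_add_right)
  moreover have "linear A" by (simp add: blinfun.bounded_linear_right bounded_linear.linear)
  ultimately have "dim W = dim V" using dim_image_eq_inj_on_subspace[of A V] VW by simp
  then show "dim {v. adjoint (blinfun_apply (adj A)) (blinfun_apply (adj A) v) = \<sigma>\<^sup>2 *\<^sub>R v} =
    dim {v. adjoint (blinfun_apply A) (blinfun_apply A v) = \<sigma>\<^sup>2 *\<^sub>R v}"
    by (simp add: adjoint_eq_adj[OF A] adjoint_eq_adj[OF adj_finite_rank[OF A]] adj_adj[OF A] V_def W_def)
qed

text \<open>Because \<open>(U A)* (U A) = A* A\<close>.\<close>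
lemma schatten_norm_isometry_left:
  fixes A U :: "'a::{real_inner,complete_space} \<Rightarrow>\<^sub>L 'a"
  assumes A: "A \<in> finite_rank" and U: "\<And>x y. U x \<bullet> U y = x \<bullet> y"
  shows "schatten_norm p (U o\<^sub>L A) = schatten_norm p A"
proof (rule schatten_norm_cong)
  fix \<sigma> :: real
  have UA: "U o\<^sub>L A \<in> finite_rank" by (rule finite_rank_compose_left[OF A])
  have "adj (U o\<^sub>L A) (U (A v)) = adj A (A v)" for v
  proof -
    have "x \<bullet> adj (U o\<^sub>L A) (U (A v)) = x \<bullet> adj A (A v)" for x
      using adj_inner[OF UA, of x "U (A v)"] adj_inner[OF A, of x "A v"] by (simp add: U)
    then have "(adj (U o\<^sub>L A) (U (A v)) - adj A (A v)) \<bullet> (adj (U o\<^sub>L A) (U (A v)) - adj A (A v)) = 0"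
      by (simp add: inner_diff_right)
    then show ?thesis by simp
  qed
  then show "dim {v. adjoint (blinfun_apply (U o\<^sub>L A)) (blinfun_apply (U o\<^sub>L A) v) = \<sigma>\<^sup>2 *\<^sub>R v} =
    dim {v. adjoint (blinfun_apply A) (blinfun_apply A v) = \<sigma>\<^sup>2 *\<^sub>R v}"
    by (simp add: adjoint_eq_adj[OF A] adjoint_eq_adj[OF UA])
qed

text \<open>
  For \<open>A = x \<otimes> y\<close> one has \<open>A* A v = (norm x)\<^sup>2 (v \<bullet> y) y\<close>, so the only possible positive eigenvalue is
  \<open>(norm x * norm y)\<^sup>2\<close>, with the line through \<open>y\<close> as its eigenspace.
\<close>
lemma is_singular_values_rank_one:
  fixes x y :: "'a::{real_inner,complete_space}"
  shows "is_singular_values (rank_one x y) s \<longleftrightarrow> s = (\<lambda>n. if n = 0 then norm x * norm y else 0)"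
proof -
  define N where "N = norm x * norm y"
  have dim: "dim {v. adjoint (blinfun_apply (rank_one x y)) (rank_one x y v) = \<sigma>\<^sup>2 *\<^sub>R v} =
    (if \<sigma> = N then 1 else 0)" if "0 < \<sigma>" for \<sigma>
  proof -
    define V where "V = {v. adjoint (blinfun_apply (rank_one x y)) (rank_one x y v) = \<sigma>\<^sup>2 *\<^sub>R v}"
    have V: "v \<in> V \<longleftrightarrow> ((v \<bullet> y) * (norm x)\<^sup>2) *\<^sub>R y = \<sigma>\<^sup>2 *\<^sub>R v" for v
      by (simp add: V_def adjoint_eq_adj adj_rank_one power2_norm_eq_inner)
    show ?thesis
    proof (cases "\<sigma> = N")
      case True
      then have "y \<noteq> 0" using that by (auto simp: N_def)
      have "V = span {y}"
      proof (rule set_eqI)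
        fix v
        have "v \<in> span {y}" if "v \<in> V"
        proof -
          have "v = (1 / \<sigma>\<^sup>2) *\<^sub>R (\<sigma>\<^sup>2 *\<^sub>R v)" using \<open>0 < \<sigma>\<close> by simp
          also have "\<dots> = (1 / \<sigma>\<^sup>2) *\<^sub>R (((v \<bullet> y) * (norm x)\<^sup>2) *\<^sub>R y)"
            using that unfolding V by simp
          finally have "v = (1 / \<sigma>\<^sup>2 * ((v \<bullet> y) * (norm x)\<^sup>2)) *\<^sub>R y"
            by simp
          then show ?thesis by (metis span_base span_scale singletonI)
        qed
        moreover have "v \<in> V" if "v \<in> span {y}"
          using that \<open>\<sigma> = N\<close> by (auto simp: span_singleton V N_def power_mult_distrib power2_norm_eq_inner mult_ac)
        ultimately show "v \<in> V \<longleftrightarrow> v \<in> span {y}" by blast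
      qed
      moreover have "independent {y}" using \<open>y \<noteq> 0\<close> by simp
      ultimately have "dim V = 1" using dim_span_eq_card_independent[of "{y}"] by simp
      then show ?thesis using True by (simp add: V_def)
    next
      case False
      have "v = 0" if "v \<in> V" for v
      proof -
        have eq: "((v \<bullet> y) * (norm x)\<^sup>2) *\<^sub>R y = \<sigma>\<^sup>2 *\<^sub>R v" using that V by simp
        then have "(((v \<bullet> y) * (norm x)\<^sup>2) *\<^sub>R y) \<bullet> y = (\<sigma>\<^sup>2 *\<^sub>R v) \<bullet> y" by simp
        then have "(v \<bullet> y) * N\<^sup>2 = (v \<bullet> y) * \<sigma>\<^sup>2"
          by (simp add: N_def power_mult_distrib power2_norm_eq_inner mult_ac)
        moreover have "N\<^sup>2 \<noteq> \<sigma>\<^sup>2"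
          using False \<open>0 < \<sigma>\<close> by (simp add: N_def)
        ultimately have "v \<bullet> y = 0" by simp
        then show "v = 0" using eq \<open>0 < \<sigma>\<close> by simp
      qed
      moreover have "0 \<in> V" by (simp add: V)
      ultimately have "V = {0}" by auto
      then have V_eq: "V = span {}" by simp
      have "dim V = card ({} :: 'a set)"
        unfolding V_eq by (rule dim_span_eq_card_independent[OF independent_empty])
      then have "dim V = 0" by simp
      then show ?thesis using False by (simp add: V_def)
    qed
  qed
  have "is_singular_values (rank_one x y) s \<longleftrightarrow> decseq s \<and> (\<forall>n. 0 \<le> s n) \<and>
     (\<forall>\<sigma>>0. finite {n. s n = \<sigma>} \<and> card {n. s n = \<sigma>} = (if \<sigma> = N then 1 else 0))"
    unfolding is_singular_values_def using dim by auto
  also have "\<dots> \<longleftrightarrow> s = (\<lambda>n. if n = 0 then N else 0)"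
  proof (rule iffI)
    assume "decseq s \<and> (\<forall>n. 0 \<le> s n) \<and>
      (\<forall>\<sigma>>0. finite {n. s n = \<sigma>} \<and> card {n. s n = \<sigma>} = (if \<sigma> = N then 1 else 0))"
    then have s: "decseq s" "\<forall>n. 0 \<le> s n" and
      c: "\<forall>\<sigma>>0. finite {n. s n = \<sigma>} \<and> card {n. s n = \<sigma>} = (if \<sigma> = N then 1 else 0)" by simp_all
    have other: "s n = N" if "s n \<noteq> 0" for n
    proof (rule ccontr)
      assume "s n \<noteq> N"
      moreover have "0 < s n" using s(2) that by (simp add: less_le)
      ultimately have "finite {m. s m = s n}" "card {m. s m = s n} = 0" using c by auto
      then show False by auto
    qed
    show "s = (\<lambda>n. if n = 0 then N else 0)"
    proof (cases "N = 0")
      case True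
      then show ?thesis using other by (auto simp: fun_eq_iff)
    next
      case False
      then have "0 < N" by (simp add: N_def less_le)
      then have "card {n. s n = N} = 1" using c by auto
      then obtain k where k: "{n. s n = N} = {k}" by (auto simp: card_1_singleton_iff)
      then have "s k = N" by blast
      then have "s 0 \<ge> N" using decseqD[OF s(1), of 0 k] by simp
      then have "s 0 = N" using other[of 0] \<open>0 < N\<close> by auto
      then have "0 \<in> {n. s n = N}" by simp
      then have "k = 0" unfolding k by simp
      have "s n = (if n = 0 then N else 0)" for n
      proof (cases "n = 0")
        case True
        then show ?thesis using \<open>s 0 = N\<close> by simp
      next
        case False
        then have "n \<notin> {n. s n = N}" unfolding k using \<open>k = 0\<close> by simp
        then have "s n \<noteq> N" by simp
        then show ?thesis using False other[of n] by (cases "s n = 0") simp_all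
      qed
      then show ?thesis by blast
    qed
  next
    assume s: "s = (\<lambda>n. if n = 0 then N else 0)"
    have "0 \<le> N" by (simp add: N_def)
    have "{n. s n = \<sigma>} = (if \<sigma> = N then {0} else {})" if "0 < \<sigma>" for \<sigma>
      using s that by auto
    then have "\<forall>\<sigma>>0. finite {n. s n = \<sigma>} \<and> card {n. s n = \<sigma>} = (if \<sigma> = N then 1 else 0)"
      by simp
    moreover have "decseq s" "\<forall>n. 0 \<le> s n" using s \<open>0 \<le> N\<close> by (auto simp: decseq_def)
    ultimately show "decseq s \<and> (\<forall>n. 0 \<le> s n) \<and>
      (\<forall>\<sigma>>0. finite {n. s n = \<sigma>} \<and> card {n. s n = \<sigma>} = (if \<sigma> = N then 1 else 0))" by simp
  qed
  finally show ?thesis unfolding N_def .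
qed

lemma schatten_norm_rank_one:
  fixes x y :: "'a::{real_inner,complete_space}"
  assumes "1 \<le> p"
  shows "schatten_norm p (rank_one x y) = norm x * norm y"
proof -
  define N where "N = norm x * norm y"
  have "0 \<le> N" by (simp add: N_def)
  have sv: "singular_values (rank_one x y) = (\<lambda>n. if n = 0 then N else 0)"
    unfolding singular_values_def is_singular_values_rank_one N_def by simp
  have "lp_norm p (\<lambda>n. if n = 0 then N else 0) = N"
  proof (cases "p = \<infinity>")
    case True
    have "(SUP n::nat. \<bar>if n = 0 then N else 0\<bar>) = N"
      using \<open>0 \<le> N\<close> by (intro cSup_eq_maximum) (auto intro!: image_eqI[of _ _ 0])
    then show ?thesis using True by (simp add: lp_norm_def)
  next
    case False
    then have "0 < enn2real p" using assms
      by (metis enn2real_positive_iff infinity_ennreal_def less_le_trans less_one top.not_eq_extremum zero_less_one)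
    have "(\<lambda>n::nat. \<bar>if n = 0 then N else 0\<bar> powr enn2real p) = (\<lambda>n. if n = 0 then N powr enn2real p else 0)"
      using \<open>0 \<le> N\<close> by auto
    then have "(\<Sum>n::nat. \<bar>if n = 0 then N else 0\<bar> powr enn2real p) = N powr enn2real p"
      using sums_single[of 0 "\<lambda>_. N powr enn2real p"] by (simp add: sums_iff)
    then show ?thesis using False \<open>0 < enn2real p\<close> \<open>0 \<le> N\<close>
      by (simp add: lp_norm_def powr_powr)
  qed
  then show ?thesis by (simp add: schatten_norm_def sv N_def)
qed

section \<open>The completed tensor product\<close>

text \<open>
  Extension of a bounded linear map from a dense subspace, in a form suited to a completion that is
  given by a map \<open>J\<close> from the incomplete space. The bound makes \<open>L\<close> factor through \<open>J\<close>.
\<close>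
lemma bounded_linear_extension_of_dense:
  fixes J :: "'c::real_vector \<Rightarrow> 'b::real_normed_vector" and L :: "'c \<Rightarrow> 'd::banach"
  assumes S: "subspace S"
    and J_add: "\<And>a b. a \<in> S \<Longrightarrow> b \<in> S \<Longrightarrow> J (a + b) = J a + J b"
    and J_scaleR: "\<And>r a. a \<in> S \<Longrightarrow> J (r *\<^sub>R a) = r *\<^sub>R J a"
    and L_add: "\<And>a b. a \<in> S \<Longrightarrow> b \<in> S \<Longrightarrow> L (a + b) = L a + L b"
    and L_scaleR: "\<And>r a. a \<in> S \<Longrightarrow> L (r *\<^sub>R a) = r *\<^sub>R L a"
    and bound: "\<And>a. a \<in> S \<Longrightarrow> norm (L a) \<le> K * norm (J a)"
    and dense: "closure (J ` S) = UNIV"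
  shows "\<exists>g. bounded_linear g \<and> (\<forall>a\<in>S. g (J a) = L a) \<and> (\<forall>x. norm (g x) \<le> K * norm x)"
proof -
  have diff: "norm (L a - L b) \<le> K * norm (J a - J b)" if "a \<in> S" "b \<in> S" for a b
  proof -
    have b: "(-1) *\<^sub>R b \<in> S" using S that(2) by (rule subspace_scale)
    have "L (a + (-1) *\<^sub>R b) = L a - L b" "J (a + (-1) *\<^sub>R b) = J a - J b"
      using that L_add[OF that(1) b] J_add[OF that(1) b] L_scaleR[of b "-1"] J_scaleR[of b "-1"] by auto
    then show ?thesis using bound[OF subspace_add[OF S that(1) b]] by simp
  qed
  define f where "f y = L (inv_into S J y)" for y
  have f_J: "f (J a) = L a" if "a \<in> S" for a
  proof -
    have "inv_into S J (J a) \<in> S" "J (inv_into S J (J a)) = J a"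
      using that by (auto intro: inv_into_into f_inv_into_f)
    then show ?thesis using diff[of "inv_into S J (J a)" a] that by (simp add: f_def)
  qed
  have "uniformly_continuous_on (J ` S) f"
    unfolding uniformly_continuous_on_def
  proof (intro allI impI)
    fix e :: real assume "0 < e"
    have "dist (f y') (f y) < e" if "y \<in> J ` S" "y' \<in> J ` S" "dist y' y < e / (\<bar>K\<bar> + 1)" for y y'
    proof -
      have "dist (f y') (f y) \<le> K * dist y' y"
        using that diff by (auto simp: f_J dist_norm)
      also have "\<dots> \<le> (\<bar>K\<bar> + 1) * dist y' y" by (intro mult_right_mono) auto
      also have "\<dots> < e" using that(3) by (simp add: field_simps add_pos_nonneg)
      finally show ?thesis .
    qed
    then show "\<exists>d>0. \<forall>x\<in>J ` S. \<forall>x'\<in>J ` S. dist x' x < d \<longrightarrow> dist (f x') (f x) < e"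
      using \<open>0 < e\<close> by (intro exI[of _ "e / (\<bar>K\<bar> + 1)"]) (auto simp: add_nonneg_pos)
  qed
  then obtain g where g: "uniformly_continuous_on (closure (J ` S)) g" "\<And>y. y \<in> J ` S \<Longrightarrow> f y = g y"
    by (rule uniformly_continuous_on_extension_on_closure) blast
  then have "continuous_on UNIV g" using uniformly_continuous_imp_continuous dense by metis
  then have lim: "(\<lambda>n. g (u n)) \<longlonglongrightarrow> g x" if "u \<longlonglongrightarrow> x" for u x
    using that by (auto simp: continuous_on_eq_continuous_at intro: isCont_tendsto_compose)
  have gJ: "g (J a) = L a" if "a \<in> S" for a using g(2)[of "J a"] f_J that by auto
  have approx: "\<exists>u. (\<forall>n. u n \<in> S) \<and> (\<lambda>n. J (u n)) \<longlonglongrightarrow> x" for x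
  proof -
    have "x \<in> closure (J ` S)" using dense by simp
    then obtain v where v: "\<forall>n. v n \<in> J ` S" "v \<longlonglongrightarrow> x" unfolding closure_sequential by blast
    define u where "u n = inv_into S J (v n)" for n
    have "u n \<in> S" "J (u n) = v n" for n
      using v(1) by (auto simp: u_def intro: inv_into_into f_inv_into_f)
    then show ?thesis using v(2) by (intro exI[of _ u]) simp
  qed
  have add: "g (x + y) = g x + g y" for x y
  proof -
    obtain u v where u: "\<forall>n. u n \<in> S" "(\<lambda>n. J (u n)) \<longlonglongrightarrow> x" and v: "\<forall>n. v n \<in> S" "(\<lambda>n. J (v n)) \<longlonglongrightarrow> y"
      using approx by metis
    have "(\<lambda>n. g (J (u n) + J (v n))) \<longlonglongrightarrow> g (x + y)" by (intro lim tendsto_intros u v)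
    moreover have "g (J (u n) + J (v n)) = g (J (u n)) + g (J (v n))" for n
      using u(1) v(1) gJ[OF subspace_add[OF S]] gJ by (simp add: L_add flip: J_add)
    ultimately have "(\<lambda>n. g (J (u n)) + g (J (v n))) \<longlonglongrightarrow> g (x + y)" by simp
    moreover have "(\<lambda>n. g (J (u n)) + g (J (v n))) \<longlonglongrightarrow> g x + g y" by (intro tendsto_intros lim u v)
    ultimately show ?thesis by (rule LIMSEQ_unique)
  qed
  have scale: "g (r *\<^sub>R x) = r *\<^sub>R g x" for r x
  proof -
    obtain u where u: "\<forall>n. u n \<in> S" "(\<lambda>n. J (u n)) \<longlonglongrightarrow> x" using approx by metis
    have "(\<lambda>n. g (r *\<^sub>R J (u n))) \<longlonglongrightarrow> g (r *\<^sub>R x)" by (intro lim tendsto_intros u)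
    moreover have "g (r *\<^sub>R J (u n)) = r *\<^sub>R g (J (u n))" for n
      using u(1) gJ[OF subspace_scale[OF S]] gJ by (simp add: L_scaleR flip: J_scaleR)
    ultimately have "(\<lambda>n. r *\<^sub>R g (J (u n))) \<longlonglongrightarrow> g (r *\<^sub>R x)" by simp
    moreover have "(\<lambda>n. r *\<^sub>R g (J (u n))) \<longlonglongrightarrow> r *\<^sub>R g x" by (intro tendsto_intros lim u)
    ultimately show ?thesis by (rule LIMSEQ_unique)
  qed
  have bnd: "norm (g x) \<le> K * norm x" for x
  proof -
    obtain u where u: "\<forall>n. u n \<in> S" "(\<lambda>n. J (u n)) \<longlonglongrightarrow> x" using approx by metis
    have "(\<lambda>n. norm (g (J (u n)))) \<longlonglongrightarrow> norm (g x)" by (intro tendsto_intros lim u)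
    moreover have "(\<lambda>n. K * norm (J (u n))) \<longlonglongrightarrow> K * norm x" by (intro tendsto_intros u)
    ultimately show ?thesis using u(1) bound gJ by (intro LIMSEQ_le) auto
  qed
  have "bounded_linear g"
    by (rule bounded_linear_intro[where K = K]) (use add scale bnd in \<open>auto simp: mult.commute\<close>)
  then show ?thesis using gJ bnd by blast
qed

definition projL :: "'a::real_inner set \<Rightarrow> 'a \<Rightarrow>\<^sub>L 'a" where
  "projL B = (\<Sum>b\<in>B. rank_one b b)"

lemma projL_apply [simp]: "blinfun_apply (projL B) = proj B"
  by (simp add: fun_eq_iff projL_def proj_def blinfun.sum_left)

lemma rank_one_add_left: "rank_one (x + x') y = rank_one x y + rank_one x' y"
  and rank_one_add_right: "rank_one x (y + y') = rank_one x y + rank_one x y'"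
  and rank_one_scaleR_left: "rank_one (r *\<^sub>R x) y = r *\<^sub>R rank_one x y"
  and rank_one_scaleR_right: "rank_one x (r *\<^sub>R y) = r *\<^sub>R rank_one x y"
  by (auto intro!: blinfun_eqI simp: blinfun.add_left blinfun.scaleR_left inner_simps scaleR_add_left
      scaleR_add_right)

locale schatten_tensor =
  fixes J :: "('a::{real_inner,complete_space} \<Rightarrow>\<^sub>L 'a) \<Rightarrow> 'b::banach" and p :: ennreal
  assumes p_ge_1: "1 \<le> p" and completion: "schatten_completion p J"
begin

lemma J_add: "A \<in> finite_rank \<Longrightarrow> B \<in> finite_rank \<Longrightarrow> J (A + B) = J A + J B"
  and J_scaleR: "A \<in> finite_rank \<Longrightarrow> J (c *\<^sub>R A) = c *\<^sub>R J A"
  and norm_J: "A \<in> finite_rank \<Longrightarrow> norm (J A) = schatten_norm p A"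
  and J_dense: "closure (J ` finite_rank) = UNIV"
  using completion by (auto simp: schatten_completion_def)

lemma J_sum: "(\<And>i. i \<in> I \<Longrightarrow> A i \<in> finite_rank) \<Longrightarrow> J (\<Sum>i\<in>I. A i) = (\<Sum>i\<in>I. J (A i))"
proof (induction I rule: infinite_finite_induct)
  case (insert i I)
  then show ?case by (simp add: J_add subspace_sum[OF subspace_finite_rank])
qed (use J_scaleR[of 0 0] subspace_0[OF subspace_finite_rank] in auto)

lemma norm_tensor: "norm (tensor J x y) = norm x * norm y"
  by (simp add: tensor_def norm_J schatten_norm_rank_one p_ge_1)

lemma bounded_bilinear_tensor: "bounded_bilinear (tensor J)"
proof
  show "\<exists>K. \<forall>a b. norm (tensor J a b) \<le> norm a * norm b * K"
    by (intro exI[of _ 1]) (simp add: norm_tensor)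
qed (simp_all add: tensor_def rank_one_add_left rank_one_add_right rank_one_scaleR_left
    rank_one_scaleR_right J_add J_scaleR)

lemma norm_J_adj: "A \<in> finite_rank \<Longrightarrow> norm (J (adj A)) = norm (J A)"
  by (simp add: norm_J adj_finite_rank schatten_norm_adj)

text \<open>
  With the reflection \<open>U = 2 P - 1\<close> one has \<open>P A = (A + U A) / 2\<close>, and \<open>U A\<close> has the same norm as \<open>A\<close>.
\<close>
lemma norm_J_proj_left:
  assumes A: "A \<in> finite_rank" and B: "finite B" "orthonormal B"
  shows "norm (J (projL B o\<^sub>L A)) \<le> norm (J A)"
proof -
  define U where "U = 2 *\<^sub>R projL B - id_blinfun"
  have "U x \<bullet> U y = x \<bullet> y" for x y
  proof -
    have "proj B x \<bullet> proj B y = proj B x \<bullet> y"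
      using proj_inner_proj proj_span[OF B proj_in_span] by metis
    then show ?thesis
      by (simp add: U_def blinfun.diff_left blinfun.scaleR_left inner_simps proj_inner_proj)
  qed
  then have norm_U: "norm (J (U o\<^sub>L A)) = norm (J A)"
    using A by (simp add: norm_J schatten_norm_isometry_left finite_rank_compose_left)
  have "projL B o\<^sub>L A = (1/2) *\<^sub>R (A + (U o\<^sub>L A))"
    by (rule blinfun_eqI) (simp add: U_def blinfun.scaleR_left blinfun.add_left blinfun.diff_left)
  then have "J (projL B o\<^sub>L A) = (1/2) *\<^sub>R (J A + J (U o\<^sub>L A))"
    using A by (simp add: J_scaleR J_add finite_rank_compose_left finite_rank_add)
  then show ?thesis using norm_triangle_ineq[of "J A" "J (U o\<^sub>L A)"] norm_U by simp
qed

lemma norm_J_proj_right: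
  assumes A: "A \<in> finite_rank" and B: "finite B" "orthonormal B"
  shows "norm (J (A o\<^sub>L projL B)) \<le> norm (J A)"
proof -
  have "adj (A o\<^sub>L projL B) = projL B o\<^sub>L adj A"
    using A by (intro adj_eqI finite_rank_compose_right) (simp_all add: adj_inner proj_inner_proj)
  then have "norm (J (A o\<^sub>L projL B)) = norm (J (projL B o\<^sub>L adj A))"
    using A norm_J_adj[of "A o\<^sub>L projL B"] by (simp add: finite_rank_compose_right)
  also have "\<dots> \<le> norm (J (adj A))" by (intro norm_J_proj_left adj_finite_rank A B)
  finally show ?thesis using A by (simp add: norm_J_adj)
qed

lemma norm_J_proj_both:
  assumes A: "A \<in> finite_rank" and B: "finite B" "orthonormal B" and C: "finite C" "orthonormal C"
  shows "norm (J (projL B o\<^sub>L A o\<^sub>L projL C)) \<le> norm (J A)"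
  by (rule order_trans[OF norm_J_proj_right norm_J_proj_left])
    (use assms in \<open>auto intro: finite_rank_compose_left\<close>)

text \<open>The swap of factors extends the adjoint, which preserves the Schatten norm.\<close>
lemma swap_exists:
  "\<exists>g. bounded_linear g \<and> (\<forall>x y. g (tensor J x y) = tensor J y x)"
proof -
  have "\<exists>g. bounded_linear g \<and> (\<forall>A\<in>finite_rank. g (J A) = J (adj A)) \<and> (\<forall>x. norm (g x) \<le> 1 * norm x)"
    by (rule bounded_linear_extension_of_dense[OF subspace_finite_rank _ _ _ _ _ J_dense])
      (simp_all add: J_add J_scaleR adj_add adj_scaleR adj_finite_rank norm_J_adj)
  then show ?thesis by (auto simp: tensor_def adj_rank_one)
qed

text \<open>
  The matrix coefficient \<open>b \<bullet> A c\<close> is bounded by the norm of \<open>A\<close>, because it is up to sign the norm of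
  the compression of \<open>A\<close> between the lines through \<open>c\<close> and \<open>b\<close>.
\<close>
lemma coord_exists:
  assumes b: "norm b = 1" and c: "norm c = 1"
  shows "\<exists>g. bounded_linear g \<and> (\<forall>A\<in>finite_rank. g (J A) = b \<bullet> A c) \<and> (\<forall>x. \<bar>g x\<bar> \<le> norm x)"
proof -
  have *: "\<bar>b \<bullet> A c\<bar> \<le> norm (J A)" if A: "A \<in> finite_rank" for A
  proof -
    have "projL {b} o\<^sub>L A o\<^sub>L projL {c} = (b \<bullet> A c) *\<^sub>R rank_one b c"
      by (rule blinfun_eqI) (simp add: proj_def blinfun.scaleR_right blinfun.scaleR_left inner_commute)
    then have "norm (J (projL {b} o\<^sub>L A o\<^sub>L projL {c})) = \<bar>b \<bullet> A c\<bar>"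
      using norm_tensor[of b c] b c by (simp add: J_scaleR tensor_def)
    moreover have "norm (J (projL {b} o\<^sub>L A o\<^sub>L projL {c})) \<le> norm (J A)"
      using A b c by (intro norm_J_proj_both) (auto simp: orthonormal_def dot_square_norm)
    ultimately show ?thesis by simp
  qed
  have "\<exists>g. bounded_linear g \<and> (\<forall>A\<in>finite_rank. g (J A) = b \<bullet> A c) \<and> (\<forall>x. norm (g x) \<le> 1 * norm x)"
    by (rule bounded_linear_extension_of_dense[OF subspace_finite_rank _ _ _ _ _ J_dense])
      (use * in \<open>simp_all add: J_add J_scaleR blinfun.add_left blinfun.scaleR_left inner_simps\<close>)
  then show ?thesis by simp
qed

end

text \<open>
  The properties of the completed tensor product on which the analysis of rough paths rests:
  the swap and the matrix coefficients are continuous, and compression by a finite rank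
  orthogonal projection, here written in coordinates, is a contraction. The last property
  is uniform in the rank, which makes approximation in infinite dimension possible.
\<close>
locale hilbert_tensor =
  fixes tens :: "'a::{real_inner,complete_space} \<Rightarrow> 'a \<Rightarrow> 'b::banach"
    and swap :: "'b \<Rightarrow> 'b" and coord :: "'a \<Rightarrow> 'a \<Rightarrow> 'b \<Rightarrow> real"
  assumes bilinear: "bounded_bilinear tens"
    and norm_tens: "norm (tens x y) = norm x * norm y"
    and tens_dense: "closure (span {tens x y | x y. True}) = UNIV"
    and swap_linear: "bounded_linear swap"
    and swap_tens: "swap (tens x y) = tens y x"
    and coord_linear: "norm b = 1 \<Longrightarrow> norm c = 1 \<Longrightarrow> bounded_linear (coord b c)"
    and coord_tens: "norm b = 1 \<Longrightarrow> norm c = 1 \<Longrightarrow> coord b c (tens x y) = (b \<bullet> x) * (c \<bullet> y)"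
    and coord_le: "norm b = 1 \<Longrightarrow> norm c = 1 \<Longrightarrow> \<bar>coord b c A\<bar> \<le> norm A"
    and norm_coord_sum_le: "finite B \<Longrightarrow> orthonormal B \<Longrightarrow>
      norm (\<Sum>b\<in>B. \<Sum>c\<in>B. coord b c A *\<^sub>R tens b c) \<le> norm A"

lemma (in schatten_tensor) hilbert_tensor_exists:
  "\<exists>swap coord. hilbert_tensor (tensor J) swap coord"
proof -
  obtain sw where sw: "bounded_linear sw" "\<And>x y. sw (tensor J x y) = tensor J y x"
    using swap_exists by blast
  have "\<exists>g. norm b = 1 \<longrightarrow> norm c = 1 \<longrightarrow>
      bounded_linear g \<and> (\<forall>A\<in>finite_rank. g (J A) = b \<bullet> A c) \<and> (\<forall>x. \<bar>g x\<bar> \<le> norm x)" for b c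
    using coord_exists by blast
  then obtain co where co: "\<And>b c. norm b = 1 \<Longrightarrow> norm c = 1 \<Longrightarrow>
      bounded_linear (co b c) \<and> (\<forall>A\<in>finite_rank. co b c (J A) = b \<bullet> A c) \<and> (\<forall>x. \<bar>co b c x\<bar> \<le> norm x)"
    by metis
  have J_in_span: "J A \<in> span {tensor J x y | x y. True}" if "A \<in> finite_rank" for A
    using that
  proof (induction rule: finite_rank_induct)
    case (rank_one x y)
    then show ?case by (auto intro!: span_base simp: tensor_def)
  next
    case (add A B)
    then show ?case by (simp add: J_add span_add)
  qed
  have "hilbert_tensor (tensor J) sw co"
  proof (rule hilbert_tensor.intro)
    show "closure (span {tensor J x y |x y. True}) = UNIV"
      using J_dense closure_mono[of "J ` finite_rank" "span {tensor J x y |x y. True}"] J_in_span by auto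
  next
    fix B :: "'a set" and X :: 'b
    assume B: "finite B" "orthonormal B"
    have n1: "norm b = 1" if "b \<in> B" for b using B that orthonormal_norm by blast
    define Q where "Q X = (\<Sum>b\<in>B. \<Sum>c\<in>B. co b c X *\<^sub>R tensor J b c)" for X
    have "bounded_linear Q"
      unfolding Q_def using co n1
      by (intro bounded_linear_sum bounded_linear_compose[OF bounded_linear_scaleR_left]) auto
    have QJ: "norm (Q (J A)) \<le> norm (J A)" if A: "A \<in> finite_rank" for A
    proof -
      have "projL B o\<^sub>L A o\<^sub>L projL B = (\<Sum>b\<in>B. \<Sum>c\<in>B. (b \<bullet> A c) *\<^sub>R rank_one b c)"
      proof (rule blinfun_eqI)
        fix z
        have "(projL B o\<^sub>L A o\<^sub>L projL B) z = proj B (A (\<Sum>c\<in>B. (z \<bullet> c) *\<^sub>R c))"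
          by (simp add: proj_def)
        also have "\<dots> = (\<Sum>b\<in>B. (\<Sum>c\<in>B. (z \<bullet> c) * (b \<bullet> A c)) *\<^sub>R b)"
          unfolding proj_def blinfun.sum_right blinfun.scaleR_right inner_sum_left
          by (simp add: inner_commute)
        also have "\<dots> = (\<Sum>b\<in>B. \<Sum>c\<in>B. ((z \<bullet> c) * (b \<bullet> A c)) *\<^sub>R b)"
          by (simp add: scaleR_sum_left)
        finally show "(projL B o\<^sub>L A o\<^sub>L projL B) z = (\<Sum>b\<in>B. \<Sum>c\<in>B. (b \<bullet> A c) *\<^sub>R rank_one b c) z"
          by (simp add: blinfun.sum_left blinfun.scaleR_left mult.commute)
      qed
      then have "J (projL B o\<^sub>L A o\<^sub>L projL B) = Q (J A)"
        using A co n1 by (simp add: Q_def J_sum subspace_sum[OF subspace_finite_rank]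
            subspace_scale[OF subspace_finite_rank] J_scaleR tensor_def)
      then show ?thesis using norm_J_proj_both[OF A B B] by simp
    qed
    have "closed {X. norm (Q X) \<le> norm X}"
      by (intro closed_Collect_le continuous_intros bounded_linear.continuous_on[OF \<open>bounded_linear Q\<close>])
    then have "closure (J ` finite_rank) \<subseteq> {X. norm (Q X) \<le> norm X}"
      using QJ by (intro closure_minimal) auto
    then show "norm (\<Sum>b\<in>B. \<Sum>c\<in>B. co b c X *\<^sub>R tensor J b c) \<le> norm X"
      using J_dense by (auto simp: Q_def)
  next
    fix b c x y :: 'a
    assume "norm b = 1" "norm c = 1"
    then show "co b c (tensor J x y) = (b \<bullet> x) * (c \<bullet> y)"
      using co[of b c] by (simp add: tensor_def inner_commute mult.commute)
  qed (use sw co norm_tensor bounded_bilinear_tensor in auto)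
  then show ?thesis by blast
qed

section \<open>Canonical lifts of continuously differentiable paths\<close>

context hilbert_tensor
begin

sublocale tens: bounded_bilinear tens by (rule bilinear)

sublocale swap: bounded_linear swap by (rule swap_linear)

lemma tensor_swap_eq: "tensor_swap tens = swap"
  unfolding tensor_swap_def
proof (rule the_equality)
  show "bounded_linear swap \<and> (\<forall>x y. swap (tens x y) = tens y x)"
    using swap_linear swap_tens by blast
next
  fix f assume f: "bounded_linear f \<and> (\<forall>x y. f (tens x y) = tens y x)"
  interpret f: bounded_linear f using f by blast
  have "span {tens x y | x y. True} \<subseteq> {A. f A = swap A}"
    using f by (intro span_minimal) (auto simp: subspace_def f.add swap.add f.scaleR swap.scaleR f.zero swap.zero swap_tens)
  moreover have "closed {A. f A = swap A}"
    by (intro closed_Collect_eq f.continuous_on swap.continuous_on continuous_on_id)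
  ultimately have "closure (span {tens x y | x y. True}) \<subseteq> {A. f A = swap A}"
    by (rule closure_minimal)
  then show "f = swap" using tens_dense by auto
qed

lemma sym_part_eq: "sym_part tens A = (1/2) *\<^sub>R (A + swap A)"
  by (simp add: sym_part_def tensor_swap_eq)

lemma norm_swap: "\<exists>K\<ge>0. \<forall>A. norm (swap A) \<le> norm A * K"
  using bounded_linear.nonneg_bounded[OF swap_linear] by blast

end

locale c1_path = hilbert_tensor tens swap coord
  for tens :: "'a::{real_inner,complete_space} \<Rightarrow> 'a \<Rightarrow> 'b::banach" and swap coord +
  fixes T :: real and y y' :: "real \<Rightarrow> 'a"
  assumes deriv: "t \<in> {0..T} \<Longrightarrow> (y has_vector_derivative y' t) (at t within {0..T})"
    and cont': "continuous_on {0..T} y'"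
begin

definition area :: "real \<Rightarrow> real \<Rightarrow> 'b" where
  "area s t = integral {s..t} (\<lambda>r. tens (y r - y s) (y' r))"

lemma deriv_sub:
  "0 \<le> s \<Longrightarrow> t \<le> T \<Longrightarrow> r \<in> {s..t} \<Longrightarrow> (y has_vector_derivative y' r) (at r within {s..t})"
  by (rule has_vector_derivative_within_subset[OF deriv]) auto

lemma cont: "continuous_on {0..T} y"
  using deriv by (meson continuous_on_vector_derivative)

lemma cont_sub: "0 \<le> s \<Longrightarrow> t \<le> T \<Longrightarrow> continuous_on {s..t} y"
  and cont'_sub: "0 \<le> s \<Longrightarrow> t \<le> T \<Longrightarrow> continuous_on {s..t} y'"
  by (rule continuous_on_subset[OF cont], simp, rule continuous_on_subset[OF cont'], simp)

lemma integrable_tens: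
  assumes "0 \<le> s" "t \<le> T"
  shows "(\<lambda>r. tens (y r - q) (y' r)) integrable_on {s..t}"
  using assms by (intro integrable_continuous_real tens.continuous_on continuous_intros cont_sub cont'_sub)

text \<open>
  The values of \<open>y'\<close> are integrated only after tensoring with a vector, so that the integrand lies
  in the Banach space \<open>'b\<close>.
\<close>
lemma has_integral_tens_const:
  assumes "0 \<le> s" "s \<le> t" "t \<le> T"
  shows "((\<lambda>r. tens c (y' r)) has_integral tens c (y t - y s)) {s..t}"
proof -
  have "((\<lambda>r. tens c (y' r)) has_integral (tens c (y t) - tens c (y s))) {s..t}"
    by (rule fundamental_theorem_of_calculus[OF assms(2)])
      (rule bounded_linear.has_vector_derivative[OF tens.bounded_linear_right deriv_sub[OF assms(1,3)]])
  then show ?thesis by (simp add: tens.diff_right)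
qed

lemma area_chen:
  assumes "0 \<le> s" "s \<le> u" "u \<le> t" "t \<le> T"
  shows "area s t = area s u + area u t + tens (y u - y s) (y t - y u)"
proof -
  let ?f = "\<lambda>r. tens (y r - y s) (y' r)"
  have "((\<lambda>r. tens (y u - y s) (y' r)) has_integral tens (y u - y s) (y t - y u)) {u..t}"
    using assms by (intro has_integral_tens_const) auto
  moreover have "((\<lambda>r. tens (y r - y u) (y' r)) has_integral area u t) {u..t}"
    unfolding area_def using assms by (intro integrable_integral integrable_tens) auto
  ultimately have "((\<lambda>r. tens (y r - y u) (y' r) + tens (y u - y s) (y' r)) has_integral
      (area u t + tens (y u - y s) (y t - y u))) {u..t}"
    by (rule has_integral_add[rotated])
  then have "(?f has_integral (area u t + tens (y u - y s) (y t - y u))) {u..t}"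
    by (simp flip: tens.add_left)
  moreover have "(?f has_integral area s u) {s..u}"
    unfolding area_def using assms by (intro integrable_integral integrable_tens) auto
  ultimately have "(?f has_integral (area s u + (area u t + tens (y u - y s) (y t - y u)))) {s..t}"
    using assms by (intro has_integral_combine[of s u t])
  then show ?thesis by (simp add: area_def[of s t] integral_unique add.assoc)
qed

lemma area_refl [simp]: "area s s = 0"
  by (simp add: area_def)

text \<open>
  Integration by parts: the derivative of \<open>(y r - y s) \<otimes> (y r - y s)\<close> is the integrand of the area
  plus its swap.
\<close>
lemma area_sym:
  assumes "0 \<le> s" "s \<le> t" "t \<le> T"
  shows "area s t + swap (area s t) = tens (y t - y s) (y t - y s)"
proof -
  let ?f = "\<lambda>r. tens (y r - y s) (y' r)"
  have f: "(?f has_integral area s t) {s..t}"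
    unfolding area_def using assms by (intro integrable_integral integrable_tens) auto
  have "((\<lambda>r. ?f r + swap (?f r)) has_integral (area s t + swap (area s t))) {s..t}"
    using has_integral_add[OF f has_integral_linear[OF f swap_linear]] by (simp add: o_def)
  moreover have "((\<lambda>r. ?f r + tens (y' r) (y r - y s)) has_integral
      (tens (y t - y s) (y t - y s) - tens (y s - y s) (y s - y s))) {s..t}"
  proof (rule fundamental_theorem_of_calculus[OF assms(2)])
    fix r assume "r \<in> {s..t}"
    then have "((\<lambda>r. y r - y s) has_vector_derivative (y' r - 0)) (at r within {s..t})"
      using assms by (intro derivative_intros deriv_sub) auto
    from tens.has_vector_derivative[OF this this]
    show "((\<lambda>r. tens (y r - y s) (y r - y s)) has_vector_derivative
      (tens (y r - y s) (y' r) + tens (y' r) (y r - y s))) (at r within {s..t})" by simp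
  qed
  ultimately show ?thesis
    by (simp add: swap_tens tens.zero_left has_integral_unique)
qed

text \<open>
  While the path stays on a line the integrand is symmetric, so the area equals its symmetric part,
  which depends on the increment only. Hence the parametrisation of a polygon can be changed freely.
\<close>
lemma area_segment:
  assumes "0 \<le> s" "s \<le> t" "t \<le> T"
    and "\<And>r. r \<in> {s..t} \<Longrightarrow> y r - y s = f r *\<^sub>R v"
    and "\<And>r. r \<in> {s..t} \<Longrightarrow> y' r = g r *\<^sub>R v"
  shows "area s t = (1/2) *\<^sub>R tens (y t - y s) (y t - y s)"
proof -
  let ?f = "\<lambda>r. tens (y r - y s) (y' r)"
  have "swap (area s t) = integral {s..t} (swap \<circ> ?f)"
    unfolding area_def using assms by (intro integral_linear[symmetric] integrable_tens swap_linear) auto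
  also have "\<dots> = area s t"
    unfolding area_def using assms(4,5)
    by (intro integral_cong) (simp add: swap.scaleR swap_tens tens.scaleR_left tens.scaleR_right)
  finally have "2 *\<^sub>R area s t = tens (y t - y s) (y t - y s)"
    using area_sym[OF assms(1-3)] by (simp add: scaleR_2)
  then show ?thesis by (simp flip: \<open>2 *\<^sub>R area s t = _\<close>)
qed

lemma
  assumes "0 \<le> s" "s \<le> t" "t \<le> T" and L: "\<And>r. r \<in> {0..T} \<Longrightarrow> norm (y' r) \<le> L"
  shows incr_le: "norm (y t - y s) \<le> L * (t - s)"
    and area_le: "norm (area s t) \<le> (L * (t - s))\<^sup>2"
proof -
  have "0 \<le> norm (y' s)" by simp
  also have "\<dots> \<le> L" using L[of s] assms by auto
  finally have L0: "0 \<le> L" .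
  have incr: "norm (y v - y s) \<le> L * (v - s)" if "s \<le> v" "v \<le> t" for v
  proof (cases "s < v")
    case True
    have "\<exists>r\<in>{s<..<v}. norm (y v - y s) \<le> norm ((v - s) *\<^sub>R y' r)"
    proof (rule mvt_general[OF True])
      show "continuous_on {s..v} y" using that assms by (intro cont_sub) auto
      fix r assume r: "s < r" "r < v"
      then have "(y has_vector_derivative y' r) (at r within {s<..<v})"
        using that assms by (intro has_vector_derivative_within_subset[OF deriv]) auto
      moreover have "at r within {s<..<v} = at r" using r by (intro at_within_open) auto
      ultimately show "(y has_derivative (\<lambda>h. h *\<^sub>R y' r)) (at r)"
        by (simp add: has_vector_derivative_def)
    qed
    then obtain r where r: "r \<in> {s<..<v}" "norm (y v - y s) \<le> (v - s) * norm (y' r)"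
      using True by auto
    moreover have "norm (y' r) \<le> L" using r(1) that assms by (intro L) auto
    ultimately have "(v - s) * norm (y' r) \<le> (v - s) * L" using True by (intro mult_left_mono) auto
    then show ?thesis using r(2) by (simp add: mult.commute)
  next
    case False
    then show ?thesis using that by simp
  qed
  show "norm (y t - y s) \<le> L * (t - s)" using incr[of t] assms by simp
  have "norm (area s t) \<le> (L * (t - s) * L) * measure lborel {s..t}"
  proof (rule has_integral_bound_real[OF _ finite.emptyI])
    show "0 \<le> L * (t - s) * L" using L0 assms by simp
    show "((\<lambda>r. tens (y r - y s) (y' r)) has_integral area s t) {s..t}"
      unfolding area_def using assms by (intro integrable_integral integrable_tens) auto
    fix r assume r: "r \<in> {s..t} - {}"
    then have "norm (y r - y s) \<le> L * (t - s)"
      using incr[of r] mult_left_mono[OF _ L0, of "r - s" "t - s"] by fastforce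
    then show "norm (tens (y r - y s) (y' r)) \<le> L * (t - s) * L"
      using r L[of r] L0 assms by (simp add: norm_tens) (intro mult_mono, auto)
  qed
  then show "norm (area s t) \<le> (L * (t - s))\<^sup>2" using assms by (simp add: power2_eq_square mult_ac)
qed

lemma canonical_lift_eq:
  assumes "0 < T" "0 \<le> s" "s \<le> t" "t \<le> T"
  shows "path2_incr (canonical_lift tens T y) s t = (y t - y s, area s t)"
proof -
  have "vector_derivative y (at r within {0..T}) = y' r" if "r \<in> {s..t}" for r
    using vector_derivative_within_cbox[of 0 T r y "y' r"] deriv[of r] that assms by auto
  then have "oriented_integral s t (\<lambda>r. tens (y r - y s) (vector_derivative y (at r within {0..T}))) = area s t"
    unfolding oriented_integral_def area_def using assms(3) by (auto intro!: integral_cong)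
  then show ?thesis by (simp add: path2_incr_def canonical_lift_def)
qed

end

lemma (in hilbert_tensor) smooth_path_imp_c1_path:
  assumes "smooth_path T x"
  shows "\<exists>x'. c1_path tens swap coord T x x'"
proof -
  obtain D where D: "\<And>t. t \<in> {0..T} \<Longrightarrow> D 0 t = x t"
    "\<And>n t. t \<in> {0..T} \<Longrightarrow> (D n has_vector_derivative D (Suc n) t) (at t within {0..T})"
    using assms unfolding smooth_path_def by metis
  have "c1_path tens swap coord T x (D (Suc 0))"
  proof unfold_locales
    show "continuous_on {0..T} (D (Suc 0))"
      using D(2) by (meson continuous_on_vector_derivative)
    fix t assume t: "t \<in> {0..T}"
    show "(x has_vector_derivative D (Suc 0) t) (at t within {0..T})"
      by (rule has_vector_derivative_transform[OF t _ D(2)[OF t]]) (use D(1) in auto)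
  qed
  then show ?thesis by blast
qed

lemma grp_dist_eq:
  assumes "bounded_bilinear tens"
  shows "grp_dist tens (y, Y) (x, X) =
    max (norm (x - y)) (sqrt (norm (X - Y - tens y (x - y))))"
proof -
  interpret bounded_bilinear tens by fact
  show ?thesis
    by (simp add: grp_dist_def grp_norm_def grp_mult_def grp_inv_def diff_right minus_left minus_right algebra_simps)
qed

text \<open>
  The defect \<open>c\<close> of weak geometricity of a limit is \<open>R + swap R - d \<otimes> d\<close>, where \<open>1 + d + R\<close> is the
  group element that separates it from an approximating lift. This is quadratic in the distance. The
  distance only sees times \<open>s < t\<close>; the remaining times follow from Chen's relation.
\<close>
lemma (in hilbert_tensor) geometric_subset_weakly_geometric:
  assumes T: "0 < T"
  shows "geometric tens T \<alpha> \<subseteq> weakly_geometric tens T \<alpha>"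
proof
  fix Z assume Z: "Z \<in> geometric tens T \<alpha>"
  obtain x X where Z_eq: "Z = (x, X)" by force
  have chen: "X s t - X s u - X u t = tens (x u - x s) (x t - x u)"
    if "s \<in> {0..T}" "u \<in> {0..T}" "t \<in> {0..T}" for s u t
    using Z that by (auto simp: Z_eq geometric_def rough_paths_def)
  obtain K where K: "0 \<le> K" "\<And>A. norm (swap A) \<le> norm A * K" using norm_swap by blast
  have main: "X s t + swap (X s t) = tens (x t - x s) (x t - x s)" if st: "0 \<le> s" "s < t" "t \<le> T" for s t
  proof -
    define c where "c = X s t + swap (X s t) - tens (x t - x s) (x t - x s)"
    define \<rho> where "\<rho> = \<bar>t - s\<bar> powr \<alpha>"
    have "0 < \<rho>" using st by (simp add: \<rho>_def)
    have bound: "norm c \<le> (2 + K) * (\<epsilon> * \<rho>)\<^sup>2" if \<epsilon>: "0 < \<epsilon>" for \<epsilon>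
    proof -
      obtain y where y: "smooth_path T y" "rough_dist tens T \<alpha> (canonical_lift tens T y) Z < ennreal \<epsilon>"
        using Z \<epsilon> unfolding geometric_def by blast
      then obtain y' where "c1_path tens swap coord T y y'" using smooth_path_imp_c1_path by blast
      then interpret y: c1_path tens swap coord T y y' .
      define d where "d = (x t - x s) - (y t - y s)"
      define R where "R = X s t - y.area s t - tens (y t - y s) d"
      have "ennreal (grp_dist tens (path2_incr (canonical_lift tens T y) s t) (path2_incr Z s t) / \<rho>)
          \<le> rough_dist tens T \<alpha> (canonical_lift tens T y) Z"
        unfolding rough_dist_def \<rho>_def using st by (intro SUP_upper2[of "(s, t)"]) auto
      also note y(2)
      finally have "grp_dist tens (path2_incr (canonical_lift tens T y) s t) (path2_incr Z s t) / \<rho> < \<epsilon>"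
        using \<epsilon> by (subst (asm) ennreal_less_iff) (auto simp: grp_dist_def grp_norm_def \<rho>_def le_max_iff_disj)
      then have "grp_dist tens (y t - y s, y.area s t) (x t - x s, X s t) < \<epsilon> * \<rho>"
        using \<open>0 < \<rho>\<close> y.canonical_lift_eq[OF T, of s t] st by (simp add: Z_eq path2_incr_def divide_simps)
      then have d: "norm d < \<epsilon> * \<rho>" and "sqrt (norm R) < \<epsilon> * \<rho>"
        by (simp_all add: grp_dist_eq[OF bilinear] d_def R_def)
      then have R: "norm R \<le> (\<epsilon> * \<rho>)\<^sup>2"
        by (metis less_eq_real_def norm_ge_zero power_mono real_sqrt_ge_zero real_sqrt_pow2)
      define a A where "a = y t - y s" and "A = y.area s t"
      have x: "x t - x s = a + d" by (simp add: d_def a_def)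
      have X: "X s t = A + tens a d + R" by (simp add: R_def a_def A_def)
      have "A + swap A = tens a a" unfolding A_def a_def using st by (intro y.area_sym) auto
      moreover have "c = (A + swap A) + R + swap R - tens a a - tens d d"
        unfolding c_def x X by (simp add: swap.add swap_tens tens.add_left tens.add_right)
      ultimately have "c = R + swap R - tens d d" by simp
      then have "norm c \<le> norm R + norm (swap R) + norm (tens d d)"
        by (metis norm_triangle_ineq norm_triangle_ineq4 add_mono_thms_linordered_semiring(3) order_trans)
      also have "\<dots> \<le> (\<epsilon> * \<rho>)\<^sup>2 + (\<epsilon> * \<rho>)\<^sup>2 * K + (\<epsilon> * \<rho>)\<^sup>2"
      proof (intro add_mono R)
        show "norm (swap R) \<le> (\<epsilon> * \<rho>)\<^sup>2 * K" using K R mult_right_mono order_trans by blast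
        show "norm (tens d d) \<le> (\<epsilon> * \<rho>)\<^sup>2"
          using power_mono[OF less_imp_le[OF d] norm_ge_zero, of 2] by (simp add: norm_tens power2_eq_square)
      qed
      finally show ?thesis by (simp add: algebra_simps)
    qed
    have "((\<lambda>\<epsilon>. (2 + K) * (\<epsilon> * \<rho>)\<^sup>2) \<longlongrightarrow> (2 + K) * (0 * \<rho>)\<^sup>2) (at_right 0)"
      by (intro tendsto_intros)
    moreover have "eventually (\<lambda>\<epsilon>. norm c \<le> (2 + K) * (\<epsilon> * \<rho>)\<^sup>2) (at_right 0)"
      using bound by (auto simp: eventually_at_right_field intro: exI[of _ 1])
    ultimately have "norm c \<le> (2 + K) * (0 * \<rho>)\<^sup>2"
      by (intro tendsto_lowerbound[of _ _ "at_right 0"]) auto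
    then show ?thesis by (simp add: c_def)
  qed
  have diag: "X s s = 0" if "s \<in> {0..T}" for s
    using chen[of s s s] that by (simp add: tens.zero_left)
  have "X s t + swap (X s t) = tens (x t - x s) (x t - x s)" if "s \<in> {0..T}" "t \<in> {0..T}" for s t
  proof (cases s t rule: linorder_cases)
    case less
    then show ?thesis using main that by auto
  next
    case equal
    then show ?thesis using diag that by (simp add: tens.zero_left swap.zero)
  next
    case greater
    have "X s t = tens (x t - x s) (x t - x s) - X t s"
    proof -
      have "- X s t - X t s = tens (x t - x s) (x s - x t)"
        using chen[of s t s] that diag by simp
      also have "\<dots> = - tens (x t - x s) (x t - x s)"
        by (metis minus_diff_eq tens.minus_right)
      finally show ?thesis by (simp add: algebra_simps)
    qed
    moreover have "X t s + swap (X t s) = tens (x t - x s) (x t - x s)"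
      using main[of t s] greater that tens.minus_left tens.minus_right
      by (metis add.inverse_inverse atLeastAtMost_iff minus_diff_eq)
    moreover have "\<tau> - A + swap (\<tau> - A) = \<tau>" if "swap \<tau> = \<tau>" "A + swap A = \<tau>" for \<tau> A
      using that(2) by (auto simp: swap.diff that(1))
    ultimately show ?thesis by (simp only: swap_tens)
  qed
  then show "Z \<in> weakly_geometric tens T \<alpha>"
    using Z by (simp add: weakly_geometric_def geometric_def Z_eq sym_part_eq)
qed

section \<open>A smooth step function\<close>

text \<open>
  The functions \<open>P w\<^sup>-\<^sup>k exp (- 1 / w)\<close> with \<open>w = x * (1 - x)\<close>, extended by zero outside the unit
  interval. They are closed under differentiation, so each of them is smooth.
\<close>
definition flat_fun :: "real poly \<Rightarrow> nat \<Rightarrow> real \<Rightarrow> real" where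
  "flat_fun P k x =
     (if 0 < x \<and> x < 1 then poly P x * inverse (x * (1 - x)) ^ k * exp (- inverse (x * (1 - x))) else 0)"

text \<open>Because \<open>exp u\<close> dominates \<open>(1 + u / n) ^ n\<close>, here with \<open>n = k + 2\<close>.\<close>
lemma power_exp_bound:
  fixes u :: real
  assumes "0 < u"
  shows "u ^ k * exp (- u) \<le> real (k + 2) ^ (k + 2) * (inverse u)\<^sup>2"
proof -
  let ?n = "k + 2"
  have "(u / real ?n) ^ ?n \<le> (1 + u / real ?n) ^ ?n"
    using assms by (intro power_mono) auto
  also have "\<dots> \<le> exp u" using assms by (intro exp_ge_one_plus_x_over_n_power_n) auto
  finally have "u ^ ?n \<le> exp u * real ?n ^ ?n"
    by (simp add: power_divide pos_divide_le_eq del: power_Suc power_add)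
  then have "u ^ ?n * exp (- u) \<le> real ?n ^ ?n"
    by (simp add: exp_minus divide_simps mult.commute)
  then have "u ^ ?n * exp (- u) * (inverse u)\<^sup>2 \<le> real ?n ^ ?n * (inverse u)\<^sup>2"
    by (rule mult_right_mono) simp
  moreover have "u ^ ?n * exp (- u) * (inverse u)\<^sup>2 = u ^ k * exp (- u)"
    using assms by (simp add: power_add power2_eq_square field_simps)
  ultimately show ?thesis by (simp only:)
qed

text \<open>
  Quadratic decay at both end points of the interval suffices for differentiability there, with
  derivative zero.
\<close>
lemma flat_fun_bound:
  "\<exists>C. \<forall>x. \<bar>flat_fun P k x\<bar> \<le> C * x\<^sup>2 \<and> \<bar>flat_fun P k x\<bar> \<le> C * (x - 1)\<^sup>2"
proof -
  have "compact (poly P ` {0..1})"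
    by (intro compact_continuous_image continuous_intros) auto
  then obtain M where M: "0 < M" "\<And>x. x \<in> {0..1} \<Longrightarrow> \<bar>poly P x\<bar> \<le> M"
    using bounded_pos compact_imp_bounded by (metis image_eqI real_norm_def)
  define C where "C = M * real (k + 2) ^ (k + 2)"
  have "0 \<le> C" using M by (simp add: C_def)
  have "\<bar>flat_fun P k x\<bar> \<le> C * x\<^sup>2 \<and> \<bar>flat_fun P k x\<bar> \<le> C * (x - 1)\<^sup>2" for x
  proof (cases "0 < x \<and> x < 1")
    case True
    define w where "w = x * (1 - x)"
    have w: "0 < w" "w \<le> x" "w \<le> 1 - x"
      using True mult_right_mono[of x 1 "1 - x"] mult_left_mono[of "1 - x" 1 x] by (auto simp: w_def)
    have "\<bar>flat_fun P k x\<bar> = \<bar>poly P x\<bar> * (inverse w ^ k * exp (- inverse w))"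
      using True w(1) by (simp add: flat_fun_def abs_mult flip: w_def)
    also have "\<dots> \<le> M * (real (k + 2) ^ (k + 2) * (inverse (inverse w))\<^sup>2)"
      using True M w(1) by (intro mult_mono power_exp_bound) auto
    finally have le: "\<bar>flat_fun P k x\<bar> \<le> C * w\<^sup>2" by (simp add: C_def)
    have "w\<^sup>2 \<le> x\<^sup>2" "w\<^sup>2 \<le> (1 - x)\<^sup>2" using w by (auto intro: power_mono)
    then have "C * w\<^sup>2 \<le> C * x\<^sup>2" "C * w\<^sup>2 \<le> C * (1 - x)\<^sup>2" using \<open>0 \<le> C\<close> by (auto intro: mult_left_mono)
    then show ?thesis using le by (simp add: power2_commute[of x 1])
  next
    case False
    then have "flat_fun P k x = 0" by (auto simp: flat_fun_def)
    then show ?thesis using \<open>0 \<le> C\<close> by simp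
  qed
  then show ?thesis by blast
qed

lemma DERIV_zero_of_quadratic_bound:
  fixes f :: "real \<Rightarrow> real"
  assumes "\<And>x. \<bar>f x\<bar> \<le> C * (x - a)\<^sup>2"
  shows "(f has_real_derivative 0) (at a)"
proof -
  have "f a = 0" using assms[of a] by simp
  have "((\<lambda>y. (f y - f a) / (y - a)) \<longlongrightarrow> 0) (at a)"
  proof (rule Lim_null_comparison)
    have "norm ((f y - f a) / (y - a)) \<le> C * \<bar>y - a\<bar>" if "y \<noteq> a" for y
      using assms[of y] that \<open>f a = 0\<close> power2_abs[of "y - a"]
      by (simp add: divide_simps power2_eq_square)
    then show "eventually (\<lambda>y. norm ((f y - f a) / (y - a)) \<le> C * \<bar>y - a\<bar>) (at a)"
      by (simp add: eventually_at_filter)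
    show "((\<lambda>y. C * \<bar>y - a\<bar>) \<longlongrightarrow> 0) (at a)"
      by (rule tendsto_eq_intros refl | simp)+
  qed
  then show ?thesis by (simp add: has_field_derivative_iff)
qed

text \<open>
  The polynomial factor \<open>P' w\<^sup>2 - k P w' w + P w'\<close> of the derivative, over the common denominator
  \<open>w ^ (k + 2)\<close>.
\<close>
definition flat_deriv :: "nat \<Rightarrow> real poly \<Rightarrow> real poly" where
  "flat_deriv k P = (let W = [:0, 1, -1:] in
     pderiv P * W\<^sup>2 - of_nat k * P * pderiv W * W + P * pderiv W)"

lemma flat_fun_DERIV: "(flat_fun P k has_real_derivative flat_fun (flat_deriv k P) (k + 2) x) (at x)"
proof -
  consider "x = 0 \<or> x = 1" | "0 < x" "x < 1" | "x < 0 \<or> 1 < x" by linarith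
  then show ?thesis
  proof cases
    case 1
    obtain C where "\<And>y. \<bar>flat_fun P k y\<bar> \<le> C * (y - 0)\<^sup>2" "\<And>y. \<bar>flat_fun P k y\<bar> \<le> C * (y - 1)\<^sup>2"
      using flat_fun_bound[of P k] by auto
    from this[THEN DERIV_zero_of_quadratic_bound] show ?thesis using 1 by (auto simp: flat_fun_def[of "flat_deriv k P"])
  next
    case 2
    define w where "w = x * (1 - x)"
    have "0 < w" using 2 by (simp add: w_def)
    let ?f = "\<lambda>x. poly P x * inverse (x * (1 - x)) ^ k * exp (- inverse (x * (1 - x)))"
    define e where "e = exp (- inverse w)"
    have D: "((\<lambda>x. inverse (x * (1 - x))) has_real_derivative - ((1 - 2 * x) * (inverse w)\<^sup>2)) (at x)"
    proof -
      have "((\<lambda>x. x * (1 - x)) has_real_derivative (1 - 2 * x)) (at x)"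
        by (auto intro!: derivative_eq_intros)
      from DERIV_inverse'[OF this] show ?thesis
        using 2 by (simp add: w_def power2_eq_square mult_ac)
    qed
    have "(?f has_real_derivative
        ((poly (pderiv P) x * inverse w ^ k + poly P x * (real k * inverse w ^ (k - 1) * - ((1 - 2 * x) * (inverse w)\<^sup>2))) * e
          + poly P x * inverse w ^ k * (e * ((1 - 2 * x) * (inverse w)\<^sup>2)))) (at x)"
      by (rule derivative_eq_intros D poly_DERIV refl | simp add: w_def e_def)+
    moreover have "real k * inverse w ^ (k - 1) * (inverse w)\<^sup>2 = real k * inverse w ^ (k + 1)"
      by (cases k) (auto simp: power2_eq_square)
    then have "(poly (pderiv P) x * inverse w ^ k + poly P x * (real k * inverse w ^ (k - 1) * - ((1 - 2 * x) * (inverse w)\<^sup>2))) * e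
          + poly P x * inverse w ^ k * (e * ((1 - 2 * x) * (inverse w)\<^sup>2))
        = (poly (pderiv P) x * inverse w ^ k - poly P x * (1 - 2 * x) * (real k * inverse w ^ (k + 1))) * e
          + poly P x * inverse w ^ k * (e * ((1 - 2 * x) * (inverse w)\<^sup>2))"
      by (auto simp: mult_ac)
    also have "\<dots> = (poly (pderiv P) x * w\<^sup>2 - real k * poly P x * (1 - 2 * x) * w + poly P x * (1 - 2 * x))
        * inverse w ^ (k + 2) * e"
      using \<open>0 < w\<close> by (simp add: power_add power2_eq_square field_simps)
    also have "\<dots> = flat_fun (flat_deriv k P) (k + 2) x"
      using 2 by (simp add: flat_fun_def flat_deriv_def Let_def e_def w_def pderiv_pCons algebra_simps)
    ultimately have "(?f has_real_derivative flat_fun (flat_deriv k P) (k + 2) x) (at x)" by simp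
    then show ?thesis
      by (rule has_field_derivative_transform_within_open[where S = "{0<..<1}"])
        (use 2 in \<open>auto simp: flat_fun_def\<close>)
  next
    case 3
    have "((\<lambda>_. 0) has_real_derivative flat_fun (flat_deriv k P) (k + 2) x) (at x)"
      using 3 by (auto simp: flat_fun_def)
    then show ?thesis
      by (rule has_field_derivative_transform_within_open[where S = "{..<0} \<union> {1<..}"])
        (use 3 in \<open>auto simp: flat_fun_def intro!: open_Un\<close>)
  qed
qed

fun flat_iter :: "nat \<Rightarrow> real poly \<times> nat" where
  "flat_iter 0 = (1, 0)"
| "flat_iter (Suc n) = (flat_deriv (snd (flat_iter n)) (fst (flat_iter n)), snd (flat_iter n) + 2)"

text \<open>
  The normalised integral of the bump \<open>exp (- 1 / w)\<close>. The sequence \<open>D\<close> lists the function and all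
  its derivatives.
\<close>
lemma smooth_step_exists:
  obtains D :: "nat \<Rightarrow> real \<Rightarrow> real" and M :: real
  where "\<And>n x. (D n has_real_derivative D (Suc n) x) (at x)"
    and "\<And>x. x \<le> 0 \<Longrightarrow> D 0 x = 0" and "\<And>x. 1 \<le> x \<Longrightarrow> D 0 x = 1"
    and "\<And>x. x \<le> 0 \<or> 1 \<le> x \<Longrightarrow> D 1 x = 0"
    and "\<And>x. \<bar>D 1 x\<bar> \<le> M"
proof -
  define h where "h = flat_fun 1 0"
  have h_deriv: "(h has_real_derivative flat_fun (flat_deriv 0 1) 2 x) (at x)" for x
    using flat_fun_DERIV[of 1 0 x] by (simp add: h_def numeral_2_eq_2)
  have cont: "continuous_on S h" for S
    using h_deriv by (meson DERIV_isCont continuous_at_imp_continuous_on)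
  have h01: "0 \<le> h x" "h x \<le> 1" for x by (auto simp: h_def flat_fun_def)
  have h0: "h x = 0" if "x \<le> 0 \<or> 1 \<le> x" for x using that by (auto simp: h_def flat_fun_def)
  define H where "H x = integral {0..x} h" for x
  have int: "h integrable_on {a..b}" for a b by (intro integrable_continuous_real cont)
  \<comment> \<open>Moving the base point below 0 makes \<open>H\<close> accessible to the fundamental theorem at \<open>x \<le> 0\<close> as well.\<close>
  have H_shift: "H x = integral {a..x} h" if "a \<le> 0" "a \<le> x" for a x
  proof (cases "0 \<le> x")
    case True
    have "integral {a..0} h = integral {a..0} (\<lambda>_. 0)" by (intro integral_cong h0) auto
    then show ?thesis
      using Henstock_Kurzweil_Integration.integral_combine[of a 0 x h] True that int by (simp add: H_def)
  next
    case False
    have "integral {a..x} h = integral {a..x} (\<lambda>_. 0)" using False by (intro integral_cong h0) auto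
    then show ?thesis using False by (simp add: H_def)
  qed
  have H_deriv: "(H has_real_derivative h x) (at x)" for x
  proof -
    define a where "a = min 0 x - 1"
    have "((\<lambda>y. integral {a..y} h) has_real_derivative h x) (at x within {a..x + 1})"
      by (intro integral_has_real_derivative cont) (auto simp: a_def)
    then have "((\<lambda>y. integral {a..y} h) has_real_derivative h x) (at x within {a<..<x + 1})"
      by (rule has_field_derivative_subset) auto
    moreover have "at x within {a<..<x + 1} = at x" by (intro at_within_open) (auto simp: a_def)
    ultimately have "((\<lambda>y. integral {a..y} h) has_real_derivative h x) (at x)" by simp
    then show ?thesis
      by (rule has_field_derivative_transform_within_open[where S = "{a<..<x + 1}"])
        (auto simp: a_def intro!: H_shift[symmetric])
  qed
  define I where "I = integral {0..1} h"
  have "0 \<le> I" unfolding I_def by (intro integral_nonneg int) (simp add: h01)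
  moreover have "I \<noteq> 0"
  proof
    assume "I = 0"
    then have "\<forall>x\<in>{0..1}. h x = 0"
      unfolding I_def by (subst (asm) integral_eq_0_iff[OF cont]) (auto simp: h01)
    then have "h (1/2) = 0" by auto
    then show False by (simp add: h_def flat_fun_def)
  qed
  ultimately have I: "0 < I" by simp
  have H0: "H x = 0" if "x \<le> 0" for x using H_shift[of x x] that by simp
  have H1: "H x = I" if "1 \<le> x" for x
  proof -
    have "integral {1..x} h = integral {1..x} (\<lambda>_. 0)" by (intro integral_cong h0) auto
    then show ?thesis
      using Henstock_Kurzweil_Integration.integral_combine[of 0 1 x h] that int by (simp add: H_def I_def)
  qed
  define D where "D n x = (case n of 0 \<Rightarrow> H x | Suc m \<Rightarrow> flat_fun (fst (flat_iter m)) (snd (flat_iter m)) x) / I" for n x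
  have D1: "D 1 x = h x / I" for x by (simp add: D_def h_def)
  show thesis
  proof (rule that[of D "1 / I"])
    show "(D n has_real_derivative D (Suc n) x) (at x)" for n x
    proof (cases n)
      case 0
      then show ?thesis using DERIV_cdivide[OF H_deriv[of x], of I] D1 by (simp add: D_def[abs_def] h_def)
    next
      case (Suc m)
      then show ?thesis
        using DERIV_cdivide[OF flat_fun_DERIV[of "fst (flat_iter m)" "snd (flat_iter m)" x], of I]
        by (simp add: D_def[abs_def])
    qed
    show "D 0 x = 0" if "x \<le> 0" for x using H0[OF that] by (simp add: D_def)
    show "D 0 x = 1" if "1 \<le> x" for x using H1[OF that] I by (simp add: D_def)
    show "D 1 x = 0" if "x \<le> 0 \<or> 1 \<le> x" for x unfolding D1 using h0[OF that] by simp
    show "\<bar>D 1 x\<bar> \<le> 1 / I" for x unfolding D1 using h01[of x] I by (simp add: divide_right_mono)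
  qed
qed

section \<open>Smoothed polygons and products of exponentials\<close>

lemma grid_cell:
  assumes "0 < \<eta>" "0 < m" "0 \<le> t" "t \<le> real m * \<eta>"
  obtains i where "i < m" "real i * \<eta> \<le> t" "t \<le> real (Suc i) * \<eta>"
proof (cases "t = real m * \<eta>")
  case True
  then show ?thesis using assms that[of "m - 1"] by (auto intro!: mult_right_mono)
next
  case False
  define i where "i = nat \<lfloor>t / \<eta>\<rfloor>"
  have i: "real i \<le> t / \<eta>" "t / \<eta> < real i + 1"
    using assms by (auto simp: i_def)
  then have "real i * \<eta> \<le> t" "t < (real i + 1) * \<eta>"
    using assms by (auto simp: field_simps)
  moreover have "real i < real m"
  proof -
    have "t < real m * \<eta>" using False assms by simp
    then have "real i * \<eta> < real m * \<eta>" using \<open>real i * \<eta> \<le> t\<close> by linarith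
    then show ?thesis using assms by simp
  qed
  ultimately show ?thesis using that[of i] by (auto simp: add.commute)
qed

text \<open>
  The path with steps \<open>v i\<close> over the cells of mesh \<open>\<eta>\<close> is a finite sum of multiples of
  translated and rescaled step functions. Since the step function is constant outside the unit
  interval, all terms but one are constant in each cell, and the path runs there on a line. The
  constant \<open>M\<close> bounds the slope of the step function.
\<close>
lemma (in hilbert_tensor) smoothed_polygon_exists:
  obtains M :: real where "0 < M"
    "\<And>\<eta> m r (v :: nat \<Rightarrow> 'a). 0 < \<eta> \<Longrightarrow> 0 < m \<Longrightarrow> (\<And>i. i < m \<Longrightarrow> norm (v i) \<le> r) \<Longrightarrow>
      \<exists>y y'. smooth_path (real m * \<eta>) y \<and> c1_path tens swap coord (real m * \<eta>) y y' \<and>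
        (\<forall>t\<in>{0..real m * \<eta>}. norm (y' t) \<le> M * r / \<eta>) \<and>
        (\<forall>i<m. y (real (Suc i) * \<eta>) - y (real i * \<eta>) = v i \<and>
          c1_path.area tens y y' (real i * \<eta>) (real (Suc i) * \<eta>) = (1/2) *\<^sub>R tens (v i) (v i))"
proof -
  obtain D :: "nat \<Rightarrow> real \<Rightarrow> real" and M0
    where D: "\<And>n x. (D n has_real_derivative D (Suc n) x) (at x)"
      and D_le: "\<And>x. x \<le> 0 \<Longrightarrow> D 0 x = 0" and D_ge: "\<And>x. 1 \<le> x \<Longrightarrow> D 0 x = 1"
      and D1_out: "\<And>x. x \<le> 0 \<or> 1 \<le> x \<Longrightarrow> D 1 x = 0" and D1_le: "\<And>x. \<bar>D 1 x\<bar> \<le> M0"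
    using smooth_step_exists by blast
  define M where "M = \<bar>M0\<bar> + 1"
  have D1_M: "\<bar>D 1 x\<bar> \<le> M" for x using D1_le[of x] by (simp add: M_def)
  show thesis
  proof (rule that[of M])
    show "0 < M" by (simp add: M_def)
    fix \<eta> r :: real and m :: nat and v :: "nat \<Rightarrow> 'a"
    assume \<eta>: "0 < \<eta>" and m: "0 < m" and v: "\<And>i. i < m \<Longrightarrow> norm (v i) \<le> r"
    define Y where "Y k t = (\<Sum>i<m. (D k (t / \<eta> - real i) / \<eta> ^ k) *\<^sub>R v i)" for k t
    have Y_deriv: "(Y k has_vector_derivative Y (Suc k) t) (at t within S)" for k t S
    proof -
      have 1: "((\<lambda>t. D k (t / \<eta> - real i) / \<eta> ^ k) has_real_derivative
          D (Suc k) (t / \<eta> - real i) / \<eta> ^ Suc k) (at t within S)" for i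
      proof -
        have "((\<lambda>t. t / \<eta> - real i) has_real_derivative 1 / \<eta>) (at t within S)"
          using \<eta> by (auto intro!: derivative_eq_intros)
        from DERIV_chain2[OF D this, of k] show ?thesis
          using DERIV_cdivide[of "\<lambda>t. D k (t / \<eta> - real i)" _ t S "\<eta> ^ k"] \<eta> by fastforce
      qed
      have "((\<lambda>t. (D k (t / \<eta> - real i) / \<eta> ^ k) *\<^sub>R v i) has_vector_derivative
          ((D (Suc k) (t / \<eta> - real i) / \<eta> ^ Suc k) *\<^sub>R v i)) (at t within S)" for i
        using has_vector_derivative_scaleR[OF 1[of i] has_vector_derivative_const[of "v i"]] by simp
      then show ?thesis unfolding Y_def[abs_def] by (intro has_vector_derivative_sum)
    qed
    have cell0: "Y 0 t = (\<Sum>j<i. v j) + D 0 (t / \<eta> - real i) *\<^sub>R v i"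
      and cell1: "Y 1 t = (D 1 (t / \<eta> - real i) / \<eta>) *\<^sub>R v i"
      if i: "i < m" "real i * \<eta> \<le> t" "t \<le> real (Suc i) * \<eta>" for i t
    proof -
      have u: "real i \<le> t / \<eta>" "t / \<eta> \<le> real i + 1" using i \<eta> by (auto simp: field_simps)
      \<comment> \<open>In the \<open>i\<close>-th cell the earlier steps are complete and the later ones have not begun.\<close>
      have before: "1 \<le> t / \<eta> - real j" if "j < i" for j
      proof -
        have "real j + 1 \<le> real i" using that by linarith
        then show ?thesis using u by linarith
      qed
      have after: "t / \<eta> - real j \<le> 0" if "i < j" for j
      proof -
        have "real i + 1 \<le> real j" using that by linarith
        then show ?thesis using u by linarith
      qed
      have "Y 0 t = (\<Sum>j<m. (if j < i then v j else 0) + (if j = i then D 0 (t / \<eta> - real i) *\<^sub>R v i else 0))"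
        unfolding Y_def using D_ge[OF before] D_le[OF after]
        by (intro sum.cong refl) (auto simp: not_less le_less)
      also have "\<dots> = (\<Sum>j<i. v j) + D 0 (t / \<eta> - real i) *\<^sub>R v i"
      proof -
        have "{..<m} \<inter> {j. j < i} = {..<i}" using i(1) by auto
        then show ?thesis using i(1) by (simp add: sum.distrib sum.If_cases)
      qed
      finally show "Y 0 t = (\<Sum>j<i. v j) + D 0 (t / \<eta> - real i) *\<^sub>R v i" .
      have "Y 1 t = (\<Sum>j<m. if j = i then (D 1 (t / \<eta> - real i) / \<eta>) *\<^sub>R v i else 0)"
      proof -
        have "D 1 (t / \<eta> - real j) = 0" if "j \<noteq> i" for j
          using before[of j] after[of j] that by (intro D1_out) linarith
        then show ?thesis unfolding Y_def by (intro sum.cong refl) auto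
      qed
      then show "Y 1 t = (D 1 (t / \<eta> - real i) / \<eta>) *\<^sub>R v i" using i(1) by simp
    qed
    let ?T = "real m * \<eta>"
    have c1: "c1_path tens swap coord ?T (Y 0) (Y 1)"
    proof unfold_locales
      show "(Y 0 has_vector_derivative Y 1 t) (at t within {0..?T})" for t
        using Y_deriv[of 0] by simp
      show "continuous_on {0..?T} (Y 1)"
        using Y_deriv[of 1] by (meson continuous_on_vector_derivative)
    qed
    then interpret y: c1_path tens swap coord ?T "Y 0" "Y 1" .
    have "smooth_path ?T (Y 0)"
      unfolding smooth_path_def using Y_deriv by (intro exI[of _ Y]) auto
    moreover have "norm (Y 1 t) \<le> M * r / \<eta>" if "t \<in> {0..?T}" for t
    proof -
      from that have t: "0 \<le> t" "t \<le> ?T" by auto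
      obtain i where i: "i < m" "real i * \<eta> \<le> t" "t \<le> real (Suc i) * \<eta>"
        by (rule grid_cell[OF \<eta> m t])
      have "norm (Y 1 t) = \<bar>D 1 (t / \<eta> - real i)\<bar> * norm (v i) / \<eta>"
        unfolding cell1[OF i] using \<eta> by simp
      also have "\<dots> \<le> M * r / \<eta>"
        using D1_M v[OF i(1)] \<eta> \<open>0 < M\<close> by (intro divide_right_mono mult_mono) auto
      finally show ?thesis .
    qed
    moreover have "Y 0 (real (Suc i) * \<eta>) - Y 0 (real i * \<eta>) = v i \<and>
        y.area (real i * \<eta>) (real (Suc i) * \<eta>) = (1/2) *\<^sub>R tens (v i) (v i)" if i: "i < m" for i
    proof -
      have le: "real i * \<eta> \<le> real (Suc i) * \<eta>" "real (Suc i) * \<eta> \<le> ?T" "0 \<le> real i * \<eta>"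
        using \<eta> i by (auto intro!: mult_right_mono)
      have start: "Y 0 (real i * \<eta>) = (\<Sum>j<i. v j)"
        using cell0[OF i, of "real i * \<eta>"] le(1) \<eta> D_le[of 0] by simp
      have "Y 0 (real (Suc i) * \<eta>) = (\<Sum>j<i. v j) + v i"
        using cell0[OF i, of "real (Suc i) * \<eta>"] le(1) \<eta> D_ge[of 1] by (simp add: field_simps)
      then have incr: "Y 0 (real (Suc i) * \<eta>) - Y 0 (real i * \<eta>) = v i" using start by simp
      have "y.area (real i * \<eta>) (real (Suc i) * \<eta>) = (1/2) *\<^sub>R
          tens (Y 0 (real (Suc i) * \<eta>) - Y 0 (real i * \<eta>)) (Y 0 (real (Suc i) * \<eta>) - Y 0 (real i * \<eta>))"
      proof (rule y.area_segment[OF le(3,1,2)])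
        fix t assume "t \<in> {real i * \<eta>..real (Suc i) * \<eta>}"
        then show "Y 0 t - Y 0 (real i * \<eta>) = D 0 (t / \<eta> - real i) *\<^sub>R v i"
          and "Y 1 t = (D 1 (t / \<eta> - real i) / \<eta>) *\<^sub>R v i"
          using cell0[OF i] cell1[OF i] start by auto
      qed
      then show ?thesis unfolding incr using incr by simp
    qed
    ultimately show "\<exists>y y'. smooth_path ?T y \<and> c1_path tens swap coord ?T y y' \<and>
        (\<forall>t\<in>{0..?T}. norm (y' t) \<le> M * r / \<eta>) \<and>
        (\<forall>i<m. y (real (Suc i) * \<eta>) - y (real i * \<eta>) = v i \<and>
          c1_path.area tens y y' (real i * \<eta>) (real (Suc i) * \<eta>) = (1/2) *\<^sub>R tens (v i) (v i))"
      using c1 by blast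
  qed
qed

context hilbert_tensor
begin

text \<open>
  The product of the exponentials \<open>1 + v + v \<otimes> v / 2\<close> of the letters, which is the signature of the
  polygon with the letters as its steps.
\<close>
definition word_prod :: "'a list \<Rightarrow> 'a \<times> 'b" where
  "word_prod vs = foldr (\<lambda>v. grp_mult tens (v, (1/2) *\<^sub>R tens v v)) vs (0, 0)"

lemma grp_mult_assoc: "grp_mult tens (grp_mult tens g h) k = grp_mult tens g (grp_mult tens h k)"
  by (simp add: grp_mult_def tens.add_left tens.add_right add_ac)

lemma grp_mult_one [simp]: "grp_mult tens (0, 0) g = g" "grp_mult tens g (0, 0) = g"
  by (simp_all add: grp_mult_def tens.zero_left tens.zero_right)

lemma word_prod_Nil [simp]: "word_prod [] = (0, 0)"
  and word_prod_Cons [simp]: "word_prod (v # vs) = grp_mult tens (v, (1/2) *\<^sub>R tens v v) (word_prod vs)"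
  by (simp_all add: word_prod_def)

lemma word_prod_append: "word_prod (us @ vs) = grp_mult tens (word_prod us) (word_prod vs)"
  by (induction us) (simp_all add: grp_mult_assoc)

text \<open>
  Running around a parallelogram gives no increment, but an area on the second level.
\<close>
lemma word_prod_commutator: "word_prod [v, w, - v, - w] = (0, tens v w - tens w v)"
proof -
  have half0: "(1/2) *\<^sub>R a + (1/2) *\<^sub>R a = a" for a :: 'b
    by (simp flip: scaleR_add_left)
  then have half: "(1/2) *\<^sub>R a + ((1/2) *\<^sub>R a + b) = a + b" for a b :: 'b
    by (metis add.assoc)
  show ?thesis
    by (simp add: grp_mult_def tens.add_left tens.add_right tens.minus_left tens.minus_right
      tens.diff_left tens.diff_right tens.zero_left tens.zero_right) (simp add: algebra_simps half half0)
qed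

text \<open>
  One loop for each pair \<open>(b, c)\<close>, with side lengths \<open>sqrt \<bar>k b c\<bar>\<close>; the sign of \<open>k b c\<close> is its
  orientation.
\<close>
lemma word_prod_areas_exists:
  assumes "finite S" "0 \<le> r"
    and "\<And>b c. (b, c) \<in> S \<Longrightarrow> norm b = 1 \<and> norm c = 1 \<and> \<bar>k b c\<bar> \<le> r\<^sup>2"
  shows "\<exists>vs. length vs = 4 * card S \<and> (\<forall>v\<in>set vs. norm v \<le> r) \<and>
    word_prod vs = (0, \<Sum>(b, c)\<in>S. k b c *\<^sub>R (tens b c - tens c b))"
  using assms(1,3)
proof (induction S rule: finite_induct)
  case empty
  then show ?case by (intro exI[of _ "[]"]) auto
next
  case (insert bc S)
  obtain b c where bc: "bc = (b, c)" by force
  obtain vs where vs: "length vs = 4 * card S" "\<forall>v\<in>set vs. norm v \<le> r"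
    "word_prod vs = (0, \<Sum>(b, c)\<in>S. k b c *\<^sub>R (tens b c - tens c b))"
    using insert by auto
  have bc1: "norm b = 1" "norm c = 1" "\<bar>k b c\<bar> \<le> r\<^sup>2" using insert.prems[of b c] bc by auto
  define q where "q = sqrt \<bar>k b c\<bar>"
  define v w where "v = q *\<^sub>R b" and "w = (sgn (k b c) * q) *\<^sub>R c"
  have q: "q * q = \<bar>k b c\<bar>" "0 \<le> q" "q \<le> r"
    using bc1(3) assms(2) real_le_rsqrt real_sqrt_le_mono[OF bc1(3)] by (auto simp: q_def)
  have coef: "q * (sgn (k b c) * q) = k b c"
    using q(1) by (metis mult.left_commute mult_sgn_abs)
  have "tens v w = k b c *\<^sub>R tens b c"
    using coef by (simp add: v_def w_def tens.scaleR_left tens.scaleR_right mult.commute)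
  moreover have "tens w v = k b c *\<^sub>R tens c b"
    using coef by (simp add: v_def w_def tens.scaleR_left tens.scaleR_right mult.commute)
  ultimately have "word_prod [v, w, - v, - w] = (0, k b c *\<^sub>R (tens b c - tens c b))"
    by (simp only: word_prod_commutator scaleR_diff_right)
  then have "word_prod ([v, w, - v, - w] @ vs) =
      (0, \<Sum>(b, c)\<in>insert bc S. k b c *\<^sub>R (tens b c - tens c b))"
    unfolding word_prod_append vs(3) using insert.hyps bc
    by (simp add: grp_mult_def tens.zero_left)
  moreover have "norm v \<le> r" "norm w \<le> r"
    using q bc1 by (auto simp: v_def w_def sgn_if)
  ultimately show ?case
    using vs(1,2) insert.hyps by (intro exI[of _ "[v, w, - v, - w] @ vs"]) auto
qed

text \<open>
  Removing \<open>\<xi> \<otimes> \<xi> / 2\<close> from the second level leaves an antisymmetric matrix, which is a sum of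
  areas of loops. Each unordered pair of basis vectors occurs twice among the pairs, hence the
  factor one half in the coefficients \<open>k\<close>. The length of the word depends on the number of basis
  vectors only.
\<close>
lemma word_prod_exists:
  assumes B: "finite B" "orthonormal B" and xi: "\<xi> \<in> span B" and r: "norm \<xi> \<le> r"
    and a: "\<And>b c. b \<in> B \<Longrightarrow> c \<in> B \<Longrightarrow> \<bar>a b c\<bar> \<le> r\<^sup>2"
    and sym: "\<And>b c. b \<in> B \<Longrightarrow> c \<in> B \<Longrightarrow> a b c + a c b = (\<xi> \<bullet> b) * (\<xi> \<bullet> c)"
  shows "\<exists>vs. length vs = 1 + 4 * (card B)\<^sup>2 \<and> (\<forall>v\<in>set vs. norm v \<le> r) \<and>
    word_prod vs = (\<xi>, \<Sum>b\<in>B. \<Sum>c\<in>B. a b c *\<^sub>R tens b c)"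
proof -
  define k where "k b c = (a b c - (\<xi> \<bullet> b) * (\<xi> \<bullet> c) / 2) / 2" for b c
  have r0: "0 \<le> r" using r norm_ge_zero order_trans by blast
  have n1: "norm b = 1" if "b \<in> B" for b using B that orthonormal_norm by blast
  have k_le: "\<bar>k b c\<bar> \<le> r\<^sup>2" if "b \<in> B" "c \<in> B" for b c
  proof -
    have "\<bar>\<xi> \<bullet> b\<bar> \<le> r" if "b \<in> B" for b
      using Cauchy_Schwarz_ineq2[of \<xi> b] n1[OF that] r by simp
    then have "\<bar>\<xi> \<bullet> b\<bar> * \<bar>\<xi> \<bullet> c\<bar> \<le> r * r" using that r0 by (intro mult_mono) auto
    then have "\<bar>(\<xi> \<bullet> b) * (\<xi> \<bullet> c)\<bar> \<le> r\<^sup>2" by (simp add: abs_mult power2_eq_square)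
    moreover have "\<bar>(x - s / 2) / 2\<bar> \<le> R" if "\<bar>x\<bar> \<le> R" "\<bar>s\<bar> \<le> R" for x s R :: real
    proof -
      have "(x - s / 2) / 2 = x / 2 - s / 4" by (simp add: diff_divide_distrib)
      moreover have "\<bar>x / 2 - s / 4\<bar> \<le> \<bar>x\<bar> / 2 + \<bar>s\<bar> / 4"
        using abs_triangle_ineq4[of "x / 2" "s / 4"] by simp
      moreover have "0 \<le> R" using that(1) abs_ge_zero order_trans by blast
      ultimately show ?thesis using that by simp
    qed
    ultimately show ?thesis using a[OF that] unfolding k_def by blast
  qed
  obtain vs where vs: "length vs = 4 * card (B \<times> B)" "\<forall>v\<in>set vs. norm v \<le> r"
    "word_prod vs = (0, \<Sum>(b, c)\<in>B \<times> B. k b c *\<^sub>R (tens b c - tens c b))"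
    using word_prod_areas_exists[of "B \<times> B" r k] B(1) r0 n1 k_le by auto
  have xi_sum: "\<xi> = (\<Sum>b\<in>B. (\<xi> \<bullet> b) *\<^sub>R b)"
    using proj_span[OF B xi] by (simp add: proj_def)
  have sq: "tens \<xi> \<xi> = (\<Sum>b\<in>B. \<Sum>c\<in>B. ((\<xi> \<bullet> b) * (\<xi> \<bullet> c)) *\<^sub>R tens b c)"
    by (subst (1 2) xi_sum)
      (simp add: tens.sum_left tens.sum_right tens.scaleR_left tens.scaleR_right scaleR_sum_right,
        subst sum.swap, simp add: mult.commute)
  have anti: "k c b = - k b c" if "b \<in> B" "c \<in> B" for b c
    using sym[OF that] by (simp add: k_def field_simps)
  have "(\<Sum>(b, c)\<in>B \<times> B. k b c *\<^sub>R (tens b c - tens c b)) =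
      (\<Sum>b\<in>B. \<Sum>c\<in>B. k b c *\<^sub>R tens b c) - (\<Sum>b\<in>B. \<Sum>c\<in>B. k b c *\<^sub>R tens c b)"
    by (simp add: sum.cartesian_product[symmetric] scaleR_diff_right sum_subtractf)
  also have "(\<Sum>b\<in>B. \<Sum>c\<in>B. k b c *\<^sub>R tens c b) = (\<Sum>c\<in>B. \<Sum>b\<in>B. k b c *\<^sub>R tens c b)"
    by (rule sum.swap)
  also have "\<dots> = (\<Sum>c\<in>B. \<Sum>b\<in>B. - (k c b *\<^sub>R tens c b))"
  proof (intro sum.cong refl)
    fix c b assume "c \<in> B" "b \<in> B"
    then have "k b c = - k c b" by (intro anti)
    then show "k b c *\<^sub>R tens c b = - (k c b *\<^sub>R tens c b)" by (simp only: scaleR_minus_left)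
  qed
  finally have "(\<Sum>(b, c)\<in>B \<times> B. k b c *\<^sub>R (tens b c - tens c b)) =
      (\<Sum>b\<in>B. \<Sum>c\<in>B. k b c *\<^sub>R tens b c) + (\<Sum>b\<in>B. \<Sum>c\<in>B. k b c *\<^sub>R tens b c)"
    by (simp add: sum_negf)
  also have "\<dots> = (\<Sum>b\<in>B. \<Sum>c\<in>B. a b c *\<^sub>R tens b c) - (1/2) *\<^sub>R tens \<xi> \<xi>"
  proof -
    have "k b c *\<^sub>R tens b c + k b c *\<^sub>R tens b c =
        a b c *\<^sub>R tens b c - (1/2) *\<^sub>R (((\<xi> \<bullet> b) * (\<xi> \<bullet> c)) *\<^sub>R tens b c)" for b c
      by (simp flip: scaleR_add_left scaleR_diff_left) (simp add: k_def)
    then show ?thesis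
      unfolding sq by (simp add: scaleR_sum_right flip: sum.distrib sum_subtractf)
  qed
  finally have "word_prod (\<xi> # vs) = (\<xi>, \<Sum>b\<in>B. \<Sum>c\<in>B. a b c *\<^sub>R tens b c)"
    using vs(3) by (simp add: grp_mult_def tens.zero_right)
  then show ?thesis
    using vs(1,2) r by (intro exI[of _ "\<xi> # vs"]) (auto simp: card_cartesian_product power2_eq_square)
qed

section \<open>Approximation by finite rank projections\<close>

text \<open>The continuous extension of \<open>A \<mapsto> P A P\<close>, where \<open>P\<close> is the projection onto the span of \<open>B\<close>.\<close>
definition proj2 :: "'a set \<Rightarrow> 'b \<Rightarrow> 'b" where
  "proj2 B A = (\<Sum>b\<in>B. \<Sum>c\<in>B. coord b c A *\<^sub>R tens b c)"

lemma bounded_linear_proj2: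
  assumes "orthonormal B"
  shows "bounded_linear (proj2 B)"
  unfolding proj2_def using orthonormal_norm[OF assms]
  by (intro bounded_linear_sum bounded_linear_compose[OF bounded_linear_scaleR_left] coord_linear) auto

lemma norm_proj2_le: "finite B \<Longrightarrow> orthonormal B \<Longrightarrow> norm (proj2 B A) \<le> norm A"
  unfolding proj2_def by (rule norm_coord_sum_le)

lemma proj2_tens:
  assumes "orthonormal B"
  shows "proj2 B (tens u v) = tens (proj B u) (proj B v)"
proof -
  have "tens (proj B u) (proj B v) = (\<Sum>b\<in>B. tens ((u \<bullet> b) *\<^sub>R b) (\<Sum>c\<in>B. (v \<bullet> c) *\<^sub>R c))"
    unfolding proj_def by (rule tens.sum_left)
  also have "\<dots> = (\<Sum>b\<in>B. \<Sum>c\<in>B. tens ((u \<bullet> b) *\<^sub>R b) ((v \<bullet> c) *\<^sub>R c))"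
    by (simp only: tens.sum_right)
  also have "\<dots> = proj2 B (tens u v)"
    unfolding proj2_def using orthonormal_norm[OF assms]
    by (intro sum.cong refl)
      (simp add: coord_tens tens.scaleR_left tens.scaleR_right inner_commute mult.commute)
  finally show ?thesis by simp
qed

lemma proj2_fixes_span:
  assumes "A \<in> span {tens u v | u v. True}"
  shows "\<exists>S. finite S \<and> (\<forall>B. finite B \<longrightarrow> orthonormal B \<longrightarrow> S \<subseteq> span B \<longrightarrow> proj2 B A = A)"
  using assms
proof (induction rule: span_induct_alt)
  case base
  have "proj2 B 0 = 0" if "orthonormal B" for B
    using bounded_linear.linear[OF bounded_linear_proj2[OF that]] by (rule linear_0)
  then show ?case by (intro exI[of _ "{}"]) auto
next
  case (step c A1 A2)
  then obtain u v S where A1: "A1 = tens u v" and S: "finite S"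
    "\<And>B. finite B \<Longrightarrow> orthonormal B \<Longrightarrow> S \<subseteq> span B \<Longrightarrow> proj2 B A2 = A2" by blast
  have "proj2 B (c *\<^sub>R A1 + A2) = c *\<^sub>R A1 + A2"
    if B: "finite B" "orthonormal B" "{u, v} \<union> S \<subseteq> span B" for B
  proof -
    have lin: "linear (proj2 B)" using bounded_linear.linear[OF bounded_linear_proj2[OF B(2)]] .
    have "proj B u = u" "proj B v = v" using B by (auto intro!: proj_span)
    then have "proj2 B A1 = A1" using A1 proj2_tens[OF B(2)] by simp
    moreover have "proj2 B A2 = A2" using S B by auto
    ultimately show ?thesis using linear_add[OF lin] linear_scale[OF lin] by simp
  qed
  then show ?case using S(1) by (intro exI[of _ "{u, v} \<union> S"]) auto
qed

text \<open>
  A finite net in each of the compact sets, with the second net taken in the algebraic tensor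
  product, involves only finitely many vectors; the projection onto their span fixes both nets, and
  contractivity takes care of the other points.
\<close>
lemma finite_rank_projections_approximate:
  assumes K1: "compact K1" and K2: "compact K2" and \<mu>: "0 < \<mu>"
  obtains B where "finite B" "orthonormal B"
    "\<And>x. x \<in> K1 \<Longrightarrow> norm (proj B x - x) \<le> \<mu>" "\<And>A. A \<in> K2 \<Longrightarrow> norm (proj2 B A - A) \<le> \<mu>"
proof -
  obtain F1 where F1: "finite F1" "K1 \<subseteq> (\<Union>x\<in>F1. ball x (\<mu>/2))"
    using compactE_image[OF K1, of K1 "\<lambda>x. ball x (\<mu>/2)"] \<mu> by (metis UN_I centre_in_ball half_gt_zero open_ball subsetI)
  have cover2: "K2 \<subseteq> (\<Union>A\<in>span {tens u v | u v. True}. ball A (\<mu>/2))"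
  proof
    fix A assume "A \<in> K2"
    have "A \<in> closure (span {tens u v | u v. True})" using tens_dense by simp
    then have "\<forall>e>0. \<exists>A'\<in>span {tens u v | u v. True}. dist A' A < e"
      by (rule closure_approachable[THEN iffD1])
    moreover have "0 < \<mu>/2" using \<mu> by simp
    ultimately obtain A' where "A' \<in> span {tens u v | u v. True}" "dist A' A < \<mu>/2"
      by blast
    then show "A \<in> (\<Union>A\<in>span {tens u v | u v. True}. ball A (\<mu>/2))"
      unfolding UN_iff mem_ball by (rule bexI[rotated])
  qed
  obtain F2 where F2: "F2 \<subseteq> span {tens u v | u v. True}" "finite F2" "K2 \<subseteq> (\<Union>A\<in>F2. ball A (\<mu>/2))"
    by (rule compactE_image[OF K2 _ cover2]) auto
  have "\<forall>A\<in>F2. \<exists>S. finite S \<and> (\<forall>B. finite B \<longrightarrow> orthonormal B \<longrightarrow> S \<subseteq> span B \<longrightarrow> proj2 B A = A)"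
    using F2(1) proj2_fixes_span by blast
  then obtain S where S: "\<And>A. A \<in> F2 \<Longrightarrow> finite (S A)"
    "\<And>A B. A \<in> F2 \<Longrightarrow> finite B \<Longrightarrow> orthonormal B \<Longrightarrow> S A \<subseteq> span B \<Longrightarrow> proj2 B A = A"
    by metis
  have "finite (F1 \<union> (\<Union>A\<in>F2. S A))" using F1 F2 S by auto
  then obtain B where B: "finite B" "orthonormal B" "span B = span (F1 \<union> (\<Union>A\<in>F2. S A))"
    by (rule orthonormal_basis_of_finite)
  have sub: "F1 \<union> (\<Union>A\<in>F2. S A) \<subseteq> span B" unfolding B(3) by (rule span_superset)
  show thesis
  proof (rule that[OF B(1,2)])
    fix x assume "x \<in> K1"
    then obtain x' where x': "x' \<in> F1" "dist x' x < \<mu>/2" using F1 by auto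
    have "proj B x' = x'" using x' sub by (intro proj_span[OF B(1,2)]) auto
    then have eq: "proj B x - x = proj B (x - x') - (x - x')"
      by (simp add: linear_diff[OF linear_proj])
    have "norm (proj B x - x) \<le> norm (x - x') + norm (x - x')"
      unfolding eq using norm_triangle_ineq4[of "proj B (x - x')" "x - x'"] norm_proj_le[OF B(1,2), of "x - x'"] by simp
    then show "norm (proj B x - x) \<le> \<mu>" using x'(2) by (simp add: dist_norm norm_minus_commute)
  next
    fix A assume "A \<in> K2"
    then obtain A' where A': "A' \<in> F2" "dist A' A < \<mu>/2" using F2 by auto
    have "proj2 B A' = A'" using A' sub by (intro S(2)[OF _ B(1,2)]) auto
    then have eq: "proj2 B A - A = proj2 B (A - A') - (A - A')"
      by (simp add: linear_diff[OF bounded_linear.linear[OF bounded_linear_proj2[OF B(2)]]])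
    have "norm (proj2 B A - A) \<le> norm (A - A') + norm (A - A')"
      unfolding eq using norm_triangle_ineq4[of "proj2 B (A - A')" "A - A'"] norm_proj2_le[OF B(1,2), of "A - A'"] by simp
    then show "norm (proj2 B A - A) \<le> \<mu>" using A'(2) by (simp add: dist_norm norm_minus_commute)
  qed
qed

text \<open>
  Two multiplicative paths that agree between grid points differ only through the two end pieces
  of an interval. These are shorter than the mesh, where both paths are small. In Chen's relation for
  the second level the end pieces meet the long middle piece only in the first-level difference,
  hence the term \<open>4 * \<epsilon> * C\<close>.
\<close>
lemma close_from_grid:
  fixes x y :: "real \<Rightarrow> 'a" and X Y :: "real \<Rightarrow> real \<Rightarrow> 'b"
  assumes h: "0 < h" "0 < n" and T: "T = real n * h" and \<epsilon>: "0 \<le> \<epsilon>" and C: "0 \<le> C" and \<beta>: "0 < \<beta>"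
    and chen_x: "\<And>s u t. 0 \<le> s \<Longrightarrow> s \<le> u \<Longrightarrow> u \<le> t \<Longrightarrow> t \<le> T \<Longrightarrow>
      X s t = X s u + X u t + tens (x u - x s) (x t - x u)"
    and chen_y: "\<And>s u t. 0 \<le> s \<Longrightarrow> s \<le> u \<Longrightarrow> u \<le> t \<Longrightarrow> t \<le> T \<Longrightarrow>
      Y s t = Y s u + Y u t + tens (y u - y s) (y t - y u)"
    and grid: "\<And>i j. i \<le> j \<Longrightarrow> j \<le> n \<Longrightarrow> y (real j * h) - y (real i * h) = x (real j * h) - x (real i * h) \<and>
      Y (real i * h) (real j * h) = X (real i * h) (real j * h)"
    and small: "\<And>s t. 0 \<le> s \<Longrightarrow> s \<le> t \<Longrightarrow> t \<le> T \<Longrightarrow> t \<le> s + h \<Longrightarrow>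
      norm (x t - x s) \<le> \<epsilon> * (t - s) powr \<beta> \<and> norm (y t - y s) \<le> \<epsilon> * (t - s) powr \<beta> \<and>
      norm (X s t) \<le> (\<epsilon> * (t - s) powr \<beta>)\<^sup>2 \<and> norm (Y s t) \<le> (\<epsilon> * (t - s) powr \<beta>)\<^sup>2"
    and large: "\<And>s t. 0 \<le> s \<Longrightarrow> s \<le> t \<Longrightarrow> t \<le> T \<Longrightarrow> norm (x t - x s) \<le> C * (t - s) powr \<beta>"
    and st: "0 \<le> s" "s \<le> t" "t \<le> T"
  shows "norm ((y t - y s) - (x t - x s)) \<le> 4 * \<epsilon> * (t - s) powr \<beta> \<and>
    norm (Y s t - X s t) \<le> (6 * \<epsilon>\<^sup>2 + 4 * \<epsilon> * C) * ((t - s) powr \<beta>)\<^sup>2"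
proof -
  define g where "g = (t - s) powr \<beta>"
  have g0: "0 \<le> g" by (simp add: g_def)
  have sm: "norm (x v - x u) \<le> \<epsilon> * g \<and> norm (y v - y u) \<le> \<epsilon> * g \<and>
      norm (X u v) \<le> (\<epsilon> * g)\<^sup>2 \<and> norm (Y u v) \<le> (\<epsilon> * g)\<^sup>2"
    if "s \<le> u" "u \<le> v" "v \<le> t" "v \<le> u + h" for u v
  proof -
    have "(v - u) powr \<beta> \<le> g" unfolding g_def using that \<beta> by (intro powr_mono2) auto
    then have le: "\<epsilon> * (v - u) powr \<beta> \<le> \<epsilon> * g" using \<epsilon> by (rule mult_left_mono)
    then have "(\<epsilon> * (v - u) powr \<beta>)\<^sup>2 \<le> (\<epsilon> * g)\<^sup>2" using \<epsilon> by (intro power_mono) auto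
    then show ?thesis using small[of u v] that st le by fastforce
  qed
  have lg: "norm (x v - x u) \<le> C * g" if "s \<le> u" "u \<le> v" "v \<le> t" for u v
  proof -
    have "(v - u) powr \<beta> \<le> g" unfolding g_def using that \<beta> by (intro powr_mono2) auto
    then have "C * (v - u) powr \<beta> \<le> C * g" using C by (rule mult_left_mono)
    then show ?thesis using large[of u v] that st by fastforce
  qed
  have "0 \<le> s" "s \<le> real n * h" "0 \<le> t" "t \<le> real n * h" using st T by auto
  then obtain i j where i: "i < n" "real i * h \<le> s" "s \<le> real (Suc i) * h"
    and j: "j < n" "real j * h \<le> t" "t \<le> real (Suc j) * h"
    using grid_cell[OF h(1,2), of s] grid_cell[OF h(1,2), of t] by metis
  show ?thesis
  proof (cases "t \<le> real (Suc i) * h")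
    case True
    then have "t \<le> s + h" using i by (simp add: algebra_simps)
    then have *: "norm (x t - x s) \<le> \<epsilon> * g" "norm (y t - y s) \<le> \<epsilon> * g"
      "norm (X s t) \<le> (\<epsilon> * g)\<^sup>2" "norm (Y s t) \<le> (\<epsilon> * g)\<^sup>2" using sm[of s t] st by auto
    have "norm ((y t - y s) - (x t - x s)) \<le> \<epsilon> * g + \<epsilon> * g"
      by (rule order_trans[OF norm_triangle_ineq4 add_mono[OF *(2,1)]])
    moreover have "norm (Y s t - X s t) \<le> (\<epsilon> * g)\<^sup>2 + (\<epsilon> * g)\<^sup>2"
      by (rule order_trans[OF norm_triangle_ineq4 add_mono[OF *(4,3)]])
    moreover have "0 \<le> \<epsilon> * g" "0 \<le> \<epsilon> * C * g\<^sup>2" "0 \<le> (\<epsilon> * g)\<^sup>2" using \<epsilon> C g0 by auto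
    moreover have "(6 * \<epsilon>\<^sup>2 + 4 * \<epsilon> * C) * g\<^sup>2 = 6 * (\<epsilon> * g)\<^sup>2 + 4 * (\<epsilon> * C * g\<^sup>2)"
      by (simp add: power_mult_distrib algebra_simps)
    ultimately show ?thesis
      unfolding g_def[symmetric] by (intro conjI; linarith)
  next
    case False
    define a b where "a = real (Suc i) * h" and "b = real j * h"
    have "real (Suc i) * h < real (Suc j) * h" using False j(3) by linarith
    then have ij: "Suc i \<le> j" using h(1) by simp
    have "a \<le> b" unfolding a_def b_def using ij h by (intro mult_right_mono) auto
    then have ab: "s \<le> a" "a \<le> b" "b \<le> t" "a \<le> s + h" "t \<le> b + h"
      using i j h by (auto simp: a_def b_def algebra_simps)
    have gr: "y b - y a = x b - x a" "Y a b = X a b"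
      using grid[OF ij] j(1) by (auto simp: a_def b_def)
    define p q r where "p = x a - x s" and "q = x b - x a" and "r = x t - x b"
    define p' r' where "p' = y a - y s" and "r' = y t - y b"
    have e: "norm p \<le> \<epsilon> * g" "norm p' \<le> \<epsilon> * g" "norm (X s a) \<le> (\<epsilon> * g)\<^sup>2" "norm (Y s a) \<le> (\<epsilon> * g)\<^sup>2"
      "norm r \<le> \<epsilon> * g" "norm r' \<le> \<epsilon> * g" "norm (X b t) \<le> (\<epsilon> * g)\<^sup>2" "norm (Y b t) \<le> (\<epsilon> * g)\<^sup>2"
      using sm[of s a] sm[of b t] ab by (auto simp: p_def p'_def r_def r'_def)
    have q: "norm q \<le> C * g" using lg[of a b] ab by (simp add: q_def)
    have d: "norm (p' - p) \<le> 2 * (\<epsilon> * g)" "norm (r' - r) \<le> 2 * (\<epsilon> * g)"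
      using norm_triangle_ineq4[of p' p] norm_triangle_ineq4[of r' r] e by auto
    have incr: "(y t - y s) - (x t - x s) = (p' - p) + (r' - r)"
      using gr(1) by (simp add: p_def p'_def r_def r'_def algebra_simps)
    have X: "X s t = X s a + X a b + X b t + tens p q + tens p r + tens q r"
      using chen_x[of s a b] chen_x[of s b t] ab st
      by (simp add: p_def q_def r_def tens.diff_left)
    have Y: "Y s t = Y s a + X a b + Y b t + tens p' q + tens p' r' + tens q r'"
    proof -
      have "Y s b = Y s a + X a b + tens p' q"
        using chen_y[of s a b] ab st by (simp add: p'_def q_def gr)
      moreover have "Y s t = Y s b + Y b t + tens (y b - y s) r'"
        using chen_y[of s b t] ab st by (simp add: r'_def)
      moreover have "y b - y s = p' + q"
        unfolding p'_def q_def gr(1)[symmetric] by simp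
      ultimately show ?thesis by (simp add: tens.add_left)
    qed
    have "Y s t - X s t = (Y s a - X s a) + (Y b t - X b t) + tens (p' - p) q + tens q (r' - r)
        + (tens p' r' - tens p r)"
      unfolding X Y by (simp add: tens.diff_left tens.diff_right)
    also have "norm \<dots> \<le> norm (Y s a - X s a) + norm (Y b t - X b t) + norm (tens (p' - p) q)
        + norm (tens q (r' - r)) + norm (tens p' r' - tens p r)"
      by (intro norm_triangle_le add_mono order_refl)
    also have "\<dots> \<le> 2 * (\<epsilon> * g)\<^sup>2 + 2 * (\<epsilon> * g)\<^sup>2 + 2 * (\<epsilon> * g) * (C * g) + (C * g) * (2 * (\<epsilon> * g)) + 2 * (\<epsilon> * g)\<^sup>2"
    proof (intro add_mono)
      show "norm (Y s a - X s a) \<le> 2 * (\<epsilon> * g)\<^sup>2" "norm (Y b t - X b t) \<le> 2 * (\<epsilon> * g)\<^sup>2"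
        using norm_triangle_ineq4[of "Y s a" "X s a"] norm_triangle_ineq4[of "Y b t" "X b t"] e by auto
      show "norm (tens (p' - p) q) \<le> 2 * (\<epsilon> * g) * (C * g)"
        unfolding norm_tens using d q \<epsilon> g0 by (intro mult_mono) auto
      show "norm (tens q (r' - r)) \<le> (C * g) * (2 * (\<epsilon> * g))"
        unfolding norm_tens using d q C g0 by (intro mult_mono) auto
      have "norm (tens p' r') \<le> (\<epsilon> * g) * (\<epsilon> * g)" "norm (tens p r) \<le> (\<epsilon> * g) * (\<epsilon> * g)"
        unfolding norm_tens using e \<epsilon> g0 by (auto intro!: mult_mono)
      then show "norm (tens p' r' - tens p r) \<le> 2 * (\<epsilon> * g)\<^sup>2"
        using norm_triangle_ineq4[of "tens p' r'" "tens p r"] by (simp add: power2_eq_square)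
    qed
    also have "\<dots> = (6 * \<epsilon>\<^sup>2 + 4 * \<epsilon> * C) * g\<^sup>2"
      by (simp add: power2_eq_square algebra_simps)
    finally have "norm (Y s t - X s t) \<le> (6 * \<epsilon>\<^sup>2 + 4 * \<epsilon> * C) * g\<^sup>2" .
    moreover have "norm ((y t - y s) - (x t - x s)) \<le> 4 * \<epsilon> * g"
      unfolding incr using norm_triangle_ineq[of "p' - p" "r' - r"] d by simp
    ultimately show ?thesis by (simp add: g_def)
  qed
qed

end

section \<open>Smooth approximation of weakly geometric rough paths\<close>

lemma powr_interpolate:
  fixes \<rho> h :: real
  assumes "0 \<le> \<rho>" "\<rho> \<le> h" "\<beta> \<le> \<alpha>"
  shows "\<rho> powr \<alpha> \<le> h powr (\<alpha> - \<beta>) * \<rho> powr \<beta>"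
proof -
  have "\<rho> powr \<alpha> = \<rho> powr (\<alpha> - \<beta>) * \<rho> powr \<beta>"
    by (simp flip: powr_add)
  also have "\<dots> \<le> h powr (\<alpha> - \<beta>) * \<rho> powr \<beta>"
    using assms by (intro mult_right_mono powr_mono2) auto
  finally show ?thesis .
qed

lemma powr_double: "(\<rho>::real) powr (2 * \<alpha>) = (\<rho> powr \<alpha>)\<^sup>2"
  by (simp add: power2_eq_square flip: powr_add)

lemma small_mesh_exists:
  fixes K \<gamma> T \<epsilon> :: real
  assumes "0 < T" "0 < \<gamma>" "0 < \<epsilon>"
  obtains n :: nat where "0 < n" "K * (T / real n) powr \<gamma> \<le> \<epsilon>"
proof -
  have "(\<lambda>n. T / real n) \<longlonglongrightarrow> 0" by (rule lim_const_over_n)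
  then have "(\<lambda>n. K * (T / real n) powr \<gamma>) \<longlonglongrightarrow> K * 0"
    using assms(1,2)
    by (intro tendsto_intros tendsto_zero_powrI[where b = \<gamma>]) (auto intro!: always_eventually)
  then have "eventually (\<lambda>n. K * (T / real n) powr \<gamma> < \<epsilon>) sequentially"
    using assms(3) by (intro order_tendstoD) auto
  then have "eventually (\<lambda>n. 0 < n \<and> K * (T / real n) powr \<gamma> < \<epsilon>) sequentially"
    using eventually_gt_at_top[of 0] by eventually_elim auto
  then have "\<exists>n. 0 < n \<and> K * (T / real n) powr \<gamma> < \<epsilon>"
    by (rule eventually_happens'[OF sequentially_bot])
  then show thesis using that less_imp_le by blast
qed

lemma holder_imp_continuous_on:
  fixes f :: "real \<Rightarrow> 'a::real_normed_vector"
  assumes "0 < \<alpha>" and f: "\<And>s t. s \<in> S \<Longrightarrow> t \<in> S \<Longrightarrow> norm (f t - f s) \<le> C * \<bar>t - s\<bar> powr \<alpha>"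
  shows "continuous_on S f"
  unfolding continuous_on_def
proof
  fix s assume s: "s \<in> S"
  have "((\<lambda>t. \<bar>t - s\<bar>) \<longlongrightarrow> 0) (at s within S)"
    by (rule tendsto_eq_intros refl | simp)+
  then have "((\<lambda>t. C * \<bar>t - s\<bar> powr \<alpha>) \<longlongrightarrow> C * 0) (at s within S)"
    using assms(1) by (intro tendsto_intros tendsto_zero_powrI[where b = \<alpha>]) auto
  then have lim: "((\<lambda>t. C * \<bar>t - s\<bar> powr \<alpha>) \<longlongrightarrow> 0) (at s within S)" by simp
  have "eventually (\<lambda>t. norm (f t - f s) \<le> C * \<bar>t - s\<bar> powr \<alpha>) (at s within S)"
    unfolding eventually_at using f[OF s] by (intro exI[of _ 1]) simp
  from Lim_null_comparison[OF this lim] show "(f \<longlongrightarrow> f s) (at s within S)" by (simp add: LIM_zero_iff)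
qed

context hilbert_tensor
begin

lemma rough_paths_chen:
  assumes "(x, X) \<in> rough_paths tens T \<alpha>" "s \<in> {0..T}" "u \<in> {0..T}" "t \<in> {0..T}"
  shows "X s t = X s u + X u t + tens (x u - x s) (x t - x u)"
proof -
  have "X s t - X s u - X u t = tens (x u - x s) (x t - x u)"
    using assms by (auto simp: rough_paths_def)
  then show ?thesis by (simp add: algebra_simps)
qed

lemma rough_paths_bound:
  assumes "(x, X) \<in> rough_paths tens T \<alpha>"
  shows "\<exists>C\<ge>1. \<forall>s\<in>{0..T}. \<forall>t\<in>{0..T}.
    norm (x t - x s) \<le> C * \<bar>t - s\<bar> powr \<alpha> \<and> norm (X s t) \<le> C * (\<bar>t - s\<bar> powr \<alpha>)\<^sup>2"
proof -
  obtain C where C: "\<forall>s\<in>{0..T}. \<forall>t\<in>{0..T}.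
      norm (x t - x s) \<le> C * \<bar>t - s\<bar> powr \<alpha> \<and> norm (X s t) \<le> C * \<bar>t - s\<bar> powr (2 * \<alpha>)"
    using assms unfolding rough_paths_def by blast
  have "norm (x t - x s) \<le> max 1 C * \<bar>t - s\<bar> powr \<alpha> \<and>
      norm (X s t) \<le> max 1 C * (\<bar>t - s\<bar> powr \<alpha>)\<^sup>2" if st: "s \<in> {0..T}" "t \<in> {0..T}" for s t
  proof -
    have "C * \<bar>t - s\<bar> powr \<alpha> \<le> max 1 C * \<bar>t - s\<bar> powr \<alpha>"
      "C * (\<bar>t - s\<bar> powr \<alpha>)\<^sup>2 \<le> max 1 C * (\<bar>t - s\<bar> powr \<alpha>)\<^sup>2"
      by (intro mult_right_mono; simp)+
    moreover have "norm (x t - x s) \<le> C * \<bar>t - s\<bar> powr \<alpha>"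
      "norm (X s t) \<le> C * (\<bar>t - s\<bar> powr \<alpha>)\<^sup>2"
      using C st by (auto simp flip: powr_double)
    ultimately show ?thesis by linarith
  qed
  then show ?thesis by (intro exI[of _ "max 1 C"]) simp
qed

lemma rough_paths_mono:
  assumes "\<beta> \<le> \<alpha>" "(x, X) \<in> rough_paths tens T \<alpha>"
  shows "(x, X) \<in> rough_paths tens T \<beta>"
proof -
  obtain C where C: "1 \<le> C"
    "\<And>s t. s \<in> {0..T} \<Longrightarrow> t \<in> {0..T} \<Longrightarrow> norm (x t - x s) \<le> C * \<bar>t - s\<bar> powr \<alpha>"
    "\<And>s t. s \<in> {0..T} \<Longrightarrow> t \<in> {0..T} \<Longrightarrow> norm (X s t) \<le> C * (\<bar>t - s\<bar> powr \<alpha>)\<^sup>2"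
    using rough_paths_bound[OF assms(2)] by blast
  define k where "k = T powr (\<alpha> - \<beta>)"
  have k: "0 \<le> k" by (simp add: k_def)
  define C' where "C' = C * k + C * k\<^sup>2"
  have "norm (x t - x s) \<le> C' * \<bar>t - s\<bar> powr \<beta> \<and> norm (X s t) \<le> C' * \<bar>t - s\<bar> powr (2 * \<beta>)"
    if st: "s \<in> {0..T}" "t \<in> {0..T}" for s t
  proof -
    have le: "\<bar>t - s\<bar> powr \<alpha> \<le> k * \<bar>t - s\<bar> powr \<beta>"
      unfolding k_def using st assms(1) by (intro powr_interpolate) auto
    then have "(\<bar>t - s\<bar> powr \<alpha>)\<^sup>2 \<le> (k * \<bar>t - s\<bar> powr \<beta>)\<^sup>2" by (intro power_mono) auto
    with le have "C * \<bar>t - s\<bar> powr \<alpha> \<le> C * (k * \<bar>t - s\<bar> powr \<beta>)"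
      "C * (\<bar>t - s\<bar> powr \<alpha>)\<^sup>2 \<le> C * (k * \<bar>t - s\<bar> powr \<beta>)\<^sup>2"
      using C(1) by (auto intro: mult_left_mono)
    moreover have "C * k * \<bar>t - s\<bar> powr \<beta> \<le> C' * \<bar>t - s\<bar> powr \<beta>"
      "C * k\<^sup>2 * (\<bar>t - s\<bar> powr \<beta>)\<^sup>2 \<le> C' * (\<bar>t - s\<bar> powr \<beta>)\<^sup>2"
      using C(1) k by (intro mult_right_mono; simp add: C'_def)+
    ultimately show ?thesis
      using C(2,3)[OF st] by (simp add: powr_double power_mult_distrib mult.assoc)
  qed
  then show ?thesis
    using assms(2) unfolding rough_paths_def by blast
qed

text \<open>
  Below a scale \<open>h\<close> the Hoelder bounds of both paths make the difference small in the \<open>\<beta>\<close>-norm.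
  Above it \<open>t - s\<close> is bounded from below, and uniform closeness suffices. Uniform closeness
  of \<open>X s t\<close> follows from that of \<open>X 0 t\<close> and \<open>X 0 s\<close> by Chen's relation.
\<close>
lemma projection_close:
  assumes rp: "(x, X) \<in> rough_paths tens T \<alpha>" and T: "0 < T" and \<beta>: "0 < \<beta>" "\<beta> < \<alpha>" and \<delta>: "0 < \<delta>"
  obtains B where "finite B" "orthonormal B"
    "\<And>s t. 0 \<le> s \<Longrightarrow> s \<le> t \<Longrightarrow> t \<le> T \<Longrightarrow>
      norm (proj B (x t - x s) - (x t - x s)) \<le> \<delta> * (t - s) powr \<beta> \<and>
      norm (proj2 B (X s t) - X s t) \<le> \<delta> * ((t - s) powr \<beta>)\<^sup>2"
proof -
  obtain C where C: "1 \<le> C"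
    and x_le: "\<And>s t. s \<in> {0..T} \<Longrightarrow> t \<in> {0..T} \<Longrightarrow> norm (x t - x s) \<le> C * \<bar>t - s\<bar> powr \<alpha>"
    and X_le: "\<And>s t. s \<in> {0..T} \<Longrightarrow> t \<in> {0..T} \<Longrightarrow> norm (X s t) \<le> C * (\<bar>t - s\<bar> powr \<alpha>)\<^sup>2"
    using rough_paths_bound[OF rp] by blast
  note chen = rough_paths_chen[OF rp]
  define D where "D = C * T powr \<alpha>"
  have D0: "0 \<le> D" using C by (simp add: D_def)
  have pow_T: "\<bar>t - s\<bar> powr \<alpha> \<le> T powr \<alpha>" if "s \<in> {0..T}" "t \<in> {0..T}" for s t
    using that \<beta> by (intro powr_mono2) auto
  have x_D: "norm (x t - x s) \<le> D" if "s \<in> {0..T}" "t \<in> {0..T}" for s t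
    unfolding D_def using C by (intro order_trans[OF x_le[OF that] mult_left_mono[OF pow_T[OF that]]]) simp
  have "continuous_on {0..T} x"
    using \<beta> x_le by (intro holder_imp_continuous_on[of \<alpha> _ _ C]) auto
  then have K1: "compact (x ` {0..T})" by (intro compact_continuous_image) auto
  have "continuous_on {0..T} (X 0)"
  proof (rule holder_imp_continuous_on[of \<alpha>])
    show "0 < \<alpha>" using \<beta> by simp
    fix s t assume st: "s \<in> {0..T}" "t \<in> {0..T}"
    have "X 0 t - X 0 s = X s t + tens (x s - x 0) (x t - x s)"
      using chen[of 0 s t] st T by simp
    then have "norm (X 0 t - X 0 s) \<le> norm (X s t) + norm (x s - x 0) * norm (x t - x s)"
      by (metis norm_tens norm_triangle_ineq)
    also have "norm (X s t) \<le> C * (T powr \<alpha> * \<bar>t - s\<bar> powr \<alpha>)"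
      using C mult_right_mono[OF pow_T[OF st], of "\<bar>t - s\<bar> powr \<alpha>"]
      by (intro order_trans[OF X_le[OF st] mult_left_mono]) (simp_all add: power2_eq_square)
    also have "norm (x s - x 0) * norm (x t - x s) \<le> D * (C * \<bar>t - s\<bar> powr \<alpha>)"
      using st T D0 by (intro mult_mono x_D x_le) auto
    finally show "norm (X 0 t - X 0 s) \<le> (D + D * C) * \<bar>t - s\<bar> powr \<alpha>"
      by (simp add: D_def algebra_simps)
  qed
  then have K2: "compact (X 0 ` {0..T})" by (intro compact_continuous_image) auto
  \<comment> \<open>The bound by 1 gives \<open>\<delta>'\<^sup>2 \<le> \<delta>'\<close>, so one choice of \<open>h\<close> serves both levels.\<close>
  define \<delta>' where "\<delta>' = min 1 \<delta>"
  have \<delta>': "0 < \<delta>'" "\<delta>' \<le> 1" "\<delta>' \<le> \<delta>" using \<delta> by (auto simp: \<delta>'_def)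
  obtain n :: nat where n: "0 < n" "2 * C * (T / real n) powr (\<alpha> - \<beta>) \<le> \<delta>'"
    using small_mesh_exists[of T "\<alpha> - \<beta>" \<delta>' "2 * C"] T \<beta> \<delta>' by auto
  define h where "h = T / real n"
  have h: "0 < h" "2 * C * h powr (\<alpha> - \<beta>) \<le> \<delta>'" using n T by (auto simp: h_def)
  define m where "m = min (h powr \<beta>) ((h powr \<beta>)\<^sup>2)"
  have m: "0 < m" using h by (simp add: m_def)
  define \<mu> where "\<mu> = \<delta> * m / (2 + 4 * D)"
  have \<mu>: "0 < \<mu>" using \<delta> m D0 by (simp add: \<mu>_def)
  obtain B where B: "finite B" "orthonormal B"
    and ap1: "\<And>y. y \<in> x ` {0..T} \<Longrightarrow> norm (proj B y - y) \<le> \<mu>"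
    and ap2: "\<And>A. A \<in> X 0 ` {0..T} \<Longrightarrow> norm (proj2 B A - A) \<le> \<mu>"
    using finite_rank_projections_approximate[OF K1 K2 \<mu>] by blast
  have lin2: "linear (proj2 B)" by (rule bounded_linear.linear[OF bounded_linear_proj2[OF B(2)]])
  have unif1: "norm (proj B (x t - x s) - (x t - x s)) \<le> 2 * \<mu>"
    if "s \<in> {0..T}" "t \<in> {0..T}" for s t
  proof -
    have "proj B (x t - x s) - (x t - x s) = (proj B (x t) - x t) - (proj B (x s) - x s)"
      by (simp add: linear_diff[OF linear_proj])
    also have "norm \<dots> \<le> \<mu> + \<mu>"
      using that by (intro order_trans[OF norm_triangle_ineq4] add_mono ap1) auto
    finally show ?thesis by simp
  qed
  have unif2: "norm (proj2 B (X s t) - X s t) \<le> (2 + 4 * D) * \<mu>"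
    if st: "s \<in> {0..T}" "t \<in> {0..T}" for s t
  proof -
    define u v where "u = x s - x 0" and "v = x t - x s"
    have X: "X s t = X 0 t - X 0 s - tens u v"
      using chen[of 0 s t] st T by (simp add: u_def v_def)
    have "proj2 B (X s t) - X s t = (proj2 B (X 0 t) - X 0 t) - (proj2 B (X 0 s) - X 0 s)
        - (tens (proj B u - u) (proj B v) + tens u (proj B v - v))"
      unfolding X by (simp add: linear_diff[OF lin2] proj2_tens[OF B(2)] tens.diff_left tens.diff_right)
    also have "norm \<dots> \<le> (norm (proj2 B (X 0 t) - X 0 t) + norm (proj2 B (X 0 s) - X 0 s))
        + (norm (tens (proj B u - u) (proj B v)) + norm (tens u (proj B v - v)))"
      by (intro order_trans[OF norm_triangle_ineq4] add_mono norm_triangle_ineq norm_triangle_ineq4)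
    also have "\<dots> \<le> (\<mu> + \<mu>) + ((2 * \<mu>) * D + D * (2 * \<mu>))"
    proof (intro add_mono)
      show "norm (proj2 B (X 0 t) - X 0 t) \<le> \<mu>" "norm (proj2 B (X 0 s) - X 0 s) \<le> \<mu>"
        using st by (auto intro: ap2)
      have uv: "norm (proj B u - u) \<le> 2 * \<mu>" "norm (proj B v - v) \<le> 2 * \<mu>"
        unfolding u_def v_def using st T by (auto intro: unif1)
      have "norm u \<le> D" "norm v \<le> D" unfolding u_def v_def using st T by (auto intro: x_D)
      moreover have "norm (proj B v) \<le> D" using norm_proj_le[OF B, of v] \<open>norm v \<le> D\<close> by simp
      ultimately show "norm (tens (proj B u - u) (proj B v)) \<le> (2 * \<mu>) * D"
        "norm (tens u (proj B v - v)) \<le> D * (2 * \<mu>)"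
        unfolding norm_tens using uv \<mu> D0 by (auto intro!: mult_mono)
    qed
    finally show ?thesis by (simp add: algebra_simps)
  qed
  show thesis
  proof (rule that[OF B])
    fix s t assume st: "0 \<le> s" "s \<le> t" "t \<le> T"
    then have st': "s \<in> {0..T}" "t \<in> {0..T}" by auto
    define \<rho> where "\<rho> = t - s"
    have \<rho>: "0 \<le> \<rho>" "\<bar>t - s\<bar> = \<rho>" using st by (auto simp: \<rho>_def)
    define d1 d2 where "d1 = norm (proj B (x t - x s) - (x t - x s))"
      and "d2 = norm (proj2 B (X s t) - X s t)"
    have "d1 \<le> \<delta> * \<rho> powr \<beta> \<and> d2 \<le> \<delta> * (\<rho> powr \<beta>)\<^sup>2"
    proof (cases "\<rho> \<le> h")
      case True
      have "d1 \<le> norm (x t - x s) + norm (x t - x s)"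
        unfolding d1_def using norm_triangle_ineq4[of "proj B (x t - x s)" "x t - x s"]
          norm_proj_le[OF B, of "x t - x s"] by simp
      then have d1: "d1 \<le> 2 * C * \<rho> powr \<alpha>" using x_le[OF st'] \<rho> by simp
      have "d2 \<le> norm (X s t) + norm (X s t)"
        unfolding d2_def using norm_triangle_ineq4[of "proj2 B (X s t)" "X s t"]
          norm_proj2_le[OF B, of "X s t"] by simp
      then have d2: "d2 \<le> 2 * C * (\<rho> powr \<alpha>)\<^sup>2" using X_le[OF st'] \<rho> by simp
      have "2 * C * \<rho> powr \<alpha> \<le> 2 * C * (h powr (\<alpha> - \<beta>) * \<rho> powr \<beta>)"
        using True \<rho> \<beta> C by (intro mult_left_mono powr_interpolate) auto
      also have "\<dots> = (2 * C * h powr (\<alpha> - \<beta>)) * \<rho> powr \<beta>" by simp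
      also have "\<dots> \<le> \<delta>' * \<rho> powr \<beta>" using h by (intro mult_right_mono) auto
      finally have le: "2 * C * \<rho> powr \<alpha> \<le> \<delta>' * \<rho> powr \<beta>" .
      have "2 * C * (\<rho> powr \<alpha>)\<^sup>2 \<le> (2 * C * \<rho> powr \<alpha>)\<^sup>2"
      proof -
        have "2 * C \<le> (2 * C)\<^sup>2" using C by (simp add: power2_eq_square)
        from mult_right_mono[OF this, of "(\<rho> powr \<alpha>)\<^sup>2"] show ?thesis
          by (simp add: power_mult_distrib)
      qed
      also have "\<dots> \<le> (\<delta>' * \<rho> powr \<beta>)\<^sup>2" using le C by (intro power_mono) auto
      also have "\<dots> \<le> \<delta>' * (\<rho> powr \<beta>)\<^sup>2"
      proof -
        have "\<delta>'\<^sup>2 \<le> \<delta>'" using \<delta>' by (simp add: power2_eq_square mult_left_le)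
        from mult_right_mono[OF this, of "(\<rho> powr \<beta>)\<^sup>2"] show ?thesis
          by (simp add: power_mult_distrib)
      qed
      finally have le2: "2 * C * (\<rho> powr \<alpha>)\<^sup>2 \<le> \<delta>' * (\<rho> powr \<beta>)\<^sup>2" .
      have "\<delta>' * \<rho> powr \<beta> \<le> \<delta> * \<rho> powr \<beta>" "\<delta>' * (\<rho> powr \<beta>)\<^sup>2 \<le> \<delta> * (\<rho> powr \<beta>)\<^sup>2"
        using \<delta>' by (auto intro: mult_right_mono)
      then show ?thesis using d1 d2 le le2 by linarith
    next
      case False
      have hp: "h powr \<beta> \<le> \<rho> powr \<beta>" using False h \<beta> by (intro powr_mono2) auto
      then have hp2: "(h powr \<beta>)\<^sup>2 \<le> (\<rho> powr \<beta>)\<^sup>2" by (intro power_mono) auto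
      have "m \<le> h powr \<beta>" "m \<le> (h powr \<beta>)\<^sup>2" by (simp_all add: m_def)
      then have "m \<le> \<rho> powr \<beta>" "m \<le> (\<rho> powr \<beta>)\<^sup>2" using hp hp2 by linarith+
      then have m_le: "\<delta> * m \<le> \<delta> * \<rho> powr \<beta>" "\<delta> * m \<le> \<delta> * (\<rho> powr \<beta>)\<^sup>2"
        using \<delta> by (auto intro: mult_left_mono)
      have eq: "(2 + 4 * D) * \<mu> = \<delta> * m" using D0 by (simp add: \<mu>_def)
      have "2 * \<mu> \<le> (2 + 4 * D) * \<mu>" using \<mu> D0 by (intro mult_right_mono) auto
      then show ?thesis
        using unif1[OF st'] unif2[OF st'] m_le eq unfolding d1_def d2_def by linarith
    qed
    then show "norm (proj B (x t - x s) - (x t - x s)) \<le> \<delta> * (t - s) powr \<beta> \<and>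
      norm (proj2 B (X s t) - X s t) \<le> \<delta> * ((t - s) powr \<beta>)\<^sup>2"
      by (simp add: d1_def d2_def \<rho>_def)
  qed
qed

end

context c1_path
begin

definition lift :: "real \<Rightarrow> real \<Rightarrow> 'a \<times> 'b" where
  "lift s t = (y t - y s, area s t)"

lemma lift_mult:
  assumes "0 \<le> s" "s \<le> u" "u \<le> t" "t \<le> T"
  shows "lift s t = grp_mult tens (lift s u) (lift u t)"
  by (simp add: lift_def grp_mult_def area_chen[OF assms])

lemma lift_refl [simp]: "lift s s = (0, 0)"
  by (simp add: lift_def)

lemma lift_polygon:
  assumes \<eta>: "0 < \<eta>" and T: "T = real m * \<eta>"
    and steps: "\<And>i. i < m \<Longrightarrow> lift (real i * \<eta>) (real (Suc i) * \<eta>) = (v i, (1/2) *\<^sub>R tens (v i) (v i))"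
    and "i + k \<le> m"
  shows "lift (real i * \<eta>) (real (i + k) * \<eta>) = word_prod (map v [i..<i + k])"
  using assms(4)
proof (induction k)
  case 0
  then show ?case by simp
next
  case (Suc k)
  have "lift (real i * \<eta>) (real (i + Suc k) * \<eta>) =
      grp_mult tens (lift (real i * \<eta>) (real (i + k) * \<eta>)) (lift (real (i + k) * \<eta>) (real (i + Suc k) * \<eta>))"
    unfolding T using \<eta> Suc.prems by (intro lift_mult[unfolded T]) (auto intro!: mult_right_mono)
  also have "lift (real (i + k) * \<eta>) (real (i + Suc k) * \<eta>) = word_prod [v (i + k)]"
    using steps[of "i + k"] Suc.prems by simp
  also have "lift (real i * \<eta>) (real (i + k) * \<eta>) = word_prod (map v [i..<i + k])"
    using Suc by simp
  also have "grp_mult tens (word_prod (map v [i..<i + k])) (word_prod [v (i + k)]) =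
      word_prod (map v [i..<i + Suc k])"
    by (simp only: word_prod_append[symmetric]) simp
  finally show ?case .
qed

end

context hilbert_tensor
begin

text \<open>
  The polygon of mesh \<open>\<eta> = h / N\<close> that follows, in the \<open>i\<close>-th cell of mesh \<open>h\<close>, the word of the
  increment over that cell. The number \<open>N\<close> of letters and the constant \<open>C\<close> are fixed before \<open>h\<close> is
  chosen, so the factor \<open>h powr (\<alpha> - \<beta>)\<close> beats them.
\<close>
lemma polygon_close:
  fixes x :: "real \<Rightarrow> 'a" and X :: "real \<Rightarrow> real \<Rightarrow> 'b"
  assumes T: "0 < T" and \<beta>: "0 < \<beta>" "\<beta> < \<alpha>" "\<alpha> < 1" and C: "1 \<le> C" and N: "0 < N" and \<delta>: "0 < \<delta>"
    and chen: "\<And>s u t. 0 \<le> s \<Longrightarrow> s \<le> u \<Longrightarrow> u \<le> t \<Longrightarrow> t \<le> T \<Longrightarrow>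
      X s t = X s u + X u t + tens (x u - x s) (x t - x u)"
    and x_le: "\<And>s t. 0 \<le> s \<Longrightarrow> s \<le> t \<Longrightarrow> t \<le> T \<Longrightarrow> norm (x t - x s) \<le> C * (t - s) powr \<alpha>"
    and X_le: "\<And>s t. 0 \<le> s \<Longrightarrow> s \<le> t \<Longrightarrow> t \<le> T \<Longrightarrow> norm (X s t) \<le> (C * (t - s) powr \<alpha>)\<^sup>2"
    and word: "\<And>s t. 0 \<le> s \<Longrightarrow> s \<le> t \<Longrightarrow> t \<le> T \<Longrightarrow>
      \<exists>vs. length vs = N \<and> (\<forall>v\<in>set vs. norm v \<le> C * (t - s) powr \<alpha>) \<and> word_prod vs = (x t - x s, X s t)"
  shows "\<exists>y y'. smooth_path T y \<and> c1_path tens swap coord T y y' \<and>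
    (\<forall>s t. 0 \<le> s \<longrightarrow> s \<le> t \<longrightarrow> t \<le> T \<longrightarrow>
      norm ((y t - y s) - (x t - x s)) \<le> \<delta> * (t - s) powr \<beta> \<and>
      norm (c1_path.area tens y y' s t - X s t) \<le> \<delta> * ((t - s) powr \<beta>)\<^sup>2)"
proof -
  obtain M where M: "0 < M" and polygon:
    "\<And>\<eta> m r (v :: nat \<Rightarrow> 'a). 0 < \<eta> \<Longrightarrow> 0 < m \<Longrightarrow> (\<And>i. i < m \<Longrightarrow> norm (v i) \<le> r) \<Longrightarrow>
      \<exists>y y'. smooth_path (real m * \<eta>) y \<and> c1_path tens swap coord (real m * \<eta>) y y' \<and>
        (\<forall>t\<in>{0..real m * \<eta>}. norm (y' t) \<le> M * r / \<eta>) \<and>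
        (\<forall>i<m. y (real (Suc i) * \<eta>) - y (real i * \<eta>) = v i \<and>
          c1_path.area tens y y' (real i * \<eta>) (real (Suc i) * \<eta>) = (1/2) *\<^sub>R tens (v i) (v i))"
    using smoothed_polygon_exists by blast
  define C' where "C' = C * T powr (\<alpha> - \<beta>)"
  have C': "0 \<le> C'" using C by (simp add: C'_def)
  \<comment> \<open>ensures \<open>4 * \<epsilon> \<le> \<delta>\<close> and \<open>6 * \<epsilon>\<^sup>2 + 4 * \<epsilon> * C' \<le> \<delta>\<close>, the constants of \<open>close_from_grid\<close>\<close>
  define \<epsilon> where "\<epsilon> = min 1 (\<delta> / (6 + 4 * C'))"
  have \<epsilon>: "0 < \<epsilon>" "\<epsilon> \<le> 1" "\<epsilon> \<le> \<delta> / (6 + 4 * C')"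
    using \<delta> C' by (auto simp: \<epsilon>_def)
  have \<epsilon>_\<delta>: "(6 + 4 * C') * \<epsilon> \<le> \<delta>"
    using \<epsilon>(3) C' by (simp add: pos_le_divide_eq mult.commute)
  \<comment> \<open>a bound both for the constant of \<open>x\<close> and, up to \<open>h powr (\<alpha> - 1)\<close>, for the speed of the polygon\<close>
  define Q where "Q = C + M * N * C"
  have Q: "C \<le> Q" "M * N * C \<le> Q" using M C by (auto simp: Q_def)
  obtain n :: nat where n: "0 < n" "Q * (T / real n) powr (\<alpha> - \<beta>) \<le> \<epsilon>"
    using small_mesh_exists[of T "\<alpha> - \<beta>" \<epsilon> Q] T \<beta> \<epsilon> by auto
  define h where "h = T / real n"
  have h: "0 < h" "Q * h powr (\<alpha> - \<beta>) \<le> \<epsilon>" and T_h: "T = real n * h"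
    using n T by (auto simp: h_def)
  have gridT: "real i * h \<le> T" if "i \<le> n" for i
    unfolding T_h using that h by (intro mult_right_mono) auto
  have "\<forall>i. \<exists>vs. i < n \<longrightarrow> length vs = N \<and> (\<forall>v\<in>set vs. norm v \<le> C * h powr \<alpha>) \<and>
      word_prod vs = (x (real (Suc i) * h) - x (real i * h), X (real i * h) (real (Suc i) * h))"
  proof
    fix i
    have "real (Suc i) * h - real i * h = h" by (simp add: algebra_simps)
    then show "\<exists>vs. i < n \<longrightarrow> length vs = N \<and> (\<forall>v\<in>set vs. norm v \<le> C * h powr \<alpha>) \<and>
      word_prod vs = (x (real (Suc i) * h) - x (real i * h), X (real i * h) (real (Suc i) * h))"
      using word[of "real i * h" "real (Suc i) * h"] gridT[of "Suc i"] h
      by (cases "i < n") (auto simp: mult_right_mono)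
  qed
  then obtain W where W: "\<And>i. i < n \<Longrightarrow> length (W i) = N"
    "\<And>i v. i < n \<Longrightarrow> v \<in> set (W i) \<Longrightarrow> norm v \<le> C * h powr \<alpha>"
    "\<And>i. i < n \<Longrightarrow> word_prod (W i) =
        (x (real (Suc i) * h) - x (real i * h), X (real i * h) (real (Suc i) * h))"
    by metis
  define \<eta> where "\<eta> = h / real N"
  have \<eta>: "0 < \<eta>" using h N by (simp add: \<eta>_def)
  define m where "m = n * N"
  have m: "0 < m" using n N by (simp add: m_def)
  have h_\<eta>: "real i * h = real (i * N) * \<eta>" for i using N by (simp add: \<eta>_def)
  have T_\<eta>: "T = real m * \<eta>" unfolding T_h m_def by (rule h_\<eta>)
  \<comment> \<open>the letters of the words \<open>W 0, W 1, ...\<close>, one after the other\<close>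
  define v where "v j = W (j div N) ! (j mod N)" for j
  have v_le: "norm (v j) \<le> C * h powr \<alpha>" if "j < m" for j
  proof -
    have "j div N < n" using that by (simp add: m_def less_mult_imp_div_less)
    then show ?thesis unfolding v_def using W(1,2) N by (metis mod_less_divisor nth_mem)
  qed
  obtain y y' where smooth: "smooth_path T y" and c1: "c1_path tens swap coord T y y'"
    and y'_le: "\<And>t. t \<in> {0..T} \<Longrightarrow> norm (y' t) \<le> M * (C * h powr \<alpha>) / \<eta>"
    and steps: "\<And>i. i < m \<Longrightarrow> y (real (Suc i) * \<eta>) - y (real i * \<eta>) = v i \<and>
          c1_path.area tens y y' (real i * \<eta>) (real (Suc i) * \<eta>) = (1/2) *\<^sub>R tens (v i) (v i)"
    using polygon[of \<eta> m v "C * h powr \<alpha>", OF \<eta> m v_le] unfolding T_\<eta>[symmetric] by blast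
  interpret y: c1_path tens swap coord T y y' by (rule c1)
  have cell: "y.lift (real i * h) (real (Suc i) * h) =
      (x (real (Suc i) * h) - x (real i * h), X (real i * h) (real (Suc i) * h))" if i: "i < n" for i
  proof -
    have "i * N + N \<le> m" using i by (metis Suc_leI add.commute m_def mult_Suc mult_le_mono1)
    then have "y.lift (real (i * N) * \<eta>) (real (i * N + N) * \<eta>) = word_prod (map v [i * N..<i * N + N])"
      using steps by (intro y.lift_polygon[OF \<eta> T_\<eta>]) (auto simp: y.lift_def)
    moreover have "map v [i * N..<i * N + N] = W i"
      using W(1)[OF i] N by (intro nth_equalityI) (auto simp: v_def)
    moreover have "i * N + N = Suc i * N" by simp
    ultimately show ?thesis using W(3)[OF i] by (simp only: h_\<eta>)
  qed
  have grid: "y.lift (real i * h) (real j * h) = (x (real j * h) - x (real i * h), X (real i * h) (real j * h))"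
    if "i \<le> j" "j \<le> n" for i j
    using that
  proof (induction j rule: dec_induct)
    case base
    have "X (real i * h) (real i * h) = X (real i * h) (real i * h) + X (real i * h) (real i * h)
        + tens (x (real i * h) - x (real i * h)) (x (real i * h) - x (real i * h))"
      using gridT[OF base] h by (intro chen) auto
    then show ?case by (simp add: tens.zero_left)
  next
    case (step j)
    have le: "0 \<le> real i * h" "real i * h \<le> real j * h" "real j * h \<le> real (Suc j) * h"
      using step.hyps h by (auto intro!: mult_right_mono)
    note le = le gridT[OF step.prems]
    have "y.lift (real i * h) (real (Suc j) * h) =
        grp_mult tens (y.lift (real i * h) (real j * h)) (y.lift (real j * h) (real (Suc j) * h))"
      by (rule y.lift_mult[OF le])
    then show ?case
      using step.IH step.prems cell[of j] chen[OF le] by (simp add: grp_mult_def del: of_nat_Suc)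
  qed
  have L_eq: "M * (C * h powr \<alpha>) / \<eta> = M * N * C * h powr (\<alpha> - 1)"
    using h N by (simp add: \<eta>_def powr_diff)
  have small: "norm (x t - x s) \<le> \<epsilon> * (t - s) powr \<beta> \<and> norm (y t - y s) \<le> \<epsilon> * (t - s) powr \<beta> \<and>
      norm (X s t) \<le> (\<epsilon> * (t - s) powr \<beta>)\<^sup>2 \<and> norm (y.area s t) \<le> (\<epsilon> * (t - s) powr \<beta>)\<^sup>2"
    if st: "0 \<le> s" "s \<le> t" "t \<le> T" "t \<le> s + h" for s t
  proof -
    define \<rho> where "\<rho> = t - s"
    have \<rho>: "0 \<le> \<rho>" "\<rho> \<le> h" using st by (auto simp: \<rho>_def)
    have "C * \<rho> powr \<alpha> \<le> C * (h powr (\<alpha> - \<beta>) * \<rho> powr \<beta>)"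
      using \<rho> \<beta> C by (intro mult_left_mono powr_interpolate) auto
    also have "\<dots> \<le> Q * h powr (\<alpha> - \<beta>) * \<rho> powr \<beta>"
      using mult_right_mono[OF Q(1), of "h powr (\<alpha> - \<beta>) * \<rho> powr \<beta>"] by (simp add: mult.assoc)
    also have "\<dots> \<le> \<epsilon> * \<rho> powr \<beta>" using h by (intro mult_right_mono) auto
    finally have x1: "C * \<rho> powr \<alpha> \<le> \<epsilon> * \<rho> powr \<beta>" .
    \<comment> \<open>Speed times length: since \<open>\<rho> \<le> h\<close>, the factor \<open>\<rho>\<close> can be traded for \<open>h powr (1 - \<beta>) * \<rho> powr \<beta>\<close>.\<close>
    have "M * N * C * h powr (\<alpha> - 1) * \<rho> powr 1
        \<le> M * N * C * h powr (\<alpha> - 1) * (h powr (1 - \<beta>) * \<rho> powr \<beta>)"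
      using \<rho> \<beta> C M by (intro mult_left_mono powr_interpolate) auto
    also have "\<dots> = M * N * C * h powr (\<alpha> - \<beta>) * \<rho> powr \<beta>"
      by (simp add: powr_add[symmetric])
    also have "\<dots> \<le> Q * h powr (\<alpha> - \<beta>) * \<rho> powr \<beta>"
      using mult_right_mono[OF Q(2), of "h powr (\<alpha> - \<beta>) * \<rho> powr \<beta>"] by (simp add: mult.assoc)
    also have "\<dots> \<le> \<epsilon> * \<rho> powr \<beta>" using h by (intro mult_right_mono) auto
    finally have y1: "M * N * C * h powr (\<alpha> - 1) * \<rho> \<le> \<epsilon> * \<rho> powr \<beta>" using \<rho> by simp
    have L: "norm (y t - y s) \<le> M * N * C * h powr (\<alpha> - 1) * \<rho>"
      "norm (y.area s t) \<le> (M * N * C * h powr (\<alpha> - 1) * \<rho>)\<^sup>2"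
      unfolding \<rho>_def using y.incr_le[OF st(1-3)] y.area_le[OF st(1-3)] y'_le unfolding L_eq by blast+
    have "(M * N * C * h powr (\<alpha> - 1) * \<rho>)\<^sup>2 \<le> (\<epsilon> * \<rho> powr \<beta>)\<^sup>2"
      using y1 \<rho> M C by (intro power_mono) auto
    moreover have "(C * \<rho> powr \<alpha>)\<^sup>2 \<le> (\<epsilon> * \<rho> powr \<beta>)\<^sup>2"
      using x1 C by (intro power_mono) auto
    ultimately show ?thesis
      using x_le[OF st(1-3)] X_le[OF st(1-3)] L x1 y1 unfolding \<rho>_def[symmetric] by linarith
  qed
  have large: "norm (x t - x s) \<le> C' * (t - s) powr \<beta>" if st: "0 \<le> s" "s \<le> t" "t \<le> T" for s t
  proof -
    have "C * (t - s) powr \<alpha> \<le> C * (T powr (\<alpha> - \<beta>) * (t - s) powr \<beta>)"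
      using st \<beta> C by (intro mult_left_mono powr_interpolate) auto
    then show ?thesis using x_le[OF st] by (simp add: C'_def)
  qed
  have "norm ((y t - y s) - (x t - x s)) \<le> \<delta> * (t - s) powr \<beta> \<and>
      norm (y.area s t - X s t) \<le> \<delta> * ((t - s) powr \<beta>)\<^sup>2" if st: "0 \<le> s" "s \<le> t" "t \<le> T" for s t
  proof -
    have close: "norm ((y t - y s) - (x t - x s)) \<le> 4 * \<epsilon> * (t - s) powr \<beta> \<and>
        norm (y.area s t - X s t) \<le> (6 * \<epsilon>\<^sup>2 + 4 * \<epsilon> * C') * ((t - s) powr \<beta>)\<^sup>2"
    proof (rule close_from_grid[OF h(1) n(1) T_h _ C' \<beta>(1) chen y.area_chen _ small large st])
      fix i j :: nat
      assume "i \<le> j" "j \<le> n"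
      from grid[OF this] show "y (real j * h) - y (real i * h) = x (real j * h) - x (real i * h) \<and>
        y.area (real i * h) (real j * h) = X (real i * h) (real j * h)"
        by (simp add: y.lift_def)
    qed (use \<epsilon> in auto)
    have "0 \<le> C' * \<epsilon>" using C' \<epsilon>(1) by simp
    then have "4 * \<epsilon> \<le> \<delta>" using \<epsilon>(1) \<epsilon>_\<delta> by (simp add: algebra_simps)
    moreover have "6 * \<epsilon>\<^sup>2 + 4 * \<epsilon> * C' \<le> \<delta>"
    proof -
      have "\<epsilon>\<^sup>2 \<le> \<epsilon>" using \<epsilon> by (simp add: power2_eq_square mult_left_le)
      then show ?thesis using \<epsilon>_\<delta> by (simp add: algebra_simps)
    qed
    ultimately have "4 * \<epsilon> * (t - s) powr \<beta> \<le> \<delta> * (t - s) powr \<beta>"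
      "(6 * \<epsilon>\<^sup>2 + 4 * \<epsilon> * C') * ((t - s) powr \<beta>)\<^sup>2 \<le> \<delta> * ((t - s) powr \<beta>)\<^sup>2"
      by (auto intro: mult_right_mono)
    then show ?thesis using close by linarith
  qed
  then show ?thesis using smooth c1 by blast
qed

text \<open>
  Weak geometricity says in coordinates that the symmetric part of the matrix of \<open>X s t\<close> is the matrix of
  \<open>\<xi> \<otimes> \<xi> / 2\<close>, which is what a product of exponentials requires.
\<close>
lemma weakly_geometric_words:
  assumes wg: "(x, X) \<in> weakly_geometric tens T \<alpha>" and B: "finite B" "orthonormal B"
    and st: "s \<in> {0..T}" "t \<in> {0..T}" and r: "norm (x t - x s) \<le> r" "norm (X s t) \<le> r\<^sup>2"
  shows "\<exists>vs. length vs = 1 + 4 * (card B)\<^sup>2 \<and> (\<forall>v\<in>set vs. norm v \<le> r) \<and>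
    word_prod vs = (proj B (x t - x s), proj2 B (X s t))"
  unfolding proj2_def
proof (rule word_prod_exists[OF B proj_in_span])
  show "norm (proj B (x t - x s)) \<le> r" using norm_proj_le[OF B] r(1) order_trans by blast
  fix b c assume bc: "b \<in> B" "c \<in> B"
  then have n1: "norm b = 1" "norm c = 1" using B(2) orthonormal_norm by auto
  show "\<bar>coord b c (X s t)\<bar> \<le> r\<^sup>2" using coord_le[OF n1] r(2) order_trans by blast
  have "sym_part tens (X s t) = (1/2) *\<^sub>R tens (x t - x s) (x t - x s)"
    using wg st by (auto simp: weakly_geometric_def)
  then have sym: "X s t + swap (X s t) = tens (x t - x s) (x t - x s)"
    by (simp add: sym_part_eq)
  interpret cb: bounded_linear "coord b c" by (rule coord_linear[OF n1])
  have "coord b c (swap A) = coord c b A" for A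
  proof -
    interpret cc: bounded_linear "coord c b" by (rule coord_linear[OF n1(2,1)])
    have "span {tens u v | u v. True} \<subseteq> {A. coord b c (swap A) = coord c b A}"
      by (intro span_minimal) (auto simp: subspace_def swap.zero swap.add swap.scaleR cb.zero cb.add cb.scaleR
          cc.zero cc.add cc.scaleR swap_tens coord_tens[OF n1] coord_tens[OF n1(2,1)])
    moreover have "closed {A. coord b c (swap A) = coord c b A}"
      by (intro closed_Collect_eq cb.continuous_on cc.continuous_on swap.continuous_on continuous_on_id)
    ultimately have "closure (span {tens u v | u v. True}) \<subseteq> {A. coord b c (swap A) = coord c b A}"
      by (rule closure_minimal)
    then show ?thesis using tens_dense by auto
  qed
  then have "coord b c (X s t) + coord c b (X s t) = coord b c (tens (x t - x s) (x t - x s))"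
    by (simp flip: sym add: cb.add)
  also have "\<dots> = ((x t - x s) \<bullet> b) * ((x t - x s) \<bullet> c)"
    by (simp add: coord_tens[OF n1] inner_commute)
  also have "\<dots> = (proj B (x t - x s) \<bullet> b) * (proj B (x t - x s) \<bullet> c)"
    using bc by (simp add: proj_inner_basis[OF B])
  finally show "coord b c (X s t) + coord c b (X s t) = (proj B (x t - x s) \<bullet> b) * (proj B (x t - x s) \<bullet> c)" .
qed

text \<open>
  The projection and the polygon contribute \<open>\<delta> / 2\<close> each. The projection comes first, because its rank
  determines the length of the words from which the polygon is built.
\<close>
lemma weakly_geometric_smooth_close:
  assumes wg: "(x, X) \<in> weakly_geometric tens T \<alpha>"
    and T: "0 < T" and \<beta>: "0 < \<beta>" "\<beta> < \<alpha>" "\<alpha> < 1" and \<delta>: "0 < \<delta>"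
  shows "\<exists>y y'. smooth_path T y \<and> c1_path tens swap coord T y y' \<and>
    (\<forall>s t. 0 \<le> s \<longrightarrow> s \<le> t \<longrightarrow> t \<le> T \<longrightarrow>
      norm ((y t - y s) - (x t - x s)) \<le> \<delta> * (t - s) powr \<beta> \<and>
      norm (c1_path.area tens y y' s t - X s t) \<le> \<delta> * ((t - s) powr \<beta>)\<^sup>2)"
proof -
  have rp: "(x, X) \<in> rough_paths tens T \<alpha>" using wg by (simp add: weakly_geometric_def)
  obtain C where C: "1 \<le> C"
    and x_le: "\<And>s t. s \<in> {0..T} \<Longrightarrow> t \<in> {0..T} \<Longrightarrow> norm (x t - x s) \<le> C * \<bar>t - s\<bar> powr \<alpha>"
    and X_le: "\<And>s t. s \<in> {0..T} \<Longrightarrow> t \<in> {0..T} \<Longrightarrow> norm (X s t) \<le> C * (\<bar>t - s\<bar> powr \<alpha>)\<^sup>2"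
    using rough_paths_bound[OF rp] by blast
  have "0 < \<delta> / 2" using \<delta> by simp
  obtain B where B: "finite B" "orthonormal B" and near:
    "\<And>s t. 0 \<le> s \<Longrightarrow> s \<le> t \<Longrightarrow> t \<le> T \<Longrightarrow>
      norm (proj B (x t - x s) - (x t - x s)) \<le> \<delta> / 2 * (t - s) powr \<beta> \<and>
      norm (proj2 B (X s t) - X s t) \<le> \<delta> / 2 * ((t - s) powr \<beta>)\<^sup>2"
    using projection_close[OF rp T \<beta>(1,2) \<open>0 < \<delta> / 2\<close>] by metis
  define x' where "x' t = proj B (x t)" for t
  define X' where "X' s t = proj2 B (X s t)" for s t
  have incr: "x' t - x' s = proj B (x t - x s)" for s t
    by (simp add: x'_def linear_diff[OF linear_proj])
  have lin2: "linear (proj2 B)" by (rule bounded_linear.linear[OF bounded_linear_proj2[OF B(2)]])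
  have bounds: "norm (x t - x s) \<le> C * (t - s) powr \<alpha>" "norm (X s t) \<le> (C * (t - s) powr \<alpha>)\<^sup>2"
    if "0 \<le> s" "s \<le> t" "t \<le> T" for s t
  proof -
    show "norm (x t - x s) \<le> C * (t - s) powr \<alpha>" using x_le[of s t] that by auto
    have "norm (X s t) \<le> C * ((t - s) powr \<alpha>)\<^sup>2" using X_le[of s t] that by auto
    also have "\<dots> \<le> C\<^sup>2 * ((t - s) powr \<alpha>)\<^sup>2"
      using C by (intro mult_right_mono) (auto simp: power2_eq_square)
    finally show "norm (X s t) \<le> (C * (t - s) powr \<alpha>)\<^sup>2" by (simp add: power_mult_distrib)
  qed
  have "\<exists>y y'. smooth_path T y \<and> c1_path tens swap coord T y y' \<and>
    (\<forall>s t. 0 \<le> s \<longrightarrow> s \<le> t \<longrightarrow> t \<le> T \<longrightarrow>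
      norm ((y t - y s) - (x' t - x' s)) \<le> \<delta> / 2 * (t - s) powr \<beta> \<and>
      norm (c1_path.area tens y y' s t - X' s t) \<le> \<delta> / 2 * ((t - s) powr \<beta>)\<^sup>2)"
  proof (rule polygon_close[OF T \<beta> C _ \<open>0 < \<delta> / 2\<close>])
    show "0 < 1 + 4 * (card B)\<^sup>2" by simp
    fix s u t :: real
    assume "0 \<le> s" "s \<le> u" "u \<le> t" "t \<le> T"
    then have "X s t = X s u + X u t + tens (x u - x s) (x t - x u)"
      by (intro rough_paths_chen[OF rp]) auto
    then show "X' s t = X' s u + X' u t + tens (x' u - x' s) (x' t - x' u)"
      unfolding X'_def incr by (simp add: linear_add[OF lin2] proj2_tens[OF B(2)])
  next
    fix s t :: real
    assume st: "0 \<le> s" "s \<le> t" "t \<le> T"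
    show "norm (x' t - x' s) \<le> C * (t - s) powr \<alpha>"
      unfolding incr by (rule order_trans[OF norm_proj_le[OF B] bounds(1)[OF st]])
    show "norm (X' s t) \<le> (C * (t - s) powr \<alpha>)\<^sup>2"
      unfolding X'_def by (rule order_trans[OF norm_proj2_le[OF B] bounds(2)[OF st]])
    show "\<exists>vs. length vs = 1 + 4 * (card B)\<^sup>2 \<and> (\<forall>v\<in>set vs. norm v \<le> C * (t - s) powr \<alpha>) \<and>
        word_prod vs = (x' t - x' s, X' s t)"
      unfolding incr X'_def using st bounds[OF st] by (intro weakly_geometric_words[OF wg B]) auto
  qed
  then obtain y y' where y: "smooth_path T y" "c1_path tens swap coord T y y'" and y_close:
    "\<And>s t. 0 \<le> s \<Longrightarrow> s \<le> t \<Longrightarrow> t \<le> T \<Longrightarrow>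
      norm ((y t - y s) - (x' t - x' s)) \<le> \<delta> / 2 * (t - s) powr \<beta> \<and>
      norm (c1_path.area tens y y' s t - X' s t) \<le> \<delta> / 2 * ((t - s) powr \<beta>)\<^sup>2"
    by blast
  have "norm ((y t - y s) - (x t - x s)) \<le> \<delta> * (t - s) powr \<beta> \<and>
      norm (c1_path.area tens y y' s t - X s t) \<le> \<delta> * ((t - s) powr \<beta>)\<^sup>2"
    if st: "0 \<le> s" "s \<le> t" "t \<le> T" for s t
  proof -
    have "norm ((y t - y s) - (x t - x s)) \<le> \<delta> / 2 * (t - s) powr \<beta> + \<delta> / 2 * (t - s) powr \<beta>"
      using y_close[OF st] near[OF st] unfolding incr by (blast intro: norm_diff_triangle_le)
    moreover have "norm (c1_path.area tens y y' s t - X s t) \<le>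
        \<delta> / 2 * ((t - s) powr \<beta>)\<^sup>2 + \<delta> / 2 * ((t - s) powr \<beta>)\<^sup>2"
      using y_close[OF st] near[OF st] unfolding X'_def by (blast intro: norm_diff_triangle_le)
    ultimately show ?thesis by simp
  qed
  then show ?thesis using y by blast
qed

text \<open>
  The group distance is recovered from the two levelwise distances: with \<open>\<rho> = (t - s) powr \<beta>\<close>,
  the second level of the quotient of the two group elements is at most \<open>\<delta> * (2 + C) * \<rho>\<^sup>2\<close>, where
  \<open>C\<close> is the Hoelder constant of \<open>x\<close>.
\<close>
lemma weakly_geometric_subset_geometric:
  assumes T: "0 < T" and \<beta>: "0 < \<beta>" "\<beta> < \<alpha>" "\<alpha> < 1"
  shows "weakly_geometric tens T \<alpha> \<subseteq> geometric tens T \<beta>"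
proof
  fix Z assume Z: "Z \<in> weakly_geometric tens T \<alpha>"
  obtain x X where Z_eq: "Z = (x, X)" by force
  have rp\<beta>: "(x, X) \<in> rough_paths tens T \<beta>"
    using Z \<beta> by (intro rough_paths_mono[of \<beta> \<alpha>]) (auto simp: Z_eq weakly_geometric_def)
  obtain C where C: "1 \<le> C"
    and x_le: "\<And>s t. s \<in> {0..T} \<Longrightarrow> t \<in> {0..T} \<Longrightarrow> norm (x t - x s) \<le> C * \<bar>t - s\<bar> powr \<beta>"
    using rough_paths_bound[OF rp\<beta>] by blast
  have "\<exists>y. smooth_path T y \<and> rough_dist tens T \<beta> (canonical_lift tens T y) Z < ennreal \<epsilon>"
    if \<epsilon>: "0 < \<epsilon>" for \<epsilon>
  proof -
    define e where "e = \<epsilon> / 2"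
    have e: "0 < e" "e < \<epsilon>" using \<epsilon> by (auto simp: e_def)
    define \<delta> where "\<delta> = min 1 (min e (e\<^sup>2 / (2 + C)))"
    have \<delta>: "0 < \<delta>" "\<delta> \<le> 1" "\<delta> \<le> e" "\<delta> \<le> e\<^sup>2 / (2 + C)" using e C by (auto simp: \<delta>_def)
    have \<delta>2: "\<delta> * (2 + C) \<le> e\<^sup>2" using \<delta>(4) C by (simp add: pos_le_divide_eq)
    obtain y y' where smooth: "smooth_path T y" and c1: "c1_path tens swap coord T y y'" and close:
      "\<And>s t. 0 \<le> s \<Longrightarrow> s \<le> t \<Longrightarrow> t \<le> T \<Longrightarrow>
        norm ((y t - y s) - (x t - x s)) \<le> \<delta> * (t - s) powr \<beta> \<and>
        norm (c1_path.area tens y y' s t - X s t) \<le> \<delta> * ((t - s) powr \<beta>)\<^sup>2"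
      using weakly_geometric_smooth_close[OF Z[unfolded Z_eq] T \<beta> \<delta>(1)] by blast
    interpret y: c1_path tens swap coord T y y' by (rule c1)
    have "grp_dist tens (path2_incr (canonical_lift tens T y) s t) (path2_incr Z s t) / \<bar>t - s\<bar> powr \<beta> \<le> e"
      if st: "0 \<le> s" "s < t" "t \<le> T" for s t
    proof -
      define \<rho> where "\<rho> = (t - s) powr \<beta>"
      have \<rho>: "0 < \<rho>" using st by (simp add: \<rho>_def)
      define d where "d = (x t - x s) - (y t - y s)"
      have d: "norm d \<le> \<delta> * \<rho>" and R: "norm (X s t - y.area s t) \<le> \<delta> * \<rho>\<^sup>2"
        using close[of s t] st by (auto simp: d_def \<rho>_def norm_minus_commute)
      have "norm (y t - y s) \<le> norm (x t - x s) + norm d"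
        using norm_triangle_ineq4[of "x t - x s" d] by (simp add: d_def)
      also have "\<dots> \<le> C * \<rho> + \<rho>"
      proof (intro add_mono)
        show "norm (x t - x s) \<le> C * \<rho>" using x_le[of s t] st by (simp add: \<rho>_def)
        have "\<delta> * \<rho> \<le> 1 * \<rho>" using \<delta> \<rho> by (intro mult_right_mono) auto
        then show "norm d \<le> \<rho>" using d by simp
      qed
      finally have "norm (tens (y t - y s) d) \<le> (C * \<rho> + \<rho>) * (\<delta> * \<rho>)"
        unfolding norm_tens using d C \<rho> by (intro mult_mono) auto
      then have "norm (X s t - y.area s t - tens (y t - y s) d) \<le> \<delta> * \<rho>\<^sup>2 + (C * \<rho> + \<rho>) * (\<delta> * \<rho>)"
        by (rule order_trans[OF norm_triangle_ineq4 add_mono[OF R]])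
      also have "\<dots> = (\<delta> * (2 + C)) * \<rho>\<^sup>2" by (simp add: power2_eq_square algebra_simps)
      also have "\<dots> \<le> e\<^sup>2 * \<rho>\<^sup>2" using \<delta>2 by (rule mult_right_mono) simp
      finally have "sqrt (norm (X s t - y.area s t - tens (y t - y s) d)) \<le> e * \<rho>"
        using e \<rho> by (intro real_le_lsqrt) (auto simp: power_mult_distrib)
      moreover have "norm d \<le> e * \<rho>" using d mult_right_mono[OF \<delta>(3), of \<rho>] \<rho> by linarith
      ultimately have "grp_dist tens (y t - y s, y.area s t) (x t - x s, X s t) \<le> e * \<rho>"
        by (simp add: grp_dist_eq[OF bilinear] d_def)
      then show ?thesis
        using y.canonical_lift_eq[OF T, of s t] st \<rho>
        by (simp add: Z_eq path2_incr_def pos_divide_le_eq flip: \<rho>_def)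
    qed
    then have "rough_dist tens T \<beta> (canonical_lift tens T y) Z \<le> ennreal e"
      unfolding rough_dist_def by (intro SUP_least) (auto intro!: ennreal_leI)
    also have "\<dots> < ennreal \<epsilon>" using e by (simp add: ennreal_less_iff)
    finally show ?thesis using smooth by blast
  qed
  then show "Z \<in> geometric tens T \<beta>" using rp\<beta> by (simp add: geometric_def Z_eq)
qed

end

theorem theorem1p1:
  fixes J :: "('a::{real_inner,complete_space} \<Rightarrow>\<^sub>L 'a) \<Rightarrow> 'b::banach"
    and p :: ennreal and T \<alpha> \<beta> :: real
  assumes "1 \<le> p" and "schatten_completion p J"
    and "0 < T" and "1/3 < \<alpha>" and "\<alpha> < 1/2"
    and "1/3 < \<beta>" and "\<beta> < \<alpha>"
  shows "geometric (tensor J) T \<alpha> \<subseteq> weakly_geometric (tensor J) T \<alpha> \<and>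
         weakly_geometric (tensor J) T \<alpha> \<subseteq> geometric (tensor J) T \<beta>"
proof -
  interpret schatten_tensor J p using assms(1,2) by (rule schatten_tensor.intro)
  obtain swap coord where "hilbert_tensor (tensor J) swap coord"
    using hilbert_tensor_exists by blast
  then interpret hilbert_tensor "tensor J" swap coord .
  show ?thesis
    using geometric_subset_weakly_geometric[OF assms(3)]
      weakly_geometric_subset_geometric[of T \<beta> \<alpha>] assms by auto
qed

end
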